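(* Let $\vartheta>0$, let $(\lambda_i)_{i\geqslant1}$, $(r_i)_{i\geqslant1}$, $(\sigma_i^2)_{i\geqslant1}$ be sequences of positive numbers, and let $L$ be a non-negative random variable with Laplace transform $\ell(\gamma)=\mathbb{E}\,e^{-\gamma L}$. For $n\geqslant1$ put \[\nu_n^+:=\frac{\sqrt{r_n^2+2(\lambda_n+\vartheta)\sigma_n^2}}{\sigma_n^2}+\frac{r_n}{\sigma_n^2},\qquad \nu_n^-:=\frac{\sqrt{r_n^2+2(\lambda_n+\vartheta)\sigma_n^2}}{\sigma_n^2}-\frac{r_n}{\sigma_n^2}.\] Let $\psi_n(\gamma)$ be the transform of the ruin probability in the Brownian-perturbed model with $n$ initial obligors (defined in the context). Then $\psi_0(\gamma)=0$ for all $\gamma>0$, and for every $n\in\mathbb{N}=\{1,2,\ldots\}$ and every $\gamma>0$ with $\gamma\neq\nu_n^-$, \[\psi_n(\gamma)=\frac{1}{\gamma+\nu_n^+}+\frac{\lambda_n}{\lambda_n+\vartheta}\,\frac{1}{\gamma+\nu_n^+}\,\frac{\nu_n^+}{\gamma}-\frac{\lambda_n}{\lambda_n+\vartheta}\,\frac{\nu_n^-\nu_n^+}{(\gamma-\nu_n^-)(\gamma+\nu_n^+)}\Big(B(\nu_n^-,\psi_{n-1}(\nu_n^-))-B(\gamma,\psi_{n-1}(\gamma))\Big),\] where \[B(x,y):=\ell(x)\left(\frac1x-y\right).\]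
   Context: Model. At time $0$ there are $n$ obligors and the initial reserve is $u>0$. While $i\geqslant1$ obligors have not yet defaulted, the reserve evolves as a Brownian motion with drift coefficient $r_i$ and variance coefficient $\sigma_i^2$ (per unit time), and the time until the next default is exponentially distributed with mean $\lambda_i^{-1}$. At each default the number of obligors decreases by one and the reserve decreases by a loss distributed as $L$. The Brownian motions, inter-default times and losses are independent. When no obligors are left, the reserve no longer changes. The net cumulative loss at time $s$ is $u$ minus the reserve at time $s$ (so it starts at $0$). Let $Z_n\geqslant 0$ be the maximum of the net cumulative loss process over $[0,E]$, where $E$ is an exponentially distributed time with mean $\vartheta^{-1}$, independent of everything else. Then $p_n(u):=\mathbb{P}(Z_n\geqslant u)$ is the probability of ruin before time $E$, and for $\gamma>0$, \[\psi_n(\gamma):=\int_0^\infty e^{-\gamma u}p_n(u)\,\mathrm{d}u .\] *)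

theory Defs
  imports "HOL-Probability.Probability"
begin

text \<open>Brownian motion started at 0 with drift coefficient \<open>\<mu>\<close> and variance coefficient \<open>v\<close> per unit
  time; only times \<open>t \<ge> 0\<close> matter. Note that \<^const>\<open>normal_density\<close> takes the standard deviation.\<close>

definition brownian_motion :: "'a measure \<Rightarrow> real \<Rightarrow> real \<Rightarrow> (real \<Rightarrow> 'a \<Rightarrow> real) \<Rightarrow> bool" where
  "brownian_motion M \<mu> v X \<longleftrightarrow>
     (\<forall>t\<ge>0. X t \<in> borel_measurable M) \<and>
     (\<forall>\<omega>\<in>space M. X 0 \<omega> = 0) \<and>
     (\<forall>\<omega>\<in>space M. continuous_on {0..} (\<lambda>t. X t \<omega>)) \<and>
     (\<forall>s t. 0 \<le> s \<and> s < t \<longrightarrow>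
        distributed M lborel (\<lambda>\<omega>. X t \<omega> - X s \<omega>)
          (normal_density (\<mu> * (t - s)) (sqrt (v * (t - s))))) \<and>
     (\<forall>\<tau> :: nat \<Rightarrow> real. \<forall>m. 0 \<le> \<tau> 0 \<and> mono \<tau> \<longrightarrow>
        prob_space.indep_vars M (\<lambda>_. borel) (\<lambda>k \<omega>. X (\<tau> (Suc k)) \<omega> - X (\<tau> k) \<omega>) {..<m})"

text \<open>A realization of the random ingredients. Quantities indexed by \<open>i\<close> belong to the period in
  which exactly \<open>i\<close> obligors have not yet defaulted: \<open>motion R i\<close> is the Brownian motion, run from
  the start of that period, \<open>default_time R i\<close> the length of the period, and \<open>loss R i\<close> the loss at
  the default ending it. \<open>horizon R\<close> is the independent exponential time.\<close>

record 'a realization =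
  base :: "'a measure"
  motion :: "nat \<Rightarrow> real \<Rightarrow> 'a \<Rightarrow> real"
  default_time :: "nat \<Rightarrow> 'a \<Rightarrow> real"
  loss :: "nat \<Rightarrow> 'a \<Rightarrow> real"
  horizon :: "'a \<Rightarrow> real"

datatype source = Motion nat | Default nat | Loss nat | Horizon

primrec source_events :: "'a realization \<Rightarrow> source \<Rightarrow> 'a set set" where
  "source_events R (Motion i) =
     sets (vimage_algebra (space (base R)) (\<lambda>\<omega>. \<lambda>t\<in>{0..}. motion R i t \<omega>) (\<Pi>\<^sub>M t\<in>{0..}. borel))"
| "source_events R (Default i) =
     sets (vimage_algebra (space (base R)) (default_time R i) borel)"
| "source_events R (Loss i) =
     sets (vimage_algebra (space (base R)) (loss R i) borel)"
| "source_events R Horizon =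
     sets (vimage_algebra (space (base R)) (horizon R) borel)"

text \<open>\<open>R\<close> realizes the model with \<open>n\<close> initial obligors, killing rate \<open>\<theta>\<close>, default rates
  \<open>lam i\<close>, drifts \<open>r i\<close>, variance coefficients \<open>v i\<close> and loss distribution \<open>Q\<close>. Times are
  taken to be non-negative everywhere, not just almost everywhere.\<close>

definition obligor_model ::
  "real \<Rightarrow> (nat \<Rightarrow> real) \<Rightarrow> (nat \<Rightarrow> real) \<Rightarrow> (nat \<Rightarrow> real) \<Rightarrow> real measure \<Rightarrow> nat \<Rightarrow> 'a realization \<Rightarrow> bool"
where
  "obligor_model \<theta> lam r v Q n R \<longleftrightarrow>
     prob_space (base R) \<and>
     (\<forall>i\<in>{1..n}. brownian_motion (base R) (r i) (v i) (motion R i)) \<and>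
     (\<forall>i\<in>{1..n}. distributed (base R) lborel (default_time R i) (exponential_density (lam i))) \<and>
     (\<forall>i\<in>{1..n}. \<forall>\<omega>\<in>space (base R). 0 \<le> default_time R i \<omega>) \<and>
     (\<forall>i\<in>{1..n}. loss R i \<in> borel_measurable (base R) \<and> distr (base R) borel (loss R i) = Q) \<and>
     distributed (base R) lborel (horizon R) (exponential_density \<theta>) \<and>
     (\<forall>\<omega>\<in>space (base R). 0 \<le> horizon R \<omega>) \<and>
     prob_space.indep_sets (base R) (source_events R)
       (insert Horizon (\<Union>i\<in>{1..n}. {Motion i, Default i, Loss i}))"

text \<open>Reserve at time \<open>s\<close> after its starting value \<open>u\<close>, with \<open>n\<close> obligors present at the start. At
  a default epoch the loss has already been deducted (right-continuous paths).\<close>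

primrec reserve :: "'a realization \<Rightarrow> nat \<Rightarrow> real \<Rightarrow> real \<Rightarrow> 'a \<Rightarrow> real" where
  "reserve R 0 u s \<omega> = u"
| "reserve R (Suc m) u s \<omega> =
     (let T = default_time R (Suc m) \<omega> in
      if s < T then u + motion R (Suc m) s \<omega>
      else reserve R m (u + motion R (Suc m) T \<omega> - loss R (Suc m) \<omega>) (s - T) \<omega>)"

definition net_loss :: "'a realization \<Rightarrow> nat \<Rightarrow> real \<Rightarrow> real \<Rightarrow> 'a \<Rightarrow> real" where
  "net_loss R n u s \<omega> = u - reserve R n u s \<omega>"

lemma reserve_shift: "reserve R n (u + w) s \<omega> = w + reserve R n u s \<omega>"
proof (induction n arbitrary: u s)
  case (Suc n)
  show ?case
    using Suc[of "u + motion R (Suc n) (default_time R (Suc n) \<omega>) \<omega> - loss R (Suc n) \<omega>"]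
    by (simp add: Let_def algebra_simps)
qed simp

lemma net_loss_initial_reserve: "net_loss R n u s \<omega> = net_loss R n 0 s \<omega>"
  using reserve_shift[of R n 0 u s \<omega>] by (simp add: net_loss_def)

text \<open>In view of the preceding lemma the initial reserve is irrelevant here and is set to 0. The
  supremum is almost surely a maximum: paths are right-continuous and jump upwards only.\<close>

definition max_net_loss :: "'a realization \<Rightarrow> nat \<Rightarrow> 'a \<Rightarrow> real" where
  "max_net_loss R n \<omega> = (SUP s\<in>{0..horizon R \<omega>}. net_loss R n 0 s \<omega>)"

definition ruin_prob :: "'a realization \<Rightarrow> nat \<Rightarrow> real \<Rightarrow> real" where
  "ruin_prob R n u = measure (base R) {\<omega>\<in>space (base R). max_net_loss R n \<omega> \<ge> u}"

definition ruin_transform :: "'a realization \<Rightarrow> nat \<Rightarrow> real \<Rightarrow> real" where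
  "ruin_transform R n \<gamma> = (LINT u:{0<..}|lborel. exp (- \<gamma> * u) * ruin_prob R n u)"

definition nu_plus :: "real \<Rightarrow> (nat \<Rightarrow> real) \<Rightarrow> (nat \<Rightarrow> real) \<Rightarrow> (nat \<Rightarrow> real) \<Rightarrow> nat \<Rightarrow> real" where
  "nu_plus \<theta> lam r v n = sqrt ((r n)\<^sup>2 + 2 * (lam n + \<theta>) * v n) / v n + r n / v n"

definition nu_minus :: "real \<Rightarrow> (nat \<Rightarrow> real) \<Rightarrow> (nat \<Rightarrow> real) \<Rightarrow> (nat \<Rightarrow> real) \<Rightarrow> nat \<Rightarrow> real" where
  "nu_minus \<theta> lam r v n = sqrt ((r n)\<^sup>2 + 2 * (lam n + \<theta>) * v n) / v n - r n / v n"

definition laplace_transform :: "'b measure \<Rightarrow> ('b \<Rightarrow> real) \<Rightarrow> real \<Rightarrow> real" where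
  "laplace_transform N L \<gamma> = (LINT \<omega>|N. exp (- \<gamma> * L \<omega>))"

definition B_fun :: "(real \<Rightarrow> real) \<Rightarrow> real \<Rightarrow> real \<Rightarrow> real" where
  "B_fun l x y = l x * (1 / x - y)"

end

theory Submission
  imports Defs "HOL-Real_Asymp.Real_Asymp"
begin

text \<open>
  Write \<open>q = \<lambda>\<^sub>n + \<theta>\<close>, let \<open>X\<close> be the Brownian motion of the first period, and put
  \<open>M\<^sub>t = sup {- X\<^sub>u | u \<le> t}\<close> and \<open>W\<^sub>t = M\<^sub>t + X\<^sub>t\<close>. Whichever of the first default and the horizon comes
  first, it comes after an exponential time with rate \<open>q\<close>, and independently of that time it is the
  default with probability \<open>\<lambda>\<^sub>n / q\<close>. If it is the horizon, the maximal net loss is \<open>M\<close>. If it is the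
  default, the maximal net loss is \<open>max M (Y - X) = M + max 0 (Y - W)\<close>, where \<open>Y = L + Z\<close> and \<open>Z\<close> is
  the maximal net loss after the default; by lack of memory the remaining horizon is again exponential
  with rate \<open>\<theta>\<close>, so \<open>Z\<close> is a copy of the maximal net loss with \<open>n - 1\<close> obligors, independent of \<open>M\<close> and
  \<open>W\<close>. At an exponential time with rate \<open>q\<close> the variables \<open>M\<close> and \<open>W\<close> are independent and exponential
  with rates \<open>\<nu>\<^sup>+\<close> and \<open>\<nu>\<^sup>-\<close> (Wiener-Hopf factorization). Hence the Laplace transform of the maximal net
  loss is
  \<open>\<nu>\<^sup>+ / (\<nu>\<^sup>+ + \<gamma>) * (\<theta> / q + \<lambda>\<^sub>n / q * E (exp (- \<gamma> * max 0 (Y - W))))\<close>,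
  and the last expectation is a combination of the Laplace transforms of \<open>Y\<close> at \<open>\<gamma>\<close> and \<open>\<nu>\<^sup>-\<close>. The
  formula follows because \<open>\<psi> \<gamma> = (1 - E (exp (- \<gamma> * Z))) / \<gamma>\<close> for a maximal net loss \<open>Z\<close>. The lemma
  \<open>killed_loss_laplace_Suc\<close> is this recursion.

  The factorization (\<open>wiener_hopf\<close>) is obtained by sampling \<open>X\<close> on a grid of mesh \<open>h\<close>. On the grid
  \<open>(M, W)\<close> is driven by a Gaussian walk that is reflected at 0, and its joint transform, averaged over
  an exponential time, satisfies an exact equation (\<open>grid_laplace_equation\<close>)
  \<open>(1 - exp (- h * \<kappa> \<beta>)) * F \<alpha> \<beta> = (1 - exp (- q * h)) - exp (- q * h) * B \<alpha> \<beta>\<close>,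
  in which \<open>B\<close> collects what happens at the boundary. The left side vanishes at the root
  \<open>\<beta> = \<nu>\<^sup>+\<close> of \<open>\<kappa>\<close>, which reveals \<open>B \<alpha> \<nu>\<^sup>+\<close>; and \<open>B \<alpha> \<beta>\<close> is proportional to \<open>\<alpha> + \<beta>\<close> up to an error
  that is small because the walk overshoots the boundary only when it is near it, and it is rarely near it
  (\<open>grid_boundary_comparison\<close>, \<open>grid_laplace_decay\<close>). So \<open>F\<close> is known for all \<open>\<beta>\<close> in the limit
  \<open>h \<rightarrow> 0\<close>, and by the Weierstrass approximation theorem expectations of other functions of \<open>W\<close> are
  known as well.

  The realizations for different numbers of obligors live on unrelated probability spaces. They can be
  compared because the recursion determines the transform of the maximal net loss
  (\<open>killed_loss_laplace_unique\<close>); at the excluded argument \<open>\<gamma> = \<nu>\<^sup>-\<close> this needs right-continuity in \<open>\<gamma>\<close>.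
\<close>

section \<open>Exponential clocks\<close>

text \<open>A non-integrable function has Bochner integral 0, and \<open>0 \<le> B\<close> because the space is not empty.\<close>

lemma (in prob_space) abs_expectation_le:
  fixes f :: "'a \<Rightarrow> real"
  assumes "\<And>x. x \<in> space M \<Longrightarrow> \<bar>f x\<bar> \<le> B"
  shows "\<bar>expectation f\<bar> \<le> B"
proof (cases "integrable M f")
  case True
  have "\<bar>expectation f\<bar> \<le> expectation (\<lambda>x. \<bar>f x\<bar>)" by (rule integral_abs_bound)
  also have "\<dots> \<le> B" using True assms by (intro integral_le_const) auto
  finally show ?thesis .
next
  case False
  obtain x where "x \<in> space M" using not_empty by blast
  then have "0 \<le> B" using assms[of x] by auto
  with False show ?thesis by (simp add: not_integrable_integral_eq)
qed

abbreviation exp_law :: "real \<Rightarrow> real measure" where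
  "exp_law q \<equiv> density lborel (\<lambda>t. ennreal (exponential_density q t))"

lemma measurable_exp_law [simp]:
  "measurable (exp_law q) N = measurable borel N" "measurable N' (exp_law q) = measurable N' borel"
  by (auto simp: measurable_def)

lemma integral_exp_law:
  fixes f :: "real \<Rightarrow> real"
  assumes "0 < q" "f \<in> borel_measurable borel"
  shows "(\<integral>t. f t \<partial>exp_law q) = (\<integral>t. exponential_density q t * f t \<partial>lborel)"
  using assms by (subst integral_density) (auto simp: exponential_density_nonneg)

lemma AE_exp_law_pos: "0 < q \<Longrightarrow> AE t in exp_law q. 0 < t"
proof -
  assume "0 < q"
  have "AE t in lborel. t \<noteq> (0::real)" by (rule AE_lborel_singleton)
  then have "AE t in lborel. 0 < ennreal (exponential_density q t) \<longrightarrow> 0 < t"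
    by eventually_elim (auto simp: exponential_density_def)
  then show ?thesis by (subst AE_density) auto
qed

lemma integrable_exp_law_bounded:
  fixes f :: "real \<Rightarrow> real"
  assumes "0 < q" "f \<in> borel_measurable borel" "\<And>t. 0 < t \<Longrightarrow> \<bar>f t\<bar> \<le> B"
  shows "integrable (exp_law q) f"
proof -
  interpret prob_space "exp_law q" using assms(1) by (rule prob_space_exponential_density)
  show ?thesis
    using assms AE_exp_law_pos[OF assms(1)]
    by (intro integrable_const_bound[where B=B]) (auto elim!: eventually_mono)
qed

text \<open>Killing an exponential clock at rate \<open>b\<close> turns it into the faster clock with rate \<open>q + b\<close>.\<close>

lemma exp_law_tilt:
  fixes f :: "real \<Rightarrow> real"
  assumes "0 < q" "0 \<le> b" and [measurable]: "f \<in> borel_measurable borel"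
  shows "(\<integral>t. exp (- b * t) * f t \<partial>exp_law q) = q / (q + b) * (\<integral>t. f t \<partial>exp_law (q + b))"
proof -
  have "(\<integral>t. exp (- b * t) * f t \<partial>exp_law q) = (\<integral>t. exponential_density q t * (exp (- b * t) * f t) \<partial>lborel)"
    using assms by (intro integral_exp_law) auto
  also have "\<dots> = (\<integral>t. q / (q + b) * (exponential_density (q + b) t * f t) \<partial>lborel)"
    using assms by (intro Bochner_Integration.integral_cong)
      (auto simp: exponential_density_def field_simps mult_exp_exp)
  also have "\<dots> = q / (q + b) * (\<integral>t. f t \<partial>exp_law (q + b))"
    using assms by (subst integral_exp_law) auto
  finally show ?thesis .
qed

lemma exp_law_memoryless:
  fixes f :: "real \<Rightarrow> real"
  assumes "0 < q" "0 \<le> s" and [measurable]: "f \<in> borel_measurable borel"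
  shows "(\<integral>t. (if s \<le> t then f (t - s) else 0) \<partial>exp_law q) = exp (- q * s) * (\<integral>t. f t \<partial>exp_law q)"
proof -
  have "(\<integral>t. (if s \<le> t then f (t - s) else 0) \<partial>exp_law q)
      = (\<integral>t. exponential_density q t * (if s \<le> t then f (t - s) else 0) \<partial>lborel)"
    using assms by (intro integral_exp_law) auto
  also have "\<dots> = (\<integral>t. exponential_density q (s + 1 * t) * (if s \<le> s + 1 * t then f (s + 1 * t - s) else 0) \<partial>lborel)"
    by (subst lborel_integral_real_affine[where c=1 and t=s]) auto
  also have "\<dots> = (\<integral>t. exp (- q * s) * (exponential_density q t * f t) \<partial>lborel)"
    using assms(2) by (intro Bochner_Integration.integral_cong)
      (auto simp: exponential_density_def field_simps mult_exp_exp)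
  also have "\<dots> = exp (- q * s) * (\<integral>t. f t \<partial>exp_law q)"
    using assms by (subst integral_exp_law) auto
  finally show ?thesis .
qed

lemma exp_law_laplace:
  assumes "0 < q" "0 \<le> b"
  shows "(\<integral>t. exp (- b * t) \<partial>exp_law q) = q / (q + b)"
proof -
  interpret prob_space "exp_law (q + b)" using assms by (intro prob_space_exponential_density) auto
  show ?thesis using exp_law_tilt[of q b "\<lambda>_. 1"] assms prob_space by simp
qed

text \<open>Beyond \<open>y\<close> the integrand is 1 and contributes the tail \<open>exp (- \<nu> * y)\<close>; below \<open>y\<close> the integrand times
  the density is a single exponential with an elementary primitive.\<close>

lemma exp_law_overshoot:
  assumes "0 < \<nu>" "0 < \<gamma>" "\<gamma> \<noteq> \<nu>" "0 \<le> y"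
  shows "(\<integral>w. exp (- \<gamma> * max 0 (y - w)) \<partial>exp_law \<nu>) = (\<nu> * exp (- \<gamma> * y) - \<gamma> * exp (- \<nu> * y)) / (\<nu> - \<gamma>)"
proof -
  interpret prob_space "exp_law \<nu>" using assms by (intro prob_space_exponential_density) auto
  let ?lo = "\<lambda>w. if w < y then exp (- \<gamma> * (y - w)) else 0"
  let ?hi = "\<lambda>w. if y \<le> w then (\<lambda>_. 1::real) (w - y) else 0"
  have int: "integrable (exp_law \<nu>) ?lo" "integrable (exp_law \<nu>) ?hi"
    using assms by (auto intro!: integrable_exp_law_bounded[where B=1])
  have "(\<integral>w. exp (- \<gamma> * max 0 (y - w)) \<partial>exp_law \<nu>) = (\<integral>w. ?lo w + ?hi w \<partial>exp_law \<nu>)"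
    by (intro Bochner_Integration.integral_cong) auto
  also have "\<dots> = (\<integral>w. ?lo w \<partial>exp_law \<nu>) + (\<integral>w. ?hi w \<partial>exp_law \<nu>)"
    using int by (rule Bochner_Integration.integral_add)
  also have "(\<integral>w. ?hi w \<partial>exp_law \<nu>) = exp (- \<nu> * y)"
    using assms prob_space by (subst exp_law_memoryless) auto
  also have "(\<integral>w. ?lo w \<partial>exp_law \<nu>) = (\<integral>w. exponential_density \<nu> w * ?lo w \<partial>lborel)"
    using assms by (intro integral_exp_law) auto
  also have "\<dots> = (\<integral>w. indicator {0..y} w *\<^sub>R (\<nu> * exp (- \<gamma> * y) * exp ((\<gamma> - \<nu>) * w)) \<partial>lborel)"
  proof (rule integral_cong_AE)
    have "AE w in lborel. w \<noteq> y" by (rule AE_lborel_singleton)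
    then show "AE w in lborel. exponential_density \<nu> w * ?lo w =
        indicator {0..y} w *\<^sub>R (\<nu> * exp (- \<gamma> * y) * exp ((\<gamma> - \<nu>) * w))"
      by eventually_elim
        (auto simp: exponential_density_def mult_exp_exp algebra_simps split: split_indicator)
  qed auto
  also have "\<dots> = \<nu> * exp (- \<gamma> * y) / (\<gamma> - \<nu>) * exp ((\<gamma> - \<nu>) * y) - \<nu> * exp (- \<gamma> * y) / (\<gamma> - \<nu>) * exp ((\<gamma> - \<nu>) * 0)"
  proof (rule integral_FTC_atLeastAtMost)
    fix x
    have "((\<lambda>w. \<nu> * exp (- \<gamma> * y) / (\<gamma> - \<nu>) * exp ((\<gamma> - \<nu>) * w)) has_real_derivative
        \<nu> * exp (- \<gamma> * y) * exp ((\<gamma> - \<nu>) * x)) (at x within {0..y})"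
      using assms by (auto intro!: derivative_eq_intros)
    then show "((\<lambda>w. \<nu> * exp (- \<gamma> * y) / (\<gamma> - \<nu>) * exp ((\<gamma> - \<nu>) * w)) has_vector_derivative
        \<nu> * exp (- \<gamma> * y) * exp ((\<gamma> - \<nu>) * x)) (at x within {0..y})"
      by (simp add: has_real_derivative_iff_has_vector_derivative)
  qed (use assms in \<open>auto intro!: continuous_intros\<close>)
  also have "\<dots> = \<nu> / (\<gamma> - \<nu>) * (exp (- \<nu> * y) - exp (- \<gamma> * y))"
    by (simp add: mult_exp_exp algebra_simps diff_divide_distrib)
  finally show ?thesis using assms by (simp add: divide_simps) algebra
qed

text \<open>Of two independent clocks, \<open>t\<close> with rate \<open>a\<close> and \<open>e\<close> with rate \<open>b\<close>, the first rings at rate \<open>a + b\<close>,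
  and the residual time \<open>e - t\<close> of the second is again exponential with rate \<open>b\<close>.\<close>

lemma exp_law_race:
  fixes f :: "real \<Rightarrow> real" and g :: "real \<Rightarrow> real \<Rightarrow> real"
  assumes pos: "0 < a" "0 < b"
    and [measurable]: "f \<in> borel_measurable borel" "case_prod g \<in> borel_measurable (borel \<Otimes>\<^sub>M borel)"
    and bound: "\<And>x. \<bar>f x\<bar> \<le> 1" "\<And>x y. \<bar>g x y\<bar> \<le> 1"
  shows "(\<integral>e. \<integral>t. (if e < t then f e else g t (e - t)) \<partial>exp_law a \<partial>exp_law b)
     = b / (a + b) * (\<integral>e. f e \<partial>exp_law (a + b))
     + a / (a + b) * (\<integral>t. \<integral>s. g t s \<partial>exp_law b \<partial>exp_law (a + b))"
proof -
  interpret A: prob_space "exp_law a" using pos by (intro prob_space_exponential_density)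
  interpret B: prob_space "exp_law b" using pos by (intro prob_space_exponential_density)
  interpret pair_prob_space "exp_law a" "exp_law b" ..
  let ?F = "\<lambda>e t. if e < t then f e else 0" and ?G = "\<lambda>e t. if t \<le> e then g t (e - t) else 0"
  have Ft: "(\<integral>t. ?F e t \<partial>exp_law a) = exp (- a * e) * f e" if "0 < e" for e
  proof -
    have "(\<integral>t. ?F e t \<partial>exp_law a) = (\<integral>t. (if e \<le> t then (\<lambda>_. f e) (t - e) else 0) \<partial>exp_law a)"
    proof (rule integral_cong_AE)
      have "AE t in lborel. t \<noteq> e" by (rule AE_lborel_singleton)
      then show "AE t in exp_law a. ?F e t = (if e \<le> t then (\<lambda>_. f e) (t - e) else 0)"
        by (subst AE_density) (auto elim!: eventually_mono)
    qed auto
    also have "\<dots> = exp (- a * e) * f e"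
      using pos that A.prob_space by (subst exp_law_memoryless) auto
    finally show ?thesis .
  qed
  have int: "integrable (exp_law a \<Otimes>\<^sub>M exp_law b) (\<lambda>(t, e). ?G e t)"
    by (intro integrable_const_bound[where B=1]) (auto intro!: bound simp: split_beta')
  have "(\<integral>e. \<integral>t. (if e < t then f e else g t (e - t)) \<partial>exp_law a \<partial>exp_law b)
      = (\<integral>e. (\<integral>t. ?F e t \<partial>exp_law a) + (\<integral>t. ?G e t \<partial>exp_law a) \<partial>exp_law b)"
  proof (intro Bochner_Integration.integral_cong refl)
    fix e
    have "integrable (exp_law a) (?F e)" "integrable (exp_law a) (?G e)"
      using pos bound by (auto intro!: integrable_exp_law_bounded[where B=1])
    then show "(\<integral>t. (if e < t then f e else g t (e - t)) \<partial>exp_law a)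
        = (\<integral>t. ?F e t \<partial>exp_law a) + (\<integral>t. ?G e t \<partial>exp_law a)"
      by (simp flip: Bochner_Integration.integral_add)
        (intro Bochner_Integration.integral_cong, auto)
  qed
  also have "\<dots> = (\<integral>e. (\<integral>t. ?F e t \<partial>exp_law a) \<partial>exp_law b) + (\<integral>e. (\<integral>t. ?G e t \<partial>exp_law a) \<partial>exp_law b)"
  proof (rule Bochner_Integration.integral_add)
    have "\<bar>\<integral>t. ?F e t \<partial>exp_law a\<bar> \<le> 1" "\<bar>\<integral>t. ?G e t \<partial>exp_law a\<bar> \<le> 1" for e
      using bound by (auto intro!: A.abs_expectation_le)
    then show "integrable (exp_law b) (\<lambda>e. \<integral>t. ?F e t \<partial>exp_law a)" "integrable (exp_law b) (\<lambda>e. \<integral>t. ?G e t \<partial>exp_law a)"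
      using pos by (auto intro!: integrable_exp_law_bounded[where B=1])
  qed
  also have "(\<integral>e. (\<integral>t. ?F e t \<partial>exp_law a) \<partial>exp_law b) = (\<integral>e. exp (- a * e) * f e \<partial>exp_law b)"
    using AE_exp_law_pos[OF pos(2)] by (intro integral_cong_AE) (auto elim!: eventually_mono simp: Ft)
  also have "\<dots> = b / (a + b) * (\<integral>e. f e \<partial>exp_law (a + b))"
    using pos by (subst exp_law_tilt) (auto simp: add.commute)
  also have "(\<integral>e. (\<integral>t. ?G e t \<partial>exp_law a) \<partial>exp_law b) = (\<integral>t. (\<integral>e. ?G e t \<partial>exp_law b) \<partial>exp_law a)"
    using Fubini_integral[OF int] by simp
  also have "\<dots> = (\<integral>t. exp (- b * t) * (\<integral>s. g t s \<partial>exp_law b) \<partial>exp_law a)"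
    using AE_exp_law_pos[OF pos(1)] pos
    by (intro integral_cong_AE) (auto elim!: eventually_mono simp: exp_law_memoryless)
  also have "\<dots> = a / (a + b) * (\<integral>t. \<integral>s. g t s \<partial>exp_law b \<partial>exp_law (a + b))"
    using pos by (subst exp_law_tilt) auto
  finally show ?thesis .
qed

text \<open>The transform of a tail probability, read as an expectation over an exponential level \<open>u\<close>, reduces
  to this distribution function.\<close>

lemma exp_law_cdf:
  assumes "0 < \<gamma>"
  shows "(\<integral>u. indicator {..z} u \<partial>exp_law \<gamma>) = 1 - exp (- \<gamma> * max 0 z)"
proof -
  interpret prob_space "exp_law \<gamma>" using assms by (rule prob_space_exponential_density)
  let ?tail = "\<lambda>u. if max 0 z \<le> u then (\<lambda>_. 1::real) (u - max 0 z) else 0"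
  have "(\<integral>u. indicator {..z} u \<partial>exp_law \<gamma>) = (\<integral>u. 1 - ?tail u \<partial>exp_law \<gamma>)"
  proof (rule integral_cong_AE)
    have "AE u in lborel. u \<noteq> z" by (rule AE_lborel_singleton)
    then have "AE u in exp_law \<gamma>. u \<noteq> z" by (subst AE_density) (auto elim!: eventually_mono)
    then show "AE u in exp_law \<gamma>. indicator {..z} u = 1 - ?tail u"
      using AE_exp_law_pos[OF assms] by eventually_elim (auto split: split_indicator)
  qed measurable
  also have "\<dots> = 1 - (\<integral>u. ?tail u \<partial>exp_law \<gamma>)"
    using assms prob_space
    by (subst Bochner_Integration.integral_diff) (auto intro!: integrable_exp_law_bounded[where B=1])
  also have "(\<integral>u. ?tail u \<partial>exp_law \<gamma>) = exp (- \<gamma> * max 0 z)"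
    using assms prob_space by (subst exp_law_memoryless) auto
  finally show ?thesis .
qed

section \<open>Moments of Gaussian steps\<close>

text \<open>Completing the square: an exponential factor shifts the mean of a normal density.\<close>

lemma normal_density_tilt:
  assumes "0 < \<sigma>"
  shows "normal_density \<mu> \<sigma> x * exp (- b * x) = exp (b\<^sup>2 * \<sigma>\<^sup>2 / 2 - b * \<mu>) * normal_density (\<mu> - b * \<sigma>\<^sup>2) \<sigma> x"
proof -
  have "- (x - \<mu>)\<^sup>2 / (2 * \<sigma>\<^sup>2) + - b * x = (b\<^sup>2 * \<sigma>\<^sup>2 / 2 - b * \<mu>) + - (x - (\<mu> - b * \<sigma>\<^sup>2))\<^sup>2 / (2 * \<sigma>\<^sup>2)"
    using assms by (simp add: field_simps power2_eq_square)
  then show ?thesis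
    by (simp add: normal_density_def mult_exp_exp flip: exp_add)
qed

lemma (in prob_space) normal_laplace:
  assumes "distributed M lborel \<xi> (normal_density \<mu> \<sigma>)" "0 < \<sigma>"
  shows "integrable M (\<lambda>\<omega>. exp (- b * \<xi> \<omega>))"
    and "expectation (\<lambda>\<omega>. exp (- b * \<xi> \<omega>)) = exp (b\<^sup>2 * \<sigma>\<^sup>2 / 2 - b * \<mu>)"
proof -
  show "integrable M (\<lambda>\<omega>. exp (- b * \<xi> \<omega>))"
  proof -
    have "integrable lborel (\<lambda>x. normal_density \<mu> \<sigma> x * exp (- b * x))"
      unfolding normal_density_tilt[OF assms(2)] using assms(2) by simp
    then show ?thesis by (subst distributed_integrable[OF assms(1), symmetric]) auto
  qed
  show "expectation (\<lambda>\<omega>. exp (- b * \<xi> \<omega>)) = exp (b\<^sup>2 * \<sigma>\<^sup>2 / 2 - b * \<mu>)"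
  proof -
    have "expectation (\<lambda>\<omega>. exp (- b * \<xi> \<omega>)) = (\<integral>x. normal_density \<mu> \<sigma> x * exp (- b * x) \<partial>lborel)"
      by (subst distributed_integral[OF assms(1), symmetric]) auto
    then show ?thesis unfolding normal_density_tilt[OF assms(2)] using assms(2) by simp
  qed
qed

text \<open>These constants bound the moments of a step by powers of its standard deviation, uniformly in the
  mesh of the grid.\<close>

definition gauss_moment :: "nat \<Rightarrow> real \<Rightarrow> real" where
  "gauss_moment p c = (\<integral>z. std_normal_density z * (\<bar>z\<bar> ^ p * exp (c * \<bar>z\<bar>)) \<partial>lborel)"

lemma power_le_fact_exp:
  fixes x :: real assumes "0 \<le> x" shows "x ^ p \<le> fact p * exp x"
proof -
  have "x ^ p / fact p \<le> exp x"
  proof -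
    have "(\<Sum>n\<in>{p}. x ^ n / fact n) \<le> (\<Sum>n. x ^ n / fact n)"
      using assms summable_exp[of x] by (intro sum_le_suminf) (auto simp: field_simps)
    then show ?thesis by (simp add: exp_def scaleR_conv_of_real field_simps)
  qed
  then show ?thesis by (simp add: field_simps)
qed

lemma integrable_gauss_moment:
  "integrable lborel (\<lambda>z. std_normal_density z * (\<bar>z\<bar> ^ p * exp (c * \<bar>z\<bar>)))"
proof (rule Bochner_Integration.integrable_bound)
  let ?b = "\<lambda>z. fact p * (std_normal_density z * exp (- (c + 1) * z) + std_normal_density z * exp (- (- (c + 1)) * z))"
  show "integrable lborel ?b"
    unfolding normal_density_tilt[OF zero_less_one] by simp
  show "AE z in lborel. norm (std_normal_density z * (\<bar>z\<bar> ^ p * exp (c * \<bar>z\<bar>)))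
     \<le> norm (?b z)"
  proof (intro always_eventually allI)
    fix z :: real
    have "\<bar>z\<bar> ^ p * exp (c * \<bar>z\<bar>) \<le> fact p * exp \<bar>z\<bar> * exp (c * \<bar>z\<bar>)"
      using power_le_fact_exp[of "\<bar>z\<bar>" p] by (intro mult_right_mono) auto
    also have "\<dots> = fact p * exp ((c + 1) * \<bar>z\<bar>)"
      by (simp add: mult_exp_exp algebra_simps)
    also have "\<dots> \<le> fact p * (exp (- (c + 1) * z) + exp (- (- (c + 1)) * z))"
    proof (intro mult_left_mono)
      have "\<bar>z\<bar> = z \<or> \<bar>z\<bar> = - z" by auto
      then show "exp ((c + 1) * \<bar>z\<bar>) \<le> exp (- (c + 1) * z) + exp (- (- (c + 1)) * z)"
        by (auto simp del: minus_add_distrib simp: less_imp_le)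
    qed auto
    finally have "std_normal_density z * (\<bar>z\<bar> ^ p * exp (c * \<bar>z\<bar>))
        \<le> std_normal_density z * (fact p * (exp (- (c + 1) * z) + exp (- (- (c + 1)) * z)))"
      by (intro mult_left_mono) auto
    then show "norm (std_normal_density z * (\<bar>z\<bar> ^ p * exp (c * \<bar>z\<bar>)))
     \<le> norm (?b z)"
      by (simp add: algebra_simps abs_mult del: minus_add_distrib)
  qed
qed simp

lemma gauss_moment_nonneg: "0 \<le> gauss_moment p c"
  unfolding gauss_moment_def by (intro integral_nonneg_AE) auto

lemma normal_density_standardize:
  "0 < \<sigma> \<Longrightarrow> \<sigma> * normal_density \<mu> \<sigma> (\<mu> + \<sigma> * z) = std_normal_density z"
  by (simp add: normal_density_def power_mult_distrib real_sqrt_mult)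

lemma (in prob_space) normal_shortfall_moment:
  assumes \<xi>: "distributed M lborel \<xi> (normal_density \<mu> \<sigma>)" and "0 < \<sigma>" "\<sigma> \<le> s" "0 \<le> c"
  shows "integrable M (\<lambda>\<omega>. max 0 (\<mu> - \<xi> \<omega>) ^ p * exp (c * max 0 (\<mu> - \<xi> \<omega>)))" (is ?int)
    and "expectation (\<lambda>\<omega>. max 0 (\<mu> - \<xi> \<omega>) ^ p * exp (c * max 0 (\<mu> - \<xi> \<omega>))) \<le> \<sigma> ^ p * gauss_moment p (c * s)" (is ?le)
proof -
  let ?f = "\<lambda>x. max 0 (\<mu> - x) ^ p * exp (c * max 0 (\<mu> - x))"
  have eq: "\<sigma> * (normal_density \<mu> \<sigma> (\<mu> + \<sigma> * z) * ?f (\<mu> + \<sigma> * z)) = std_normal_density z * ?f (\<mu> + \<sigma> * z)" for z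
    using normal_density_standardize[OF \<open>0 < \<sigma>\<close>, of \<mu> z] by (simp add: mult.assoc[symmetric])
  have le: "?f (\<mu> + \<sigma> * z) \<le> \<sigma> ^ p * (\<bar>z\<bar> ^ p * exp (c * s * \<bar>z\<bar>))" for z
  proof -
    have m: "max 0 (\<mu> - (\<mu> + \<sigma> * z)) \<le> \<sigma> * \<bar>z\<bar>"
      using \<open>0 < \<sigma>\<close> by (auto simp: abs_if mult_le_0_iff)
    have "?f (\<mu> + \<sigma> * z) \<le> (\<sigma> * \<bar>z\<bar>) ^ p * exp (c * (\<sigma> * \<bar>z\<bar>))"
      using m assms by (intro mult_mono power_mono) (auto intro!: mult_left_mono)
    also have "\<dots> \<le> (\<sigma> * \<bar>z\<bar>) ^ p * exp (c * s * \<bar>z\<bar>)"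
      using assms by (intro mult_left_mono) (auto intro!: mult_mono simp: mult.assoc)
    finally show ?thesis by (simp add: power_mult_distrib mult.assoc)
  qed
  have le': "std_normal_density z * ?f (\<mu> + \<sigma> * z) \<le> \<sigma> ^ p * (std_normal_density z * (\<bar>z\<bar> ^ p * exp (c * s * \<bar>z\<bar>)))" for z
    using mult_left_mono[OF le[of z], of "std_normal_density z"] by (simp add: algebra_simps)
  have int0: "integrable lborel (\<lambda>z. std_normal_density z * ?f (\<mu> + \<sigma> * z))"
  proof (rule Bochner_Integration.integrable_bound)
    show "integrable lborel (\<lambda>z. \<sigma> ^ p * (std_normal_density z * (\<bar>z\<bar> ^ p * exp (c * s * \<bar>z\<bar>))))"
      using integrable_gauss_moment[of p "c * s"] by simp
    show "AE z in lborel. norm (std_normal_density z * ?f (\<mu> + \<sigma> * z))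
        \<le> norm (\<sigma> ^ p * (std_normal_density z * (\<bar>z\<bar> ^ p * exp (c * s * \<bar>z\<bar>))))"
      using le' assms by (intro always_eventually allI) (simp add: abs_mult)
  qed simp
  have "integrable lborel (\<lambda>x. normal_density \<mu> \<sigma> x * ?f x)"
  proof -
    have "integrable lborel (\<lambda>z. \<sigma> * (normal_density \<mu> \<sigma> (\<mu> + \<sigma> * z) * ?f (\<mu> + \<sigma> * z)))"
      using int0 unfolding eq .
    then have "integrable lborel (\<lambda>z. normal_density \<mu> \<sigma> (\<mu> + \<sigma> * z) * ?f (\<mu> + \<sigma> * z))"
      using \<open>0 < \<sigma>\<close> by simp
    then show ?thesis
      using \<open>0 < \<sigma>\<close> lborel_integrable_real_affine_iff[of \<sigma> "\<lambda>x. normal_density \<mu> \<sigma> x * ?f x" \<mu>] by simp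
  qed
  then show ?int
    by (subst distributed_integrable[OF \<xi>, symmetric]) auto
  have "expectation (\<lambda>\<omega>. ?f (\<xi> \<omega>)) = (\<integral>x. normal_density \<mu> \<sigma> x * ?f x \<partial>lborel)"
    by (subst distributed_integral[OF \<xi>, symmetric]) auto
  also have "\<dots> = \<bar>\<sigma>\<bar> *\<^sub>R (\<integral>z. normal_density \<mu> \<sigma> (\<mu> + \<sigma> * z) * ?f (\<mu> + \<sigma> * z) \<partial>lborel)"
    using \<open>0 < \<sigma>\<close> by (intro lborel_integral_real_affine) auto
  also have "\<dots> = (\<integral>z. \<sigma> * (normal_density \<mu> \<sigma> (\<mu> + \<sigma> * z) * ?f (\<mu> + \<sigma> * z)) \<partial>lborel)"
    using \<open>0 < \<sigma>\<close> by simp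
  also have "\<dots> = (\<integral>z. std_normal_density z * ?f (\<mu> + \<sigma> * z) \<partial>lborel)"
    unfolding eq ..
  also have "\<dots> \<le> (\<integral>z. \<sigma> ^ p * (std_normal_density z * (\<bar>z\<bar> ^ p * exp (c * s * \<bar>z\<bar>))) \<partial>lborel)"
    using int0 le' integrable_gauss_moment[of p "c * s"] by (intro integral_mono) auto
  finally show ?le by (simp add: gauss_moment_def)
qed

text \<open>By symmetry the shortfall below the mean carries exactly half of the variance. This factor one half is
  what makes \<open>grid_laplace_decay\<close> work.\<close>

lemma (in prob_space) normal_shortfall_second_moment:
  assumes \<xi>: "distributed M lborel \<xi> (normal_density \<mu> \<sigma>)" and "0 < \<sigma>"
  shows "expectation (\<lambda>\<omega>. (max 0 (\<mu> - \<xi> \<omega>))\<^sup>2) = \<sigma>\<^sup>2 / 2"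
proof -
  let ?l = "\<lambda>x. normal_density \<mu> \<sigma> x * (max 0 (\<mu> - x))\<^sup>2" and ?u = "\<lambda>x. normal_density \<mu> \<sigma> x * (max 0 (x - \<mu>))\<^sup>2"
  have full: "integrable lborel (\<lambda>x. normal_density \<mu> \<sigma> x * (x - \<mu>)\<^sup>2)"
    using integrable_normal_moment[OF \<open>0 < \<sigma>\<close>, of \<mu> 2] by simp
  have int: "integrable lborel ?l" "integrable lborel ?u"
    by (rule Bochner_Integration.integrable_bound[OF full];
        auto intro!: always_eventually mult_left_mono simp: abs_mult max_def power2_commute)+
  have "(\<integral>x. ?l x \<partial>lborel) = \<bar>- 1\<bar> *\<^sub>R (\<integral>x. ?l (2 * \<mu> + - 1 * x) \<partial>lborel)"
    by (intro lborel_integral_real_affine) auto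
  also have "\<dots> = (\<integral>x. ?u x \<partial>lborel)"
    by (auto intro!: Bochner_Integration.integral_cong simp: normal_density_def power2_commute algebra_simps)

  finally have "2 * (\<integral>x. ?l x \<partial>lborel) = (\<integral>x. ?l x \<partial>lborel) + (\<integral>x. ?u x \<partial>lborel)" by simp
  also have "\<dots> = (\<integral>x. normal_density \<mu> \<sigma> x * (x - \<mu>)\<^sup>2 \<partial>lborel)"
    using int by (simp flip: Bochner_Integration.integral_add)
      (intro Bochner_Integration.integral_cong, auto simp: max_def power2_commute)
  also have "\<dots> = \<sigma>\<^sup>2"
    using integral_normal_moment_even[OF \<open>0 < \<sigma>\<close>, of \<mu> 1] by simp
  finally show ?thesis
    by (subst distributed_integral[OF \<xi>, symmetric]) auto
qed

section \<open>The reflected Gaussian walk\<close>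

text \<open>The Lindley recursion and its regulator, that is, the total amount by which the walk had to be pushed
  up to stay non-negative. Applied to the increments of a path, the regulator is the running maximum
  of the negated path on the grid (see \<open>grid_regulator\<close>).\<close>

primrec reflected :: "(nat \<Rightarrow> real) \<Rightarrow> nat \<Rightarrow> real" where
  "reflected x 0 = 0"
| "reflected x (Suc k) = max 0 (reflected x k + x k)"

primrec regulator :: "(nat \<Rightarrow> real) \<Rightarrow> nat \<Rightarrow> real" where
  "regulator x 0 = 0"
| "regulator x (Suc k) = regulator x k + max 0 (- (reflected x k + x k))"

lemma reflected_nonneg [simp]: "0 \<le> reflected x k" by (cases k) auto

lemma regulator_nonneg [simp]: "0 \<le> regulator x k" by (induction k) auto

lemma reflected_regulator_cong:
  "(\<And>j. j < k \<Longrightarrow> x j = y j) \<Longrightarrow> reflected x k = reflected y k \<and> regulator x k = regulator y k"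
  by (induction k) auto

lemma measurable_reflected_regulator:
  assumes "k \<le> n"
  shows "(\<lambda>x. reflected x k) \<in> borel_measurable (\<Pi>\<^sub>M i\<in>{..<n}. borel)"
    "(\<lambda>x. regulator x k) \<in> borel_measurable (\<Pi>\<^sub>M i\<in>{..<n}. borel)"
  using assms
proof (induction k)
  case (Suc k)
  { case 1
    have [measurable]: "(\<lambda>x. x k) \<in> borel_measurable (\<Pi>\<^sub>M i\<in>{..<n}. (borel :: real measure))"
      using 1 by (intro measurable_component_singleton) auto
    show ?case using Suc.IH[measurable] 1 by simp }
  { case 2
    have [measurable]: "(\<lambda>x. x k) \<in> borel_measurable (\<Pi>\<^sub>M i\<in>{..<n}. (borel :: real measure))"
      using 2 by (intro measurable_component_singleton) auto
    show ?case using Suc.IH[measurable] 2 by simp }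
qed auto

text \<open>The difference quotient of \<open>s \<mapsto> exp (s * y)\<close> between \<open>- a\<close> and \<open>b\<close> is, by the mean value theorem, the
  derivative \<open>y * exp (s * y)\<close> at an intermediate point, hence \<open>y\<close> up to second order in \<open>y\<close>,
  uniformly in \<open>a\<close> and \<open>b\<close>.\<close>

lemma exp_secant_estimate:
  fixes a b c y :: real
  assumes "0 \<le> y" "0 \<le> a" "a \<le> c" "0 \<le> b" "b \<le> c" "0 < a + b"
  shows "\<bar>(exp (b * y) - exp (- a * y)) / (a + b) - y\<bar> \<le> c * (y\<^sup>2 * exp (c * y))"
proof -
  have "\<exists>s. - a < s \<and> s < b \<and> exp (b * y) - exp (- a * y) = (b - - a) * (y * exp (s * y))"
    using assms by (intro MVT2) (auto intro!: derivative_eq_intros)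
  then obtain s where s: "- a < s" "s < b" "exp (b * y) - exp (- a * y) = (a + b) * (y * exp (s * y))"
    by (auto simp: add.commute)
  have sc: "\<bar>s\<bar> \<le> c" using s assms by auto
  have "\<bar>exp (s * y) - 1\<bar> \<le> \<bar>s * y\<bar> * exp \<bar>s * y\<bar>"
  proof -
    have *: "exp x - 1 \<le> x * exp x" for x :: real
      using exp_ge_add_one_self[of "- x"] mult_left_mono[of "1 - x" "exp (- x)" "exp x"]
      by (simp add: algebra_simps mult_exp_exp)
    show ?thesis
    proof (cases "0 \<le> s * y")
      case True then show ?thesis using *[of "s * y"] by simp
    next
      case False
      then have "1 - exp (s * y) \<le> - (s * y)" using exp_ge_add_one_self[of "s * y"] by linarith
      also have "\<dots> \<le> - (s * y) * exp (- (s * y))" using False mult_left_mono[of 1 "exp (- (s * y))" "- (s * y)"] by simp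
      finally show ?thesis using False by simp
    qed
  qed
  also have "\<dots> \<le> (c * y) * exp (c * y)"
    using sc assms by (intro mult_mono) (auto simp: abs_mult intro!: mult_right_mono)
  finally have "y * \<bar>exp (s * y) - 1\<bar> \<le> y * ((c * y) * exp (c * y))"
    using assms by (intro mult_left_mono)
  moreover have "(exp (b * y) - exp (- a * y)) / (a + b) - y = y * (exp (s * y) - 1)"
    unfolding s(3) using assms by (simp add: right_diff_distrib)
  ultimately show ?thesis
    using assms by (simp only: abs_mult) (simp add: power2_eq_square mult_ac)
qed

lemma exp_cubic_estimate:
  fixes x :: real assumes "0 \<le> x"
  shows "exp x - 1 \<le> x + x\<^sup>2 / 2 + x ^ 3 * exp x"
proof -
  obtain t where t: "\<bar>t\<bar> \<le> \<bar>x\<bar>" "exp x = (\<Sum>m<3. x ^ m / fact m) + exp t / fact 3 * x ^ 3"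
    using Maclaurin_exp_le[of x 3] by blast
  have "exp t / fact 3 * x ^ 3 \<le> exp x * x ^ 3"
  proof (intro mult_right_mono)
    have "exp t / fact 3 \<le> exp t" by (simp add: fact_numeral)
    also have "\<dots> \<le> exp x" using t(1) assms by simp
    finally show "exp t / fact 3 \<le> exp x" .
  qed (use assms in auto)
  moreover have "(\<Sum>m<3. x ^ m / fact m) = 1 + x + x\<^sup>2 / 2"
    by (simp add: numeral_3_eq_3 power2_eq_square)
  ultimately show ?thesis using t(2) by (simp add: mult.commute)
qed

text \<open>The drift \<open>\<mu>\<close> is non-negative, so that a push is never larger than the shortfall of the step below its
  mean. The number \<open>s\<close> is a bound for \<open>\<sigma>\<close> that makes the moment estimates uniform in the mesh.\<close>

locale gaussian_walk = prob_space M for M :: "'a measure" +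
  fixes \<xi> :: "nat \<Rightarrow> 'a \<Rightarrow> real" and \<mu> \<sigma> s :: real
  assumes normal: "\<And>k. distributed M lborel (\<xi> k) (normal_density \<mu> \<sigma>)"
    and independent: "\<And>m. indep_vars (\<lambda>_. borel) \<xi> {..<m}"
    and \<sigma>: "0 < \<sigma>" "\<sigma> \<le> s" and \<mu>: "0 \<le> \<mu>"
begin

definition W :: "nat \<Rightarrow> 'a \<Rightarrow> real" where "W k \<omega> = reflected (\<lambda>i. \<xi> i \<omega>) k"
definition D :: "nat \<Rightarrow> 'a \<Rightarrow> real" where "D k \<omega> = regulator (\<lambda>i. \<xi> i \<omega>) k"
definition push :: "nat \<Rightarrow> 'a \<Rightarrow> real" where "push k \<omega> = max 0 (- (W k \<omega> + \<xi> k \<omega>))"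
definition shortfall :: "nat \<Rightarrow> 'a \<Rightarrow> real" where "shortfall k \<omega> = max 0 (\<mu> - \<xi> k \<omega>)"

lemma W_0 [simp]: "W 0 \<omega> = 0" and D_0 [simp]: "D 0 \<omega> = 0" by (auto simp: W_def D_def)

lemma W_Suc: "W (Suc k) \<omega> = max 0 (W k \<omega> + \<xi> k \<omega>)"
  and D_Suc: "D (Suc k) \<omega> = D k \<omega> + push k \<omega>"
  by (auto simp: W_def D_def push_def)

lemma W_nonneg [simp]: "0 \<le> W k \<omega>" and D_nonneg [simp]: "0 \<le> D k \<omega>"
  and push_nonneg [simp]: "0 \<le> push k \<omega>" and shortfall_nonneg [simp]: "0 \<le> shortfall k \<omega>"
  by (auto simp: W_def D_def push_def shortfall_def)

lemma push_le_shortfall: "push k \<omega> \<le> shortfall k \<omega>"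
  using \<mu> W_nonneg[of k \<omega>] by (auto simp: push_def shortfall_def simp del: W_nonneg)

lemma W_le_shortfall: "0 < push k \<omega> \<Longrightarrow> W k \<omega> \<le> shortfall k \<omega>"
  using \<mu> by (auto simp: push_def shortfall_def)

lemma measurable_step [measurable]: "\<xi> k \<in> borel_measurable M"
  using distributed_measurable[OF normal[of k]] by simp

lemma measurable_W [measurable]: "W k \<in> borel_measurable M"
proof (induction k)
  case (Suc k) then show ?case unfolding W_Suc by simp
qed (simp add: W_def)

lemma measurable_push [measurable]: "push k \<in> borel_measurable M"
  unfolding push_def by measurable

lemma measurable_shortfall [measurable]: "shortfall k \<in> borel_measurable M"
  unfolding shortfall_def by measurable

lemma measurable_D [measurable]: "D k \<in> borel_measurable M"
proof (induction k)
  case (Suc k) then show ?case unfolding D_Suc by simp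
qed (simp add: D_def)

text \<open>The position and the regulator after \<open>k\<close> steps are functions of the first \<open>k\<close> steps only.\<close>

lemma past_indep_step:
  assumes f: "f \<in> borel_measurable (borel \<Otimes>\<^sub>M borel)" and g: "g \<in> borel_measurable borel"
  shows "indep_var borel (\<lambda>\<omega>. f (D k \<omega>, W k \<omega>) :: real) borel (\<lambda>\<omega>. g (\<xi> k \<omega>) :: real)"
proof -
  let ?P = "\<lambda>A. \<Pi>\<^sub>M i\<in>A. (borel :: real measure)"
  have "indep_var (?P {..<k}) (\<lambda>\<omega>. restrict (\<lambda>i. \<xi> i \<omega>) {..<k}) (?P {k}) (\<lambda>\<omega>. restrict (\<lambda>i. \<xi> i \<omega>) {k})"
    using independent[of "Suc k"] by (rule indep_var_restrict) auto
  then have "indep_var borel ((\<lambda>x. f (regulator x k, reflected x k)) \<circ> (\<lambda>\<omega>. restrict (\<lambda>i. \<xi> i \<omega>) {..<k}))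
      borel ((\<lambda>x. g (x k)) \<circ> (\<lambda>\<omega>. restrict (\<lambda>i. \<xi> i \<omega>) {k}))"
  proof (rule indep_var_compose)
    note [measurable] = measurable_reflected_regulator[OF order_refl, of k] f g
    show "(\<lambda>x. f (regulator x k, reflected x k)) \<in> borel_measurable (?P {..<k})" by measurable
    show "(\<lambda>x. g (x k)) \<in> borel_measurable (?P {k})" by measurable
  qed
  moreover have "regulator (restrict (\<lambda>i. \<xi> i \<omega>) {..<k}) k = D k \<omega>"
    "reflected (restrict (\<lambda>i. \<xi> i \<omega>) {..<k}) k = W k \<omega>" for \<omega>
    using reflected_regulator_cong[of k "restrict (\<lambda>i. \<xi> i \<omega>) {..<k}" "\<lambda>i. \<xi> i \<omega>"]
    by (auto simp: D_def W_def)
  ultimately show ?thesis by (simp add: comp_def)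
qed

lemma expectation_past_step:
  assumes "f \<in> borel_measurable (borel \<Otimes>\<^sub>M borel)" "g \<in> borel_measurable borel"
    "integrable M (\<lambda>\<omega>. f (D k \<omega>, W k \<omega>) :: real)" "integrable M (\<lambda>\<omega>. g (\<xi> k \<omega>) :: real)"
  shows "integrable M (\<lambda>\<omega>. f (D k \<omega>, W k \<omega>) * g (\<xi> k \<omega>))"
    "expectation (\<lambda>\<omega>. f (D k \<omega>, W k \<omega>) * g (\<xi> k \<omega>))
      = expectation (\<lambda>\<omega>. f (D k \<omega>, W k \<omega>)) * expectation (\<lambda>\<omega>. g (\<xi> k \<omega>))"
  using past_indep_step[OF assms(1,2)] assms(3,4)
  by (auto intro: indep_var_integrable indep_var_lebesgue_integral)

lemma shortfall_moment:
  assumes "0 \<le> c"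
  shows "integrable M (\<lambda>\<omega>. shortfall k \<omega> ^ p * exp (c * shortfall k \<omega>))"
    and "expectation (\<lambda>\<omega>. shortfall k \<omega> ^ p * exp (c * shortfall k \<omega>)) \<le> \<sigma> ^ p * gauss_moment p (c * s)"
  using normal_shortfall_moment[OF normal \<sigma> assms] by (auto simp: shortfall_def)

definition joint_laplace :: "real \<Rightarrow> real \<Rightarrow> nat \<Rightarrow> real" where
  "joint_laplace \<alpha> \<beta> k = expectation (\<lambda>\<omega>. exp (- \<alpha> * D k \<omega> - \<beta> * W k \<omega>))"

abbreviation "boundary_integrand \<alpha> \<beta> k \<omega> \<equiv>
  exp (- \<alpha> * D k \<omega>) * (exp (\<beta> * push k \<omega>) - exp (- \<alpha> * push k \<omega>))"

definition boundary_term :: "real \<Rightarrow> real \<Rightarrow> nat \<Rightarrow> real" where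
  "boundary_term \<alpha> \<beta> k = expectation (\<lambda>\<omega>. boundary_integrand \<alpha> \<beta> k \<omega>)"

lemma joint_exponent_nonpos: "0 \<le> \<alpha> \<Longrightarrow> 0 \<le> \<beta> \<Longrightarrow> - \<alpha> * D k \<omega> - \<beta> * W k \<omega> \<le> 0"
proof -
  assume "0 \<le> \<alpha>" "0 \<le> \<beta>"
  then have "0 \<le> \<alpha> * D k \<omega>" "0 \<le> \<beta> * W k \<omega>" by simp_all
  then have "- (\<alpha> * D k \<omega>) - \<beta> * W k \<omega> \<le> 0" by linarith
  then show ?thesis by (simp only: mult_minus_left)
qed

lemma integrable_joint:
  "0 \<le> \<alpha> \<Longrightarrow> 0 \<le> \<beta> \<Longrightarrow> integrable M (\<lambda>\<omega>. exp (- \<alpha> * D k \<omega> - \<beta> * W k \<omega>))"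
  by (intro integrable_const_bound[where B=1]) (auto intro!: always_eventually dest: joint_exponent_nonpos)

lemma joint_laplace_bounds: "0 \<le> \<alpha> \<Longrightarrow> 0 \<le> \<beta> \<Longrightarrow> \<bar>joint_laplace \<alpha> \<beta> k\<bar> \<le> 1"
  unfolding joint_laplace_def by (intro abs_expectation_le) (auto dest: joint_exponent_nonpos)

lemma boundary_integrand_bounds:
  assumes "0 \<le> \<alpha>" "0 \<le> \<beta>"
  shows "0 \<le> boundary_integrand \<alpha> \<beta> k \<omega>"
    "boundary_integrand \<alpha> \<beta> k \<omega> \<le> exp (\<beta> * shortfall k \<omega>)"
proof -
  have 1: "exp (- \<alpha> * push k \<omega>) \<le> exp (\<beta> * push k \<omega>)"
    using assms by (auto intro: order_trans[of _ 0])
  then show "0 \<le> boundary_integrand \<alpha> \<beta> k \<omega>" by simp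
  have 2: "exp (\<beta> * push k \<omega>) \<le> exp (\<beta> * shortfall k \<omega>)"
    using assms push_le_shortfall[of k \<omega>] by (auto intro: mult_left_mono)
  have "boundary_integrand \<alpha> \<beta> k \<omega>
      \<le> 1 * (exp (\<beta> * push k \<omega>) - exp (- \<alpha> * push k \<omega>))"
    using 1 assms by (intro mult_right_mono) auto
  also have "\<dots> \<le> exp (\<beta> * push k \<omega>)" by simp
  finally show "boundary_integrand \<alpha> \<beta> k \<omega> \<le> exp (\<beta> * shortfall k \<omega>)"
    using 2 by linarith
qed

lemma integrable_boundary:
  assumes "0 \<le> \<alpha>" "0 \<le> \<beta>"
  shows "integrable M (\<lambda>\<omega>. boundary_integrand \<alpha> \<beta> k \<omega>)"
proof (rule Bochner_Integration.integrable_bound)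
  show "integrable M (\<lambda>\<omega>. exp (\<beta> * shortfall k \<omega>))"
    using shortfall_moment(1)[of \<beta> k 0] assms by simp
  show "AE \<omega> in M. norm (boundary_integrand \<alpha> \<beta> k \<omega>) \<le> norm (exp (\<beta> * shortfall k \<omega>))"
    using boundary_integrand_bounds[OF assms] by (intro always_eventually) auto
qed measurable

lemma boundary_term_bounds:
  assumes "0 \<le> \<alpha>" "0 \<le> \<beta>"
  shows "\<bar>boundary_term \<alpha> \<beta> k\<bar> \<le> gauss_moment 0 (\<beta> * s)"
proof -
  have "0 \<le> boundary_term \<alpha> \<beta> k"
    unfolding boundary_term_def using boundary_integrand_bounds[OF assms] by (intro integral_nonneg_AE) auto
  moreover have "boundary_term \<alpha> \<beta> k \<le> expectation (\<lambda>\<omega>. shortfall k \<omega> ^ 0 * exp (\<beta> * shortfall k \<omega>))"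
    unfolding boundary_term_def using boundary_integrand_bounds[OF assms] shortfall_moment(1)[of \<beta> k 0] assms
    by (intro integral_mono integrable_boundary) auto
  moreover have "\<dots> \<le> gauss_moment 0 (\<beta> * s)"
    using shortfall_moment(2)[of \<beta> k 0] assms by simp
  ultimately show ?thesis by linarith
qed

text \<open>Without reflection a step would multiply the joint transform by the transform of the step. Where the
  reflection acts, the factor \<open>exp (\<beta> * push)\<close> that this produces is replaced by \<open>exp (- \<alpha> * push)\<close>;
  the boundary term is the resulting correction.\<close>

lemma joint_laplace_Suc:
  assumes "0 \<le> \<alpha>" "0 \<le> \<beta>"
  shows "joint_laplace \<alpha> \<beta> (Suc k) = exp (\<beta>\<^sup>2 * \<sigma>\<^sup>2 / 2 - \<beta> * \<mu>) * joint_laplace \<alpha> \<beta> k - boundary_term \<alpha> \<beta> k"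
proof -
  let ?f = "\<lambda>(d, w). exp (- \<alpha> * d - \<beta> * w)" and ?g = "\<lambda>x. exp (- \<beta> * x)"
  have f: "?f \<in> borel_measurable (borel \<Otimes>\<^sub>M borel)" and g: "?g \<in> borel_measurable borel" by measurable
  have if': "integrable M (\<lambda>\<omega>. ?f (D k \<omega>, W k \<omega>))"
    using integrable_joint[OF assms] by simp
  note prod = expectation_past_step[OF f g if' normal_laplace(1)[OF normal \<sigma>(1)]]
  have "exp (- \<alpha> * D (Suc k) \<omega> - \<beta> * W (Suc k) \<omega>) = ?f (D k \<omega>, W k \<omega>) * ?g (\<xi> k \<omega>)
      - boundary_integrand \<alpha> \<beta> k \<omega>" for \<omega>
  proof (cases "0 \<le> W k \<omega> + \<xi> k \<omega>")
    case True
    then have "push k \<omega> = 0" "W (Suc k) \<omega> = W k \<omega> + \<xi> k \<omega>" by (auto simp: push_def W_Suc)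
    then show ?thesis by (simp add: D_Suc mult_exp_exp algebra_simps)
  next
    case False
    then have push: "push k \<omega> = - W k \<omega> - \<xi> k \<omega>" and W: "W (Suc k) \<omega> = 0" by (auto simp: push_def W_Suc)
    show ?thesis unfolding D_Suc push W by (simp add: D_Suc mult_exp_exp algebra_simps)
  qed
  then have "joint_laplace \<alpha> \<beta> (Suc k) = expectation (\<lambda>\<omega>. ?f (D k \<omega>, W k \<omega>) * ?g (\<xi> k \<omega>)) - boundary_term \<alpha> \<beta> k"
    unfolding joint_laplace_def boundary_term_def
    using prod(1) integrable_boundary[OF assms] by (simp del: split_conv)
  then show ?thesis
    unfolding prod(2) normal_laplace(2)[OF normal \<sigma>(1)] by (simp add: joint_laplace_def)
qed

abbreviation "prob_near \<epsilon> k \<equiv> expectation (\<lambda>\<omega>. indicator {..<\<epsilon>} (W k \<omega>))"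

text \<open>Markov's inequality for \<open>exp (- b * W)\<close>.\<close>

lemma prob_W_less_le:
  assumes "0 \<le> b"
  shows "prob_near \<epsilon> k \<le> exp (b * \<epsilon>) * joint_laplace 0 b k"
proof -
  have "indicator {..<\<epsilon>} (W k \<omega>) \<le> exp (b * \<epsilon>) * exp (- 0 * D k \<omega> - b * W k \<omega>)" for \<omega>
  proof (cases "W k \<omega> < \<epsilon>")
    case True
    then have "0 \<le> b * \<epsilon> - b * W k \<omega>" using assms by (simp add: mult_left_mono)
    with True show ?thesis by (simp add: mult_exp_exp)
  qed simp
  moreover have "integrable M (\<lambda>\<omega>. indicator {..<\<epsilon>} (W k \<omega>) :: real)"
    by (intro integrable_const_bound[where B=1]) auto
  ultimately have "prob_near \<epsilon> k \<le> expectation (\<lambda>\<omega>. exp (b * \<epsilon>) * exp (- 0 * D k \<omega> - b * W k \<omega>))"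
    using integrable_joint[of 0 b k] assms by (intro integral_mono) auto
  then show ?thesis by (simp add: joint_laplace_def)
qed

lemma expectation_near_boundary:
  assumes "0 \<le> c"
  shows "integrable M (\<lambda>\<omega>. indicator {..<\<epsilon>} (W k \<omega>) * (shortfall k \<omega> ^ p * exp (c * shortfall k \<omega>)))"
    "expectation (\<lambda>\<omega>. indicator {..<\<epsilon>} (W k \<omega>) * (shortfall k \<omega> ^ p * exp (c * shortfall k \<omega>)))
     = prob_near \<epsilon> k * expectation (\<lambda>\<omega>. shortfall k \<omega> ^ p * exp (c * shortfall k \<omega>))"
proof -
  let ?f = "\<lambda>(d::real, w::real). indicator {..<\<epsilon>} w :: real"
  let ?g = "\<lambda>x. max 0 (\<mu> - x) ^ p * exp (c * max 0 (\<mu> - x))"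
  have f: "?f \<in> borel_measurable (borel \<Otimes>\<^sub>M borel)" and g: "?g \<in> borel_measurable borel" by measurable
  have "integrable M (\<lambda>\<omega>. ?f (D k \<omega>, W k \<omega>))"
    by (intro integrable_const_bound[where B=1]) auto
  from expectation_past_step[OF f g this] shortfall_moment(1)[OF assms, of k p]
  show "integrable M (\<lambda>\<omega>. indicator {..<\<epsilon>} (W k \<omega>) * (shortfall k \<omega> ^ p * exp (c * shortfall k \<omega>)))"
    "expectation (\<lambda>\<omega>. indicator {..<\<epsilon>} (W k \<omega>) * (shortfall k \<omega> ^ p * exp (c * shortfall k \<omega>)))
     = prob_near \<epsilon> k * expectation (\<lambda>\<omega>. shortfall k \<omega> ^ p * exp (c * shortfall k \<omega>))"
    by (auto simp: shortfall_def)
qed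

text \<open>A push requires that the step falls short by at least the current position. Hence either the walk is
  within \<open>\<epsilon>\<close> of the boundary, or the shortfall is at least \<open>\<epsilon>\<close> and a factor \<open>shortfall / \<epsilon>\<close> can be
  inserted.\<close>

lemma push_square_le:
  assumes "0 < \<epsilon>" "0 \<le> c"
  shows "push k \<omega> ^ 2 * exp (c * push k \<omega>)
    \<le> indicator {..<\<epsilon>} (W k \<omega>) * (shortfall k \<omega> ^ 2 * exp (c * shortfall k \<omega>))
      + shortfall k \<omega> ^ 3 * exp (c * shortfall k \<omega>) / \<epsilon>"
proof (cases "push k \<omega> = 0")
  case True then show ?thesis using assms by (auto intro!: add_nonneg_nonneg mult_nonneg_nonneg)
next
  case False
  let ?a = "shortfall k \<omega>"
  have "0 < push k \<omega>" using False push_nonneg[of k \<omega>] by linarith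
  have *: "push k \<omega> ^ 2 * exp (c * push k \<omega>) \<le> ?a ^ 2 * exp (c * ?a)"
    using push_le_shortfall[of k \<omega>] assms by (intro mult_mono power_mono) (auto intro: mult_left_mono)
  show ?thesis
  proof (cases "W k \<omega> < \<epsilon>")
    case True
    have "0 \<le> ?a ^ 3 * exp (c * ?a) / \<epsilon>" using assms by simp
    with * True show ?thesis by simp
  next
    case False
    with W_le_shortfall[OF \<open>0 < push k \<omega>\<close>] have "1 \<le> ?a / \<epsilon>" using assms by simp
    then have "?a ^ 2 * exp (c * ?a) * 1 \<le> ?a ^ 2 * exp (c * ?a) * (?a / \<epsilon>)"
      by (intro mult_left_mono) auto
    with * False show ?thesis by (simp add: power3_eq_cube power2_eq_square mult_ac)
  qed
qed

lemma integrable_push_square: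
  assumes "0 \<le> c" shows "integrable M (\<lambda>\<omega>. push k \<omega> ^ 2 * exp (c * push k \<omega>))"
proof (rule Bochner_Integration.integrable_bound)
  show "integrable M (\<lambda>\<omega>. shortfall k \<omega> ^ 2 * exp (c * shortfall k \<omega>))"
    using shortfall_moment(1)[OF assms] .
  show "AE \<omega> in M. norm (push k \<omega> ^ 2 * exp (c * push k \<omega>)) \<le> norm (shortfall k \<omega> ^ 2 * exp (c * shortfall k \<omega>))"
    using push_le_shortfall assms
    by (intro always_eventually allI) (auto simp: abs_mult intro!: mult_mono power_mono intro: mult_left_mono)
qed measurable

lemma expectation_push_square:
  assumes "0 < \<epsilon>" "0 \<le> c"
  shows "expectation (\<lambda>\<omega>. push k \<omega> ^ 2 * exp (c * push k \<omega>))
    \<le> prob_near \<epsilon> k * expectation (\<lambda>\<omega>. shortfall k \<omega> ^ 2 * exp (c * shortfall k \<omega>))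
      + \<sigma> ^ 3 * gauss_moment 3 (c * s) / \<epsilon>"
proof -
  note near = expectation_near_boundary[OF assms(2), of \<epsilon> k 2] and far = shortfall_moment[OF assms(2), of k 3]
  have "expectation (\<lambda>\<omega>. push k \<omega> ^ 2 * exp (c * push k \<omega>))
    \<le> expectation (\<lambda>\<omega>. indicator {..<\<epsilon>} (W k \<omega>) * (shortfall k \<omega> ^ 2 * exp (c * shortfall k \<omega>))
      + shortfall k \<omega> ^ 3 * exp (c * shortfall k \<omega>) / \<epsilon>)"
    using near(1) far(1) integrable_push_square[OF assms(2)] push_square_le[OF assms]
    by (intro integral_mono) auto
  also have "\<dots> = prob_near \<epsilon> k * expectation (\<lambda>\<omega>. shortfall k \<omega> ^ 2 * exp (c * shortfall k \<omega>))
      + expectation (\<lambda>\<omega>. shortfall k \<omega> ^ 3 * exp (c * shortfall k \<omega>)) / \<epsilon>"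
    unfolding near(2)[symmetric] using near(1) far(1) by simp
  also have "expectation (\<lambda>\<omega>. shortfall k \<omega> ^ 3 * exp (c * shortfall k \<omega>)) / \<epsilon> \<le> \<sigma> ^ 3 * gauss_moment 3 (c * s) / \<epsilon>"
    using far(2) assms by (intro divide_right_mono) auto
  finally show ?thesis by simp
qed

lemma push_square_small:
  assumes "0 < \<epsilon>" "0 \<le> c" "0 \<le> b"
  shows "expectation (\<lambda>\<omega>. push k \<omega> ^ 2 * exp (c * push k \<omega>))
    \<le> \<sigma>\<^sup>2 * gauss_moment 2 (c * s) * exp (b * \<epsilon>) * joint_laplace 0 b k + \<sigma> ^ 3 * gauss_moment 3 (c * s) / \<epsilon>"
proof -
  have "prob_near \<epsilon> k * expectation (\<lambda>\<omega>. shortfall k \<omega> ^ 2 * exp (c * shortfall k \<omega>))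
     \<le> (exp (b * \<epsilon>) * joint_laplace 0 b k) * (\<sigma>\<^sup>2 * gauss_moment 2 (c * s))"
    using prob_W_less_le[OF assms(3), of \<epsilon> k] shortfall_moment(2)[OF assms(2), of k 2]
    by (intro mult_mono) (auto simp: joint_laplace_def intro!: integral_nonneg_AE mult_nonneg_nonneg)
  with expectation_push_square[OF assms(1,2), of k] show ?thesis by (simp add: mult_ac)
qed

text \<open>To first order the boundary term is \<open>\<alpha> + \<beta>\<close> times an expectation that does not depend on \<open>\<beta>\<close>, the
  mean discounted push; the error is quadratic in the push.\<close>

lemma boundary_term_comparison:
  assumes "0 \<le> \<alpha>" "\<alpha> \<le> c" "0 \<le> \<beta>" "\<beta> \<le> c" "0 \<le> b" "b \<le> c" "0 < \<alpha> + \<beta>" "0 < \<alpha> + b"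
  shows "\<bar>boundary_term \<alpha> \<beta> k / (\<alpha> + \<beta>) - boundary_term \<alpha> b k / (\<alpha> + b)\<bar>
    \<le> 2 * c * expectation (\<lambda>\<omega>. push k \<omega> ^ 2 * exp (c * push k \<omega>))"
proof -
  let ?F = "\<lambda>\<beta> \<omega>. exp (- \<alpha> * D k \<omega>) * (exp (\<beta> * push k \<omega>) - exp (- \<alpha> * push k \<omega>)) / (\<alpha> + \<beta>)"
  have int: "integrable M (?F \<beta>)" "integrable M (?F b)"
    using integrable_boundary assms by auto
  have le: "\<bar>?F \<beta> \<omega> - ?F b \<omega>\<bar> \<le> 2 * c * (push k \<omega> ^ 2 * exp (c * push k \<omega>))" for \<omega>
  proof -
    let ?s = "\<lambda>\<beta>. (exp (\<beta> * push k \<omega>) - exp (- \<alpha> * push k \<omega>)) / (\<alpha> + \<beta>)"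
    have "\<bar>?s \<beta> - push k \<omega>\<bar> \<le> c * (push k \<omega> ^ 2 * exp (c * push k \<omega>))" "\<bar>?s b - push k \<omega>\<bar> \<le> c * (push k \<omega> ^ 2 * exp (c * push k \<omega>))"
      using assms by (intro exp_secant_estimate; simp)+
    then have *: "\<bar>?s \<beta> - ?s b\<bar> \<le> 2 * c * (push k \<omega> ^ 2 * exp (c * push k \<omega>))" by linarith
    have "\<bar>?F \<beta> \<omega> - ?F b \<omega>\<bar> = exp (- \<alpha> * D k \<omega>) * \<bar>?s \<beta> - ?s b\<bar>"
      by (simp add: abs_mult flip: right_diff_distrib times_divide_eq_right)
    also have "\<dots> \<le> 1 * \<bar>?s \<beta> - ?s b\<bar>" using assms by (intro mult_right_mono) auto
    also have "\<dots> \<le> 2 * c * (push k \<omega> ^ 2 * exp (c * push k \<omega>))" using * by (simp only: mult_1)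
    finally show ?thesis .
  qed
  have "\<bar>boundary_term \<alpha> \<beta> k / (\<alpha> + \<beta>) - boundary_term \<alpha> b k / (\<alpha> + b)\<bar> = \<bar>expectation (\<lambda>\<omega>. ?F \<beta> \<omega> - ?F b \<omega>)\<bar>"
    using int by (simp add: boundary_term_def)
  also have "\<dots> \<le> expectation (\<lambda>\<omega>. \<bar>?F \<beta> \<omega> - ?F b \<omega>\<bar>)"
    by (rule integral_abs_bound)
  also have "\<dots> \<le> expectation (\<lambda>\<omega>. 2 * c * (push k \<omega> ^ 2 * exp (c * push k \<omega>)))"
    using int integrable_push_square[of c k] assms le by (intro integral_mono) auto
  finally show ?thesis by simp
qed

text \<open>The linear part of \<open>exp (\<beta> * push) - 1\<close> is controlled by the boundary term at the fixed argument \<open>\<nu>\<close>.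
  The quadratic part has coefficient \<open>\<beta>\<^sup>2 * \<sigma>\<^sup>2 / 4\<close>, half of the coefficient \<open>\<beta>\<^sup>2 * \<sigma>\<^sup>2 / 2\<close> by which
  a step inflates the transform.\<close>

lemma boundary_term_growth:
  assumes "0 < \<nu>" "0 < \<beta>" "0 < \<epsilon>"
  shows "boundary_term 0 \<beta> k \<le> \<beta> / \<nu> * boundary_term 0 \<nu> k
    + \<beta>\<^sup>2 * \<sigma>\<^sup>2 / 4 * exp (\<beta> * \<epsilon>) * joint_laplace 0 \<beta> k
    + \<sigma> ^ 3 * (\<beta>\<^sup>2 / (2 * \<epsilon>) * gauss_moment 3 0 + \<beta> ^ 3 * gauss_moment 3 (\<beta> * s))"
proof -
  let ?y = "push k" and ?a = "shortfall k"
  have int: "integrable M (\<lambda>\<omega>. exp (\<nu> * ?y \<omega>) - 1)" "integrable M (\<lambda>\<omega>. exp (\<beta> * ?y \<omega>) - 1)"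
    "integrable M (\<lambda>\<omega>. (?y \<omega>)\<^sup>2)" "integrable M (\<lambda>\<omega>. ?a \<omega> ^ 3 * exp (\<beta> * ?a \<omega>))"
    using integrable_boundary[of 0 \<nu> k] integrable_boundary[of 0 \<beta> k] integrable_push_square[of 0 k]
      shortfall_moment(1)[of \<beta> k 3] assms by auto
  have le: "exp (\<beta> * ?y \<omega>) - 1 \<le> \<beta> / \<nu> * (exp (\<nu> * ?y \<omega>) - 1) + \<beta>\<^sup>2 / 2 * (?y \<omega>)\<^sup>2
      + \<beta> ^ 3 * (?a \<omega> ^ 3 * exp (\<beta> * ?a \<omega>))" for \<omega>
  proof -
    have "\<beta> * ?y \<omega> \<le> \<beta> / \<nu> * (exp (\<nu> * ?y \<omega>) - 1)"
    proof -
      have "\<nu> * ?y \<omega> \<le> exp (\<nu> * ?y \<omega>) - 1" using exp_ge_add_one_self[of "\<nu> * ?y \<omega>"] by linarith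
      then have "\<beta> / \<nu> * (\<nu> * ?y \<omega>) \<le> \<beta> / \<nu> * (exp (\<nu> * ?y \<omega>) - 1)"
        using assms by (intro mult_left_mono) auto
      then show ?thesis using assms by simp
    qed
    moreover have "(?y \<omega>) ^ 3 * exp (\<beta> * ?y \<omega>) \<le> ?a \<omega> ^ 3 * exp (\<beta> * ?a \<omega>)"
      using push_le_shortfall[of k \<omega>] assms by (intro mult_mono power_mono) auto
    then have "(\<beta> * ?y \<omega>) ^ 3 * exp (\<beta> * ?y \<omega>) \<le> \<beta> ^ 3 * (?a \<omega> ^ 3 * exp (\<beta> * ?a \<omega>))"
      using assms by (simp add: power_mult_distrib mult.assoc)
    moreover have "exp (\<beta> * ?y \<omega>) - 1 \<le> \<beta> * ?y \<omega> + (\<beta> * ?y \<omega>)\<^sup>2 / 2 + (\<beta> * ?y \<omega>) ^ 3 * exp (\<beta> * ?y \<omega>)"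
      using assms by (intro exp_cubic_estimate) simp
    moreover have "(\<beta> * ?y \<omega>)\<^sup>2 / 2 = \<beta>\<^sup>2 / 2 * (?y \<omega>)\<^sup>2" by (simp add: power_mult_distrib)
    ultimately show ?thesis by linarith
  qed
  have "boundary_term 0 \<beta> k = expectation (\<lambda>\<omega>. exp (\<beta> * ?y \<omega>) - 1)" by (simp add: boundary_term_def)
  also have "\<dots> \<le> expectation (\<lambda>\<omega>. \<beta> / \<nu> * (exp (\<nu> * ?y \<omega>) - 1) + \<beta>\<^sup>2 / 2 * (?y \<omega>)\<^sup>2
      + \<beta> ^ 3 * (?a \<omega> ^ 3 * exp (\<beta> * ?a \<omega>)))"
    using int le by (intro integral_mono) (auto simp del: times_divide_eq_left)
  also have "\<dots> = \<beta> / \<nu> * expectation (\<lambda>\<omega>. exp (\<nu> * ?y \<omega>) - 1) + \<beta>\<^sup>2 / 2 * expectation (\<lambda>\<omega>. (?y \<omega>)\<^sup>2)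
      + \<beta> ^ 3 * expectation (\<lambda>\<omega>. ?a \<omega> ^ 3 * exp (\<beta> * ?a \<omega>))"
    using int by (simp del: times_divide_eq_left)
  also have "expectation (\<lambda>\<omega>. exp (\<nu> * ?y \<omega>) - 1) = boundary_term 0 \<nu> k" by (simp add: boundary_term_def)
  also have "expectation (\<lambda>\<omega>. ?a \<omega> ^ 3 * exp (\<beta> * ?a \<omega>)) \<le> \<sigma> ^ 3 * gauss_moment 3 (\<beta> * s)"
    using shortfall_moment(2)[of \<beta> k 3] assms by simp
  also have "expectation (\<lambda>\<omega>. (?y \<omega>)\<^sup>2) \<le> (\<sigma>\<^sup>2 / 2) * (exp (\<beta> * \<epsilon>) * joint_laplace 0 \<beta> k) + \<sigma> ^ 3 * gauss_moment 3 0 / \<epsilon>"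
  proof -
    have "expectation (\<lambda>\<omega>. (?a \<omega>)\<^sup>2) = \<sigma>\<^sup>2 / 2"
      using normal_shortfall_second_moment[OF normal \<sigma>(1), of k] by (simp add: shortfall_def)
    moreover have "(\<sigma>\<^sup>2 / 2) * prob_near \<epsilon> k \<le> (\<sigma>\<^sup>2 / 2) * (exp (\<beta> * \<epsilon>) * joint_laplace 0 \<beta> k)"
      using prob_W_less_le[of \<beta> \<epsilon> k] assms by (intro mult_left_mono) auto
    ultimately show ?thesis
      using expectation_push_square[OF assms(3), of 0 k]
      by (simp only: mult_zero_left exp_zero mult_1_right order_refl simp_thms) (simp add: mult.commute)
  qed
  finally show ?thesis using assms by (simp add: algebra_simps mult_left_mono)
qed

end

section \<open>The running maximum of a continuous path\<close>

definition running_max :: "(real \<Rightarrow> 'a \<Rightarrow> real) \<Rightarrow> real \<Rightarrow> 'a \<Rightarrow> real" where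
  "running_max X t \<omega> = (SUP u\<in>{0..t}. - X u \<omega>)"

definition grid_step :: "(real \<Rightarrow> 'a \<Rightarrow> real) \<Rightarrow> real \<Rightarrow> nat \<Rightarrow> 'a \<Rightarrow> real" where
  "grid_step X h k \<omega> = X (h * real (Suc k)) \<omega> - X (h * real k) \<omega>"

text \<open>The regulator grows exactly when the negated path reaches a new maximum on the grid.\<close>

lemma grid_regulator:
  fixes X :: "real \<Rightarrow> 'a \<Rightarrow> real"
  assumes "X 0 \<omega> = 0"
  shows "reflected (\<lambda>i. grid_step X h i \<omega>) k = regulator (\<lambda>i. grid_step X h i \<omega>) k + X (h * real k) \<omega>"
    and "j \<le> k \<Longrightarrow> - X (h * real j) \<omega> \<le> regulator (\<lambda>i. grid_step X h i \<omega>) k"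
    and "\<exists>j\<le>k. regulator (\<lambda>i. grid_step X h i \<omega>) k = - X (h * real j) \<omega>"
proof -
  let ?x = "\<lambda>i. grid_step X h i \<omega>"
  have *: "reflected ?x k = regulator ?x k + X (h * real k) \<omega>" for k
  proof (induction k)
    case (Suc k)
    then show ?case by (auto simp: grid_step_def max_def)
  qed (simp add: assms)
  then show "reflected ?x k = regulator ?x k + X (h * real k) \<omega>" .
  have step: "regulator ?x (Suc k) = max (regulator ?x k) (- X (h * real (Suc k)) \<omega>)" for k
    using *[of k] by (auto simp: grid_step_def max_def)
  show "j \<le> k \<Longrightarrow> - X (h * real j) \<omega> \<le> regulator ?x k"
  proof (induction k)
    case (Suc k)
    then show ?case unfolding step by (cases "j = Suc k") (auto simp: le_max_iff_disj)
  qed (simp add: assms)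
  show "\<exists>j\<le>k. regulator ?x k = - X (h * real j) \<omega>"
  proof (induction k)
    case (Suc k)
    then obtain j where j: "j \<le> k" "regulator ?x k = - X (h * real j) \<omega>" by blast
    show ?case
    proof (cases "regulator ?x (Suc k) = regulator ?x k")
      case True then show ?thesis using j by (intro exI[of _ j]) auto
    next
      case False then show ?thesis unfolding step by (intro exI[of _ "Suc k"]) auto
    qed
  qed (simp add: assms)
qed

definition mesh :: "nat \<Rightarrow> real" where "mesh n = 1 / real (Suc n)"

lemma mesh: "0 < mesh n" "mesh n \<le> 1" by (auto simp: mesh_def)

lemma mesh_tendsto: "mesh \<longlonglongrightarrow> 0"
  unfolding mesh_def[abs_def] using LIMSEQ_inverse_real_of_nat by (simp add: inverse_eq_divide)

lemma grid_point_tendsto: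
  assumes "0 \<le> u" shows "(\<lambda>n. mesh n * real (nat \<lfloor>u / mesh n\<rfloor>)) \<longlonglongrightarrow> u"
proof (rule tendsto_sandwich)
  have eq: "real (nat \<lfloor>u / mesh n\<rfloor>) = real_of_int \<lfloor>u / mesh n\<rfloor>" for n
    using assms mesh[of n] by simp
  have "u - mesh n \<le> mesh n * real (nat \<lfloor>u / mesh n\<rfloor>)" for n
  proof -
    have "u / mesh n - 1 \<le> real (nat \<lfloor>u / mesh n\<rfloor>)" unfolding eq by linarith
    then have "mesh n * (u / mesh n - 1) \<le> mesh n * real (nat \<lfloor>u / mesh n\<rfloor>)"
      using mesh[of n] by (intro mult_left_mono) auto
    then show ?thesis using mesh[of n] by (simp add: right_diff_distrib)
  qed
  then show "\<forall>\<^sub>F n in sequentially. u - mesh n \<le> mesh n * real (nat \<lfloor>u / mesh n\<rfloor>)" by simp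
  have "mesh n * real (nat \<lfloor>u / mesh n\<rfloor>) \<le> u" for n
  proof -
    have "mesh n * real (nat \<lfloor>u / mesh n\<rfloor>) \<le> mesh n * (u / mesh n)"
      unfolding eq using mesh[of n] by (intro mult_left_mono) auto
    then show ?thesis using mesh[of n] by simp
  qed
  then show "\<forall>\<^sub>F n in sequentially. mesh n * real (nat \<lfloor>u / mesh n\<rfloor>) \<le> u" by simp
  show "(\<lambda>n. u - mesh n) \<longlonglongrightarrow> u" using tendsto_diff[OF tendsto_const mesh_tendsto, of u] by simp
qed simp

lemma grid_point_le: "0 \<le> u \<Longrightarrow> j \<le> nat \<lfloor>u / mesh n\<rfloor> \<Longrightarrow> mesh n * real j \<le> u"
proof -
  assume u: "0 \<le> u" "j \<le> nat \<lfloor>u / mesh n\<rfloor>"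
  then have "int j \<le> \<lfloor>u / mesh n\<rfloor>" using mesh[of n] by (simp add: le_nat_iff)
  then have "real j \<le> u / mesh n" by (simp add: le_floor_iff)
  then show ?thesis using mesh[of n] by (simp add: field_simps)
qed

lemma path_bdd_above:
  fixes X :: "real \<Rightarrow> 'a \<Rightarrow> real"
  assumes "continuous_on {0..} (\<lambda>t. X t \<omega>)"
  shows "bdd_above ((\<lambda>u. - X u \<omega>) ` {0..t::real})"
proof -
  have "continuous_on {0..t} (\<lambda>u. - X u \<omega>)"
    by (intro continuous_on_minus continuous_on_subset[OF assms(1)]) auto
  then have "compact ((\<lambda>u. - X u \<omega>) ` {0..t})" by (intro compact_continuous_image) auto
  then show ?thesis by (intro bounded_imp_bdd_above compact_imp_bounded)
qed

lemma running_max_upper: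
  fixes X :: "real \<Rightarrow> 'a \<Rightarrow> real"
  assumes "continuous_on {0..} (\<lambda>t. X t \<omega>)" "0 \<le> u" "u \<le> t"
  shows "- X u \<omega> \<le> running_max X t \<omega>"
  unfolding running_max_def using assms by (intro cSUP_upper path_bdd_above) auto

lemma running_max_attained:
  fixes X :: "real \<Rightarrow> 'a \<Rightarrow> real"
  assumes "continuous_on {0..} (\<lambda>t. X t \<omega>)" "0 \<le> t"
  obtains u where "0 \<le> u" "u \<le> t" "running_max X t \<omega> = - X u \<omega>"
proof -
  have "continuous_on {0..t} (\<lambda>u. - X u \<omega>)"
    by (intro continuous_on_minus continuous_on_subset[OF assms(1)]) auto
  then obtain u where u: "u \<in> {0..t}" "\<And>u'. u' \<in> {0..t} \<Longrightarrow> - X u' \<omega> \<le> - X u \<omega>"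
    using continuous_attains_sup[of "{0..t}" "\<lambda>u. - X u \<omega>"] assms by auto
  have "running_max X t \<omega> = - X u \<omega>"
    unfolding running_max_def using u by (intro cSup_eq_maximum) auto
  with u that show ?thesis by auto
qed

lemma running_max_nonneg:
  fixes X :: "real \<Rightarrow> 'a \<Rightarrow> real"
  assumes "continuous_on {0..} (\<lambda>t. X t \<omega>)" "X 0 \<omega> = 0" "0 \<le> t"
  shows "0 \<le> running_max X t \<omega>"
  using running_max_upper[where X=X and \<omega>=\<omega> and u=0 and t=t, OF assms(1)] assms by simp

lemma grid_path_tendsto:
  fixes X :: "real \<Rightarrow> 'a \<Rightarrow> real"
  assumes "continuous_on {0..} (\<lambda>t. X t \<omega>)" "0 \<le> t"
  shows "(\<lambda>n. X (mesh n * real (nat \<lfloor>t / mesh n\<rfloor>)) \<omega>) \<longlonglongrightarrow> X t \<omega>"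
  using continuous_on_tendsto_compose[OF assms(1) grid_point_tendsto[OF assms(2)]] assms(2)
    mesh(1) by (simp add: less_imp_le)

text \<open>From below, the grid points next to a maximizer \<open>u\<close> are eventually as good as \<open>u\<close>, by continuity.\<close>

lemma grid_regulator_tendsto:
  fixes X :: "real \<Rightarrow> 'a \<Rightarrow> real"
  assumes cont: "continuous_on {0..} (\<lambda>t. X t \<omega>)" and "X 0 \<omega> = 0" "0 \<le> t"
  shows "(\<lambda>n. regulator (\<lambda>i. grid_step X (mesh n) i \<omega>) (nat \<lfloor>t / mesh n\<rfloor>)) \<longlonglongrightarrow> running_max X t \<omega>"
proof -
  let ?D = "\<lambda>n. regulator (\<lambda>i. grid_step X (mesh n) i \<omega>) (nat \<lfloor>t / mesh n\<rfloor>)"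
  obtain u where u: "0 \<le> u" "u \<le> t" "running_max X t \<omega> = - X u \<omega>"
    using running_max_attained[where X=X and \<omega>=\<omega>, OF cont \<open>0 \<le> t\<close>] .
  show ?thesis
  proof (rule tendsto_sandwich)
    show "(\<lambda>n. - X (mesh n * real (nat \<lfloor>u / mesh n\<rfloor>)) \<omega>) \<longlonglongrightarrow> running_max X t \<omega>"
      unfolding u(3) using u by (intro tendsto_minus grid_path_tendsto cont)
    have "- X (mesh n * real (nat \<lfloor>u / mesh n\<rfloor>)) \<omega> \<le> ?D n" for n
      using u mesh(1)[of n] \<open>X 0 \<omega> = 0\<close>
      by (intro grid_regulator(2)) (auto intro!: nat_mono floor_mono divide_right_mono)
    then show "\<forall>\<^sub>F n in sequentially. - X (mesh n * real (nat \<lfloor>u / mesh n\<rfloor>)) \<omega> \<le> ?D n"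
      by simp
    have "?D n \<le> running_max X t \<omega>" for n
    proof -
      obtain j where j: "j \<le> nat \<lfloor>t / mesh n\<rfloor>" "?D n = - X (mesh n * real j) \<omega>"
        using grid_regulator(3)[of X \<omega> "nat \<lfloor>t / mesh n\<rfloor>" "mesh n"] \<open>X 0 \<omega> = 0\<close> by blast
      show ?thesis unfolding j(2)
        using grid_point_le[OF \<open>0 \<le> t\<close> j(1)] mesh(1)[of n] by (intro running_max_upper cont) auto
    qed
    then show "\<forall>\<^sub>F n in sequentially. ?D n \<le> running_max X t \<omega>"
      by simp
  qed simp
qed

lemma measurable_grid_point:
  fixes X :: "real \<Rightarrow> 'a \<Rightarrow> real"
  assumes "\<And>t. 0 \<le> t \<Longrightarrow> X t \<in> borel_measurable F"
  shows "(\<lambda>(\<omega>, t). X (mesh n * real (nat \<lfloor>max 0 t / mesh n\<rfloor>)) \<omega>) \<in> borel_measurable (F \<Otimes>\<^sub>M borel)"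
proof -
  have [measurable]: "X (mesh n * real i) \<in> borel_measurable F" for i
    using mesh(1)[of n] by (intro assms) simp
  show ?thesis
    unfolding split_beta'
    by (rule measurable_compose_countable[where f="\<lambda>i p. X (mesh n * real i) (fst p)"]) measurable
qed

text \<open>A path that is continuous in time is the pointwise limit of its values on the grid, and these are
  measurable because they depend on time through countably many values only. Negative times are
  replaced by 0, since the paths are constrained on non-negative times only.\<close>

lemma measurable_path:
  fixes X :: "real \<Rightarrow> 'a \<Rightarrow> real"
  assumes meas: "\<And>t. 0 \<le> t \<Longrightarrow> X t \<in> borel_measurable F"
    and cont: "\<And>\<omega>. \<omega> \<in> space F \<Longrightarrow> continuous_on {0..} (\<lambda>t. X t \<omega>)"
  shows "(\<lambda>(\<omega>, t). X (max 0 t) \<omega>) \<in> borel_measurable (F \<Otimes>\<^sub>M borel)"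
proof (rule borel_measurable_LIMSEQ_real)
  show "(\<lambda>(\<omega>, t). X (mesh n * real (nat \<lfloor>max 0 t / mesh n\<rfloor>)) \<omega>) \<in> borel_measurable (F \<Otimes>\<^sub>M borel)" for n
    by (rule measurable_grid_point[OF meas])
  fix p assume "p \<in> space (F \<Otimes>\<^sub>M (borel :: real measure))"
  then show "(\<lambda>n. case p of (\<omega>, t) \<Rightarrow> X (mesh n * real (nat \<lfloor>max 0 t / mesh n\<rfloor>)) \<omega>) \<longlonglongrightarrow> (case p of (\<omega>, t) \<Rightarrow> X (max 0 t) \<omega>)"
    by (auto simp: space_pair_measure intro!: grid_path_tendsto cont)
qed

lemma measurable_running_max:
  fixes X :: "real \<Rightarrow> 'a \<Rightarrow> real"
  assumes meas: "\<And>t. 0 \<le> t \<Longrightarrow> X t \<in> borel_measurable F"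
    and cont: "\<And>\<omega>. \<omega> \<in> space F \<Longrightarrow> continuous_on {0..} (\<lambda>t. X t \<omega>)"
    and start: "\<And>\<omega>. \<omega> \<in> space F \<Longrightarrow> X 0 \<omega> = 0"
  shows "(\<lambda>(\<omega>, t). running_max X (max 0 t) \<omega>) \<in> borel_measurable (F \<Otimes>\<^sub>M borel)"
proof (rule borel_measurable_LIMSEQ_real)
  fix n
  let ?reg = "\<lambda>k \<omega>. regulator (\<lambda>i. grid_step X (mesh n) i \<omega>) k"
  have [measurable]: "grid_step X (mesh n) i \<in> borel_measurable F" for i
    unfolding grid_step_def[abs_def] using mesh(1)[of n]
    by (intro borel_measurable_diff meas) auto
  have "(\<lambda>\<omega>. reflected (\<lambda>i. grid_step X (mesh n) i \<omega>) k) \<in> borel_measurable F" for k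
    by (induction k) auto
  note [measurable] = this
  have [measurable]: "?reg k \<in> borel_measurable F" for k
    by (induction k) auto
  show "(\<lambda>(\<omega>, t). ?reg (nat \<lfloor>max 0 t / mesh n\<rfloor>) \<omega>) \<in> borel_measurable (F \<Otimes>\<^sub>M borel)"
    unfolding split_beta'
    by (rule measurable_compose_countable[where f="\<lambda>k p. ?reg k (fst p)"]) measurable
next
  fix p assume "p \<in> space (F \<Otimes>\<^sub>M (borel :: real measure))"
  then show "(\<lambda>n. case p of (\<omega>, t) \<Rightarrow> regulator (\<lambda>i. grid_step X (mesh n) i \<omega>) (nat \<lfloor>max 0 t / mesh n\<rfloor>))
      \<longlonglongrightarrow> (case p of (\<omega>, t) \<Rightarrow> running_max X (max 0 t) \<omega>)"
    by (auto simp: space_pair_measure intro!: grid_regulator_tendsto cont start)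
qed

lemma measurable_path_compose:
  fixes X :: "real \<Rightarrow> 'a \<Rightarrow> real"
  assumes "\<And>t. 0 \<le> t \<Longrightarrow> X t \<in> borel_measurable F"
    and "\<And>\<omega>. \<omega> \<in> space F \<Longrightarrow> continuous_on {0..} (\<lambda>t. X t \<omega>)"
    and "f \<in> borel_measurable N" "g \<in> measurable N F"
  shows "(\<lambda>x. X (max 0 (f x)) (g x)) \<in> borel_measurable N"
  using measurable_compose[OF measurable_Pair[OF assms(4,3)] measurable_path[OF assms(1,2)]] by simp

lemma measurable_running_max_compose:
  fixes X :: "real \<Rightarrow> 'a \<Rightarrow> real"
  assumes "\<And>t. 0 \<le> t \<Longrightarrow> X t \<in> borel_measurable F"
    and "\<And>\<omega>. \<omega> \<in> space F \<Longrightarrow> continuous_on {0..} (\<lambda>t. X t \<omega>)"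
    and "\<And>\<omega>. \<omega> \<in> space F \<Longrightarrow> X 0 \<omega> = 0"
    and "f \<in> borel_measurable N" "g \<in> measurable N F"
  shows "(\<lambda>x. running_max X (max 0 (f x)) (g x)) \<in> borel_measurable N"
  using measurable_compose[OF measurable_Pair[OF assms(5,4)] measurable_running_max[OF assms(1-3)]] by simp

section \<open>The Wiener-Hopf factorization for Brownian motion with drift\<close>

text \<open>The expectation of \<open>f\<close> at the index of the grid cell that contains an exponential time. This index is
  geometrically distributed, which is what \<open>grid_average_Suc\<close> expresses.\<close>

definition grid_average :: "real \<Rightarrow> real \<Rightarrow> (nat \<Rightarrow> real) \<Rightarrow> real" where
  "grid_average q h f = (\<integral>t. f (nat \<lfloor>t / h\<rfloor>) \<partial>exp_law q)"

context
  fixes q h :: real assumes q: "0 < q" and h: "0 < h"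
begin

lemma integrable_grid:
  "(\<And>k. \<bar>f k\<bar> \<le> B) \<Longrightarrow> integrable (exp_law q) (\<lambda>t. f (nat \<lfloor>t / h\<rfloor>) :: real)"
  using q by (intro integrable_exp_law_bounded[where B=B]) auto

lemma grid_average_mono:
  assumes "\<And>k. \<bar>f k\<bar> \<le> B" "\<And>k. \<bar>g k\<bar> \<le> C" "\<And>k. f k \<le> g k"
  shows "grid_average q h f \<le> grid_average q h g"
  unfolding grid_average_def using assms
  by (intro integral_mono integrable_grid[where B=B] integrable_grid[where B=C]) auto

lemma grid_average_diff:
  assumes "\<And>k. \<bar>f k\<bar> \<le> B" "\<And>k. \<bar>g k\<bar> \<le> C"
  shows "grid_average q h (\<lambda>k. f k - g k) = grid_average q h f - grid_average q h g"
  unfolding grid_average_def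
  by (intro Bochner_Integration.integral_diff integrable_grid[where B=B] integrable_grid[where B=C] assms)

lemma grid_average_add:
  assumes "\<And>k. \<bar>f k\<bar> \<le> B" "\<And>k. \<bar>g k\<bar> \<le> C"
  shows "grid_average q h (\<lambda>k. f k + g k) = grid_average q h f + grid_average q h g"
  unfolding grid_average_def
  by (intro Bochner_Integration.integral_add integrable_grid[where B=B] integrable_grid[where B=C] assms)

lemma grid_average_cmult: "grid_average q h (\<lambda>k. c * f k) = c * grid_average q h f"
  unfolding grid_average_def by simp

lemma grid_average_const: "grid_average q h (\<lambda>k. c) = c"
proof -
  interpret prob_space "exp_law q" using q by (rule prob_space_exponential_density)
  show ?thesis using prob_space by (simp add: grid_average_def)
qed

lemma grid_average_abs_le:
  "\<bar>grid_average q h f\<bar> \<le> grid_average q h (\<lambda>k. \<bar>f k\<bar>)"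
  unfolding grid_average_def by (rule integral_abs_bound)

text \<open>The clock rings within the first cell with probability \<open>1 - exp (- q * h)\<close>; otherwise it starts afresh
  at \<open>h\<close>, by lack of memory.\<close>

lemma grid_average_Suc:
  assumes "\<And>k. \<bar>f k\<bar> \<le> B"
  shows "grid_average q h f = (1 - exp (- q * h)) * f 0 + exp (- q * h) * grid_average q h (\<lambda>k. f (Suc k))"
proof -
  interpret prob_space "exp_law q" using q by (rule prob_space_exponential_density)
  let ?late = "\<lambda>t. if h \<le> t then (\<lambda>s. f (Suc (nat \<lfloor>s / h\<rfloor>)) - f 0) (t - h) else 0"
  have eq: "f (nat \<lfloor>t / h\<rfloor>) = f 0 + ?late t" if "0 < t" for t
  proof (cases "h \<le> t")
    case True
    have "\<lfloor>t / h\<rfloor> = \<lfloor>(t - h) / h\<rfloor> + 1"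
      using h by (simp add: diff_divide_distrib)
    moreover have "0 \<le> \<lfloor>(t - h) / h\<rfloor>" using True h by simp
    ultimately have "nat \<lfloor>t / h\<rfloor> = Suc (nat \<lfloor>(t - h) / h\<rfloor>)" by linarith
    with True show ?thesis by simp
  next
    case False
    then have "\<lfloor>t / h\<rfloor> = 0" using that h by (simp add: floor_eq_iff)
    with False show ?thesis by simp
  qed
  have B: "\<bar>f (Suc k) - f 0\<bar> \<le> 2 * B" for k using assms[of "Suc k"] assms[of 0] by linarith
  have "0 \<le> B" using assms[of 0] by linarith
  have "grid_average q h f = (\<integral>t. f 0 + ?late t \<partial>exp_law q)"
    unfolding grid_average_def using AE_exp_law_pos[OF q]
    by (intro integral_cong_AE) (auto elim!: eventually_mono dest: eq)
  also have "\<dots> = f 0 + (\<integral>t. ?late t \<partial>exp_law q)"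
    using q B \<open>0 \<le> B\<close> prob_space
    by (subst Bochner_Integration.integral_add) (auto intro!: integrable_exp_law_bounded[where B="2 * B"])
  also have "(\<integral>t. ?late t \<partial>exp_law q) = exp (- q * h) * (\<integral>s. f (Suc (nat \<lfloor>s / h\<rfloor>)) - f 0 \<partial>exp_law q)"
    using q h by (intro exp_law_memoryless) auto
  also have "(\<integral>s. f (Suc (nat \<lfloor>s / h\<rfloor>)) - f 0 \<partial>exp_law q) = grid_average q h (\<lambda>k. f (Suc k)) - f 0"
    using grid_average_diff[of "\<lambda>k. f (Suc k)" B "\<lambda>_. f 0" B] assms grid_average_const[of "f 0"]
    by (simp add: grid_average_def)
  finally show ?thesis by (simp add: algebra_simps)
qed

end

locale drifted_bm = prob_space M for M :: "'a measure" +
  fixes X :: "real \<Rightarrow> 'a \<Rightarrow> real" and r v q :: real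
  assumes bm: "brownian_motion M r v X" and r: "0 < r" and v: "0 < v" and q: "0 < q"
begin

lemma measurable_X: "0 \<le> t \<Longrightarrow> X t \<in> borel_measurable M"
  and X_0: "\<omega> \<in> space M \<Longrightarrow> X 0 \<omega> = 0"
  and X_continuous: "\<omega> \<in> space M \<Longrightarrow> continuous_on {0..} (\<lambda>t. X t \<omega>)"
  using bm by (auto simp: brownian_motion_def)

definition \<nu>p :: real where "\<nu>p = sqrt (r\<^sup>2 + 2 * q * v) / v + r / v"
definition \<nu>m :: real where "\<nu>m = sqrt (r\<^sup>2 + 2 * q * v) / v - r / v"
definition \<kappa> :: "real \<Rightarrow> real" where "\<kappa> b = q + r * b - v * b\<^sup>2 / 2"

lemma \<nu>_pos: "0 < \<nu>p" "0 < \<nu>m"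
proof -
  have "sqrt (r\<^sup>2) < sqrt (r\<^sup>2 + 2 * q * v)"
    using q v by (intro real_sqrt_less_mono) simp
  then have "r < sqrt (r\<^sup>2 + 2 * q * v)" using r by simp
  then show "0 < \<nu>m" unfolding \<nu>m_def using v by (simp add: field_simps)
  show "0 < \<nu>p" unfolding \<nu>p_def using v r q by (intro add_nonneg_pos) auto
qed

text \<open>The Laplace transform of \<open>X\<close> at time \<open>t\<close> is \<open>exp ((q - \<kappa> b) * t)\<close>; the roots of \<open>\<kappa>\<close> are \<open>\<nu>\<^sup>+\<close> and \<open>- \<nu>\<^sup>-\<close>.\<close>

lemma \<kappa>_factor: "\<kappa> b = v / 2 * (\<nu>p - b) * (b + \<nu>m)"
  and \<nu>_product: "v / 2 * \<nu>p * \<nu>m = q"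
proof -
  define s where "s = sqrt (r\<^sup>2 + 2 * q * v)"
  have s: "s * s = r * r + 2 * q * v"
    using q v by (simp add: s_def power2_eq_square)
  have \<nu>: "\<nu>p = (s + r) / v" "\<nu>m = (s - r) / v"
    by (auto simp: \<nu>p_def \<nu>m_def s_def add_divide_distrib diff_divide_distrib)
  have "v / 2 * ((s + r) / v - b) * (b + (s - r) / v) = (s * s - (r - v * b) * (r - v * b)) / (2 * v)"
    using v by (simp add: field_simps)
  also have "\<dots> = \<kappa> b"
    unfolding s \<kappa>_def using v by (simp add: field_simps power2_eq_square)
  finally show "\<kappa> b = v / 2 * (\<nu>p - b) * (b + \<nu>m)" unfolding \<nu> by (rule sym)
  have "v / 2 * ((s + r) / v) * ((s - r) / v) = (s * s - r * r) / (2 * v)"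
    using v by (simp add: field_simps)
  also have "\<dots> = q" unfolding s using v by simp
  finally show "v / 2 * \<nu>p * \<nu>m = q" unfolding \<nu> .
qed

lemma walk:
  assumes "0 < h" "h \<le> 1"
  shows "gaussian_walk M (grid_step X h) (r * h) (sqrt (v * h)) (sqrt v)"
proof
  fix k
  have *: "\<And>s t. 0 \<le> s \<and> s < t \<Longrightarrow>
        distributed M lborel (\<lambda>\<omega>. X t \<omega> - X s \<omega>) (normal_density (r * (t - s)) (sqrt (v * (t - s))))"
    using bm unfolding brownian_motion_def by blast
  have "h * real (Suc k) - h * real k = h" by (simp add: algebra_simps)
  then show "distributed M lborel (grid_step X h k) (normal_density (r * h) (sqrt (v * h)))"
    using *[of "h * real k" "h * real (Suc k)"] assms unfolding grid_step_def[abs_def] by simp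
next
  fix m
  have *: "\<And>\<tau> :: nat \<Rightarrow> real. \<And>m. 0 \<le> \<tau> 0 \<and> mono \<tau> \<Longrightarrow>
        indep_vars (\<lambda>_. borel) (\<lambda>k \<omega>. X (\<tau> (Suc k)) \<omega> - X (\<tau> k) \<omega>) {..<m}"
    using bm unfolding brownian_motion_def by blast
  show "indep_vars (\<lambda>_. borel) (grid_step X h) {..<m}"
    using *[of "\<lambda>k. h * real k" m] assms unfolding grid_step_def[abs_def] by (auto simp: mono_def)
qed (use assms v r in \<open>auto simp: mult_le_cancel_left1\<close>)

abbreviation walk_laplace where "walk_laplace h \<equiv> gaussian_walk.joint_laplace M (grid_step X h)"
abbreviation walk_boundary where "walk_boundary h \<equiv> gaussian_walk.boundary_term M (grid_step X h)"

definition grid_laplace :: "real \<Rightarrow> real \<Rightarrow> real \<Rightarrow> real" where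
  "grid_laplace h \<alpha> \<beta> = grid_average q h (walk_laplace h \<alpha> \<beta>)"

definition grid_boundary :: "real \<Rightarrow> real \<Rightarrow> real \<Rightarrow> real" where
  "grid_boundary h \<alpha> \<beta> = grid_average q h (walk_boundary h \<alpha> \<beta>)"

context
  fixes h :: real assumes h: "0 < h" "h \<le> 1"
begin

interpretation w: gaussian_walk M "grid_step X h" "r * h" "sqrt (v * h)" "sqrt v"
  by (rule walk[OF h])

lemma grid_laplace_nonneg: "0 \<le> grid_laplace h \<alpha> \<beta>"
  unfolding grid_laplace_def grid_average_def w.joint_laplace_def
  by (intro integral_nonneg_AE always_eventually) auto

text \<open>The geometric average of \<open>joint_laplace_Suc\<close>: conditioning on whether the clock survives the first grid
  cell relates the averages over \<open>k\<close> and over \<open>Suc k\<close>.\<close>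

lemma grid_laplace_equation:
  assumes "0 \<le> \<alpha>" "0 \<le> \<beta>"
  shows "(1 - exp (- h * \<kappa> \<beta>)) * grid_laplace h \<alpha> \<beta>
    = (1 - exp (- q * h)) - exp (- q * h) * grid_boundary h \<alpha> \<beta>"
proof -
  let ?\<phi> = "exp (\<beta>\<^sup>2 * (sqrt (v * h))\<^sup>2 / 2 - \<beta> * (r * h))"
  have 0: "w.joint_laplace \<alpha> \<beta> 0 = 1" by (simp add: w.joint_laplace_def prob_space)
  have b: "\<bar>?\<phi> * w.joint_laplace \<alpha> \<beta> k\<bar> \<le> ?\<phi>" for k
    using w.joint_laplace_bounds[OF assms, of k] by (simp add: abs_mult mult_left_le)
  have "grid_laplace h \<alpha> \<beta> = (1 - exp (- q * h)) * 1
      + exp (- q * h) * grid_average q h (\<lambda>k. ?\<phi> * w.joint_laplace \<alpha> \<beta> k - w.boundary_term \<alpha> \<beta> k)"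
    unfolding grid_laplace_def w.joint_laplace_Suc[OF assms, symmetric]
    using grid_average_Suc[where f="w.joint_laplace \<alpha> \<beta>", OF q h(1) w.joint_laplace_bounds[OF assms]] unfolding 0 .
  also have "grid_average q h (\<lambda>k. ?\<phi> * w.joint_laplace \<alpha> \<beta> k - w.boundary_term \<alpha> \<beta> k)
      = ?\<phi> * grid_laplace h \<alpha> \<beta> - grid_boundary h \<alpha> \<beta>"
    unfolding grid_laplace_def grid_boundary_def grid_average_cmult[OF q h(1), symmetric]
    by (rule grid_average_diff[OF q h(1) b w.boundary_term_bounds[OF assms]])
  finally have *: "grid_laplace h \<alpha> \<beta> = (1 - exp (- q * h)) + exp (- q * h) * ?\<phi> * grid_laplace h \<alpha> \<beta> - exp (- q * h) * grid_boundary h \<alpha> \<beta>"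
    unfolding right_diff_distrib mult_1_right mult.assoc add_diff_eq .
  have "- q * h + (\<beta>\<^sup>2 * (sqrt (v * h))\<^sup>2 / 2 - \<beta> * (r * h)) = - h * \<kappa> \<beta>"
    using h v by (simp add: \<kappa>_def algebra_simps)
  then have "exp (- q * h) * ?\<phi> = exp (- h * \<kappa> \<beta>)"
    by (simp only: mult_exp_exp)
  then have "exp (- q * h) * ?\<phi> * grid_laplace h \<alpha> \<beta> = exp (- h * \<kappa> \<beta>) * grid_laplace h \<alpha> \<beta>"
    by (simp only:)
  with * show ?thesis unfolding left_diff_distrib by linarith
qed

text \<open>The kernel method: at the root \<open>\<nu>\<^sup>+\<close> of \<open>\<kappa>\<close> the unknown transform drops out of the equation.\<close>

lemma grid_boundary_root:
  assumes "0 \<le> \<alpha>"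
  shows "exp (- q * h) * grid_boundary h \<alpha> \<nu>p = 1 - exp (- q * h)"
  using grid_laplace_equation[OF assms, of \<nu>p] \<nu>_pos by (simp add: \<kappa>_factor)

text \<open>For large \<open>\<beta>\<close> the transform at \<open>(0, \<beta>)\<close> measures how often the walk is near the boundary. In the grid
  equation it has a coefficient of order \<open>v * \<beta>\<^sup>2 / 2\<close>. The boundary term returns a fraction of that, at
  most \<open>3 / 4\<close>: one half from the one-sided second moment, times \<open>3 / 2\<close> from Markov's inequality at
  the level \<open>ln (3 / 2) / \<beta>\<close>. What remains, \<open>v * \<beta>\<^sup>2 / 8\<close>, outgrows the linear part of the boundary
  term, so that the boundary is not sticky.\<close>

lemma grid_laplace_decay:
  assumes "0 < \<beta>"
  shows "(v * \<beta>\<^sup>2 / 8 - r * \<beta> - q) * grid_laplace h 0 \<beta>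
    \<le> \<beta> * q / \<nu>p + sqrt h * (sqrt v ^ 3 * (\<beta> ^ 3 / (2 * ln (3 / 2)) * gauss_moment 3 0 + \<beta> ^ 3 * gauss_moment 3 (\<beta> * sqrt v)))"
proof -
  define m where "m = grid_laplace h 0 \<beta>"
  define \<rho> where "\<rho> = exp (- q * h)"
  define C where "C = \<beta> ^ 3 / (2 * ln (3 / 2)) * gauss_moment 3 0 + \<beta> ^ 3 * gauss_moment 3 (\<beta> * sqrt v)"
  have m: "0 \<le> m" unfolding m_def by (rule grid_laplace_nonneg)
  have \<rho>: "0 < \<rho>" "\<rho> \<le> 1" "1 - \<rho> \<le> q * h"
    using q h exp_ge_add_one_self[of "- q * h"] by (auto simp: \<rho>_def)
  have lg: "0 < ln (3 / 2 :: real)" by simp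
  have "0 \<le> C" unfolding C_def using assms lg gauss_moment_nonneg by (intro add_nonneg_nonneg mult_nonneg_nonneg) auto
  \<comment> \<open>This width makes the Markov factor \<open>exp (\<beta> * \<epsilon>)\<close> equal to \<open>3 / 2\<close>, less than 2.\<close>
  let ?\<epsilon> = "ln (3 / 2) / \<beta>"
  let ?c = "\<beta>\<^sup>2 * (sqrt (v * h))\<^sup>2 / 4 * (3 / 2)"
  have growth: "w.boundary_term 0 \<beta> k \<le> \<beta> / \<nu>p * w.boundary_term 0 \<nu>p k + ?c * w.joint_laplace 0 \<beta> k + sqrt (v * h) ^ 3 * C" for k
    using w.boundary_term_growth[of \<nu>p \<beta> ?\<epsilon> k] \<nu>_pos assms lg
    by (simp add: C_def power2_eq_square power3_eq_cube)
  have b1: "\<bar>\<beta> / \<nu>p * w.boundary_term 0 \<nu>p k\<bar> \<le> \<beta> / \<nu>p * gauss_moment 0 (\<nu>p * sqrt v)" for k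
    using w.boundary_term_bounds[of 0 \<nu>p k] \<nu>_pos assms
    unfolding abs_mult by (intro mult_mono) auto
  have b2: "\<bar>?c * w.joint_laplace 0 \<beta> k\<bar> \<le> ?c" for k
    using mult_left_mono[OF w.joint_laplace_bounds[of 0 \<beta> k], of ?c] h v assms by (simp add: abs_mult)
  have b12: "\<bar>\<beta> / \<nu>p * w.boundary_term 0 \<nu>p k + ?c * w.joint_laplace 0 \<beta> k\<bar> \<le> \<beta> / \<nu>p * gauss_moment 0 (\<nu>p * sqrt v) + ?c" for k
    using b1[of k] b2[of k] by linarith
  have b3: "\<bar>sqrt (v * h) ^ 3 * C\<bar> \<le> sqrt (v * h) ^ 3 * C" using \<open>0 \<le> C\<close> h v by simp
  have b: "\<bar>\<beta> / \<nu>p * w.boundary_term 0 \<nu>p k + ?c * w.joint_laplace 0 \<beta> k + sqrt (v * h) ^ 3 * C\<bar>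
      \<le> \<beta> / \<nu>p * gauss_moment 0 (\<nu>p * sqrt v) + ?c + sqrt (v * h) ^ 3 * C" for k
    using b12[of k] b3 by linarith
  have "grid_boundary h 0 \<beta> \<le> grid_average q h (\<lambda>k. \<beta> / \<nu>p * w.boundary_term 0 \<nu>p k + ?c * w.joint_laplace 0 \<beta> k + sqrt (v * h) ^ 3 * C)"
    unfolding grid_boundary_def using assms
    by (intro grid_average_mono[OF q h(1) w.boundary_term_bounds b growth]) auto
  also have "\<dots> = grid_average q h (\<lambda>k. \<beta> / \<nu>p * w.boundary_term 0 \<nu>p k + ?c * w.joint_laplace 0 \<beta> k) + sqrt (v * h) ^ 3 * C"
    by (subst grid_average_add[OF q h(1) b12 b3]) (simp only: grid_average_const[OF q h(1)])
  also have "grid_average q h (\<lambda>k. \<beta> / \<nu>p * w.boundary_term 0 \<nu>p k + ?c * w.joint_laplace 0 \<beta> k)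
      = \<beta> / \<nu>p * grid_boundary h 0 \<nu>p + ?c * m"
    by (subst grid_average_add[OF q h(1) b1 b2])
      (simp only: grid_average_cmult[OF q h(1)] grid_boundary_def grid_laplace_def m_def)
  finally have "\<rho> * grid_boundary h 0 \<beta> \<le> \<rho> * (\<beta> / \<nu>p * grid_boundary h 0 \<nu>p + ?c * m + sqrt (v * h) ^ 3 * C)"
    using \<rho> by (intro mult_left_mono) auto
  also have "\<dots> = \<beta> / \<nu>p * (\<rho> * grid_boundary h 0 \<nu>p) + \<rho> * (?c * m + sqrt (v * h) ^ 3 * C)"
    by (simp add: algebra_simps)
  also have "\<rho> * grid_boundary h 0 \<nu>p = 1 - \<rho>"
    unfolding \<rho>_def by (rule grid_boundary_root) simp
  also have "\<beta> / \<nu>p * (1 - \<rho>) \<le> \<beta> / \<nu>p * (q * h)"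
    using \<rho> assms \<nu>_pos by (intro mult_left_mono) auto
  also have "\<rho> * (?c * m + sqrt (v * h) ^ 3 * C) \<le> 1 * (?c * m + sqrt (v * h) ^ 3 * C)"
    using \<rho> m \<open>0 \<le> C\<close> h v by (intro mult_right_mono) auto
  finally have 1: "\<rho> * grid_boundary h 0 \<beta> \<le> \<beta> / \<nu>p * (q * h) + (?c * m + sqrt (v * h) ^ 3 * C)" by simp
  have "(exp (- h * \<kappa> \<beta>) - 1) * m = \<rho> * grid_boundary h 0 \<beta> - (1 - \<rho>)"
    using grid_laplace_equation[of 0 \<beta>] assms by (simp add: m_def \<rho>_def algebra_simps)
  moreover have "- h * \<kappa> \<beta> * m \<le> (exp (- h * \<kappa> \<beta>) - 1) * m"
    using exp_ge_add_one_self[of "- h * \<kappa> \<beta>"] m by (intro mult_right_mono) linarith+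
  ultimately have "- h * \<kappa> \<beta> * m \<le> \<beta> / \<nu>p * (q * h) + ?c * m + sqrt (v * h) ^ 3 * C"
    using 1 \<rho> by linarith
  also have "sqrt (v * h) ^ 3 = h * (sqrt h * sqrt v ^ 3)"
    using h by (simp add: real_sqrt_mult power3_eq_cube mult_ac)
  also have "?c = h * (3 / 8 * v * \<beta>\<^sup>2)" using h v by (simp add: mult_ac)
  finally have fin: "- h * \<kappa> \<beta> * m \<le> \<beta> / \<nu>p * (q * h) + h * (3 / 8 * v * \<beta>\<^sup>2) * m + h * (sqrt h * sqrt v ^ 3) * C" .
  have "h * ((v * \<beta>\<^sup>2 / 8 - r * \<beta> - q) * m) \<le> h * (K * q + S * C)"
    if "- h * \<kappa> \<beta> * m \<le> K * (q * h) + h * (3 / 8 * v * \<beta>\<^sup>2) * m + h * S * C" for K S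
    using that by (simp add: \<kappa>_def algebra_simps)
  from this[OF fin] have "h * ((v * \<beta>\<^sup>2 / 8 - r * \<beta> - q) * m) \<le> h * (\<beta> * q / \<nu>p + sqrt h * (sqrt v ^ 3 * C))"
    by (simp add: mult.assoc)
  then show ?thesis using h by (simp add: m_def C_def)
qed

text \<open>The error is \<open>h\<close> times a quantity that is small for small \<open>h\<close> and large \<open>b\<close>; the width of the
  boundary layer is taken as \<open>1 / b\<close>.\<close>

lemma grid_boundary_comparison:
  assumes "0 < \<alpha>" "0 \<le> \<beta>" "\<alpha> \<le> c" "\<beta> \<le> c" "\<nu>p \<le> c" "0 < b"
  shows "\<bar>grid_boundary h \<alpha> \<beta> / (\<alpha> + \<beta>) - grid_boundary h \<alpha> \<nu>p / (\<alpha> + \<nu>p)\<bar>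
    \<le> h * (2 * c * (v * gauss_moment 2 (c * sqrt v) * exp 1 * grid_laplace h 0 b
        + sqrt h * (sqrt v ^ 3 * gauss_moment 3 (c * sqrt v) * b)))"
proof -
  have c: "0 < c" using assms by linarith
  let ?d = "\<lambda>k. w.boundary_term \<alpha> \<beta> k / (\<alpha> + \<beta>) - w.boundary_term \<alpha> \<nu>p k / (\<alpha> + \<nu>p)"
  let ?G = "(sqrt (v * h))\<^sup>2 * gauss_moment 2 (c * sqrt v) * exp 1" and ?H = "sqrt (v * h) ^ 3 * gauss_moment 3 (c * sqrt v) * b"
  have GH: "0 \<le> ?G" "0 \<le> ?H" using assms v h gauss_moment_nonneg by auto
  have d: "\<bar>?d k\<bar> \<le> 2 * c * ?G * w.joint_laplace 0 b k + 2 * c * ?H" for k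
  proof -
    have "\<bar>?d k\<bar> \<le> 2 * c * expectation (\<lambda>\<omega>. w.push k \<omega> ^ 2 * exp (c * w.push k \<omega>))"
      using assms \<nu>_pos by (intro w.boundary_term_comparison) auto
    also have "\<dots> \<le> 2 * c * (?G * w.joint_laplace 0 b k + ?H)"
      using w.push_square_small[of "1 / b" c b k] assms c by (intro mult_left_mono) auto
    finally show ?thesis by (simp add: algebra_simps)
  qed
  have b1: "\<bar>w.boundary_term \<alpha> \<beta> k / (\<alpha> + \<beta>)\<bar> \<le> gauss_moment 0 (\<beta> * sqrt v) / (\<alpha> + \<beta>)"
    and b2: "\<bar>w.boundary_term \<alpha> \<nu>p k / (\<alpha> + \<nu>p)\<bar> \<le> gauss_moment 0 (\<nu>p * sqrt v) / (\<alpha> + \<nu>p)" for k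
    using w.boundary_term_bounds[of \<alpha> \<beta> k] w.boundary_term_bounds[of \<alpha> \<nu>p k] assms \<nu>_pos
    by (auto simp: abs_div intro!: divide_right_mono)
  have b3: "\<bar>2 * c * ?G * w.joint_laplace 0 b k\<bar> \<le> 2 * c * ?G" for k
  proof -
    have "\<bar>2 * c * ?G * w.joint_laplace 0 b k\<bar> = 2 * c * ?G * \<bar>w.joint_laplace 0 b k\<bar>"
    proof -
      have "0 \<le> 2 * c * ?G" using c GH by simp
      then show ?thesis unfolding abs_mult[of "2 * c * ?G"] by (simp only: abs_of_nonneg)
    qed
    also have "\<dots> \<le> 2 * c * ?G * 1"
      using c GH assms w.joint_laplace_bounds[of 0 b k] by (intro mult_left_mono) auto
    finally show ?thesis by simp
  qed
  have b4: "\<bar>2 * c * ?H\<bar> \<le> 2 * c * ?H" using c GH by simp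
  have div: "grid_average q h (\<lambda>k. f k / x) = grid_average q h f / x" for f x
    unfolding grid_average_def by simp
  have eq: "grid_boundary h \<alpha> \<beta> / (\<alpha> + \<beta>) - grid_boundary h \<alpha> \<nu>p / (\<alpha> + \<nu>p) = grid_average q h ?d"
    unfolding grid_boundary_def div[symmetric] by (rule grid_average_diff[OF q h(1) b1 b2, symmetric])
  have "\<bar>grid_boundary h \<alpha> \<beta> / (\<alpha> + \<beta>) - grid_boundary h \<alpha> \<nu>p / (\<alpha> + \<nu>p)\<bar> \<le> grid_average q h (\<lambda>k. \<bar>?d k\<bar>)"
    unfolding eq by (rule grid_average_abs_le[OF q h(1)])
  also have "\<dots> \<le> grid_average q h (\<lambda>k. 2 * c * ?G * w.joint_laplace 0 b k + 2 * c * ?H)"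
  proof (rule grid_average_mono[OF q h(1) _ _ d])
    show "\<bar>\<bar>?d k\<bar>\<bar> \<le> gauss_moment 0 (\<beta> * sqrt v) / (\<alpha> + \<beta>) + gauss_moment 0 (\<nu>p * sqrt v) / (\<alpha> + \<nu>p)" for k
      using b1[of k] b2[of k] by linarith
    show "\<bar>2 * c * ?G * w.joint_laplace 0 b k + 2 * c * ?H\<bar> \<le> 2 * c * ?G + 2 * c * ?H" for k
      using b3[of k] b4 by linarith
  qed
  also have "\<dots> = 2 * c * ?G * grid_laplace h 0 b + 2 * c * ?H"
    by (subst grid_average_add[OF q h(1) b3 b4])
      (simp only: grid_average_const[OF q h(1)] grid_average_cmult[OF q h(1)] grid_laplace_def)
  also have "\<dots> = h * (2 * c * (v * gauss_moment 2 (c * sqrt v) * exp 1 * grid_laplace h 0 b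
        + sqrt h * (sqrt v ^ 3 * gauss_moment 3 (c * sqrt v) * b)))"
  proof -
    have "sqrt (v * h) ^ 3 = h * (sqrt h * sqrt v ^ 3)"
      using h by (simp add: real_sqrt_mult power3_eq_cube mult_ac)
    moreover have "(sqrt (v * h))\<^sup>2 = h * v"
      using h v by simp
    ultimately show ?thesis by (simp only:) (simp add: algebra_simps)
  qed
  finally show ?thesis .
qed

end

end

text \<open>The derivative of \<open>x \<mapsto> 1 - exp (- x * c)\<close> at 0.\<close>

lemma exp_quotient_tendsto:
  "(\<lambda>n. (1 - exp (- mesh n * c)) / mesh n) \<longlonglongrightarrow> c"
proof -
  have "((\<lambda>x. 1 - exp (- x * c)) has_real_derivative c) (at 0)"
    by (auto intro!: derivative_eq_intros)
  then have "((\<lambda>x. (1 - exp (- x * c)) / x) \<longlongrightarrow> c) (at 0)"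
    by (simp add: DERIV_def)
  moreover have "filterlim mesh (at 0) sequentially"
    using mesh_tendsto mesh(1) by (auto simp: filterlim_at intro!: always_eventually) (metis less_irrefl)
  ultimately show ?thesis by (rule filterlim_compose)
qed

context drifted_bm
begin

lemma measurable_X_compose [measurable (raw)]:
  "f \<in> borel_measurable N \<Longrightarrow> g \<in> measurable N M \<Longrightarrow> (\<lambda>x. X (max 0 (f x)) (g x)) \<in> borel_measurable N"
  by (rule measurable_path_compose[OF measurable_X X_continuous])

lemma measurable_running_max_X_compose [measurable (raw)]:
  "f \<in> borel_measurable N \<Longrightarrow> g \<in> measurable N M \<Longrightarrow> (\<lambda>x. running_max X (max 0 (f x)) (g x)) \<in> borel_measurable N"
  by (rule measurable_running_max_compose[OF measurable_X X_continuous X_0])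

abbreviation "peak t \<omega> \<equiv> running_max X (max 0 t) \<omega>"

text \<open>The height of the path above its running minimum: Brownian motion reflected at 0.\<close>

definition excess :: "real \<Rightarrow> 'a \<Rightarrow> real" where
  "excess t \<omega> = peak t \<omega> + X (max 0 t) \<omega>"

lemma running_max_X_nonneg: "\<omega> \<in> space M \<Longrightarrow> 0 \<le> peak t \<omega>"
  by (intro running_max_nonneg X_continuous X_0) auto

lemma excess_nonneg: "\<omega> \<in> space M \<Longrightarrow> 0 \<le> excess t \<omega>"
  using running_max_upper[where X=X and \<omega>=\<omega> and u="max 0 t" and t="max 0 t", OF X_continuous]
  by (simp add: excess_def)

lemma measurable_excess_compose [measurable (raw)]:
  "f \<in> borel_measurable N \<Longrightarrow> g \<in> measurable N M \<Longrightarrow> (\<lambda>x. excess (f x) (g x)) \<in> borel_measurable N"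
  unfolding excess_def by (intro borel_measurable_add measurable_X_compose measurable_running_max_X_compose)

lemma laplace_exponent_nonpos:
  "\<omega> \<in> space M \<Longrightarrow> 0 \<le> \<alpha> \<Longrightarrow> 0 \<le> \<beta> \<Longrightarrow> - \<alpha> * peak t \<omega> - \<beta> * excess t \<omega> \<le> 0"
proof -
  assume "\<omega> \<in> space M" "0 \<le> \<alpha>" "0 \<le> \<beta>"
  then have "0 \<le> \<alpha> * peak t \<omega>" "0 \<le> \<beta> * excess t \<omega>"
    using running_max_X_nonneg excess_nonneg by auto
  then show ?thesis unfolding mult_minus_left by linarith
qed

definition killed_laplace :: "real \<Rightarrow> real \<Rightarrow> real" where
  "killed_laplace \<alpha> \<beta> = (\<integral>t. expectation (\<lambda>\<omega>. exp (- \<alpha> * peak t \<omega> - \<beta> * excess t \<omega>)) \<partial>exp_law q)"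

lemma killed_laplace_nonneg: "0 \<le> killed_laplace \<alpha> \<beta>"
  unfolding killed_laplace_def by (intro integral_nonneg_AE always_eventually allI) auto

text \<open>Dominated convergence, once over the paths at a fixed time and once over the time.\<close>

lemma grid_laplace_tendsto:
  assumes "0 \<le> \<alpha>" "0 \<le> \<beta>"
  shows "(\<lambda>n. grid_laplace (mesh n) \<alpha> \<beta>) \<longlonglongrightarrow> killed_laplace \<alpha> \<beta>"
  unfolding grid_laplace_def grid_average_def killed_laplace_def
proof (rule integral_dominated_convergence)
  let ?lim = "\<lambda>t \<omega>. exp (- \<alpha> * peak t \<omega> - \<beta> * excess t \<omega>)"
  let ?walk = "\<lambda>n t \<omega>. exp (- \<alpha> * gaussian_walk.D (grid_step X (mesh n)) (nat \<lfloor>t / mesh n\<rfloor>) \<omega> - \<beta> * gaussian_walk.W (grid_step X (mesh n)) (nat \<lfloor>t / mesh n\<rfloor>) \<omega>)"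
  interpret E: prob_space "exp_law q" using q by (rule prob_space_exponential_density)
  show "integrable (exp_law q) (\<lambda>_. 1::real)" by simp
  show "(\<lambda>t. expectation (?lim t)) \<in> borel_measurable (exp_law q)"
    by measurable
  show "(\<lambda>t. walk_laplace (mesh n) \<alpha> \<beta> (nat \<lfloor>t / mesh n\<rfloor>)) \<in> borel_measurable (exp_law q)" for n
    by measurable
  have "norm (walk_laplace (mesh n) \<alpha> \<beta> k) \<le> 1" for n k
    using gaussian_walk.joint_laplace_bounds[OF walk[OF mesh] assms] by simp
  then show "AE t in exp_law q. norm (walk_laplace (mesh n) \<alpha> \<beta> (nat \<lfloor>t / mesh n\<rfloor>)) \<le> 1" for n
    by simp
  have "(\<lambda>n. walk_laplace (mesh n) \<alpha> \<beta> (nat \<lfloor>t / mesh n\<rfloor>))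
      \<longlonglongrightarrow> expectation (?lim t)" if t: "0 < t" for t
  proof -
    have "(\<lambda>n. expectation (?walk n t))
      \<longlonglongrightarrow> expectation (?lim t)"
    proof (rule integral_dominated_convergence)
      show "integrable M (\<lambda>_. 1::real)" by simp
      show "(?lim t) \<in> borel_measurable M" by measurable
      fix n
      interpret w: gaussian_walk M "grid_step X (mesh n)" "r * mesh n" "sqrt (v * mesh n)" "sqrt v"
        by (rule walk[OF mesh])
      show "(\<lambda>\<omega>. exp (- \<alpha> * w.D (nat \<lfloor>t / mesh n\<rfloor>) \<omega> - \<beta> * w.W (nat \<lfloor>t / mesh n\<rfloor>) \<omega>)) \<in> borel_measurable M"
        by measurable
      show "AE \<omega> in M. norm (exp (- \<alpha> * w.D (nat \<lfloor>t / mesh n\<rfloor>) \<omega> - \<beta> * w.W (nat \<lfloor>t / mesh n\<rfloor>) \<omega>)) \<le> 1"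
        using w.joint_exponent_nonpos[OF assms] by simp
    next
      show "AE \<omega> in M. (\<lambda>n. ?walk n t \<omega>)
        \<longlonglongrightarrow> ?lim t \<omega>"
      proof (rule AE_I2)
        fix \<omega> assume \<omega>: "\<omega> \<in> space M"
        have D: "gaussian_walk.D (grid_step X (mesh n)) k \<omega> = regulator (\<lambda>i. grid_step X (mesh n) i \<omega>) k"
          and W: "gaussian_walk.W (grid_step X (mesh n)) k \<omega>
            = regulator (\<lambda>i. grid_step X (mesh n) i \<omega>) k + X (mesh n * real k) \<omega>" for n k
          using gaussian_walk.D_def[OF walk[OF mesh]] gaussian_walk.W_def[OF walk[OF mesh]]
            grid_regulator(1)[of X \<omega>] X_0[OF \<omega>] by auto
        have t': "max 0 t = t" using t by simp
        show "(\<lambda>n. ?walk n t \<omega>)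
        \<longlonglongrightarrow> ?lim t \<omega>"
          unfolding D W excess_def t' using t \<omega>
          by (intro tendsto_intros grid_regulator_tendsto grid_path_tendsto X_continuous X_0) auto
      qed
    qed
    then show ?thesis
      by (simp add: gaussian_walk.joint_laplace_def[OF walk[OF mesh]])
  qed
  then show "AE t in exp_law q. (\<lambda>n. walk_laplace (mesh n) \<alpha> \<beta> (nat \<lfloor>t / mesh n\<rfloor>))
      \<longlonglongrightarrow> expectation (?lim t)"
    using AE_exp_law_pos[OF q] by (auto elim!: eventually_mono)
qed

text \<open>Divide the bound in \<open>grid_laplace_decay\<close> by its quadratic coefficient. In probabilistic terms, the
  reflected Brownian motion is almost surely not at 0 at the exponential time.\<close>

lemma killed_laplace_vanishes: "(killed_laplace 0 \<longlongrightarrow> 0) at_top"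
proof (rule tendsto_sandwich)
  show "\<forall>\<^sub>F b in at_top. 0 \<le> killed_laplace 0 b"
    by (simp add: killed_laplace_nonneg)
  have decay: "(v * b\<^sup>2 / 8 - r * b - q) * killed_laplace 0 b \<le> b * q / \<nu>p" if b: "0 < b" for b
  proof -
    let ?C = "sqrt v ^ 3 * (b ^ 3 / (2 * ln (3 / 2)) * gauss_moment 3 0 + b ^ 3 * gauss_moment 3 (b * sqrt v))"
    have 1: "(\<lambda>n. (v * b\<^sup>2 / 8 - r * b - q) * grid_laplace (mesh n) 0 b) \<longlonglongrightarrow> (v * b\<^sup>2 / 8 - r * b - q) * killed_laplace 0 b"
      using b by (intro tendsto_intros grid_laplace_tendsto) auto
    have "(\<lambda>n. b * q / \<nu>p + sqrt (mesh n) * ?C) \<longlonglongrightarrow> b * q / \<nu>p + sqrt 0 * ?C"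
      by (intro tendsto_intros mesh_tendsto)
    then have 2: "(\<lambda>n. b * q / \<nu>p + sqrt (mesh n) * ?C) \<longlonglongrightarrow> b * q / \<nu>p" by simp
    show ?thesis
      by (rule LIMSEQ_le[OF 1 2]) (use grid_laplace_decay[OF mesh b] in auto)
  qed
  have "filterlim (\<lambda>b. v * b\<^sup>2 / 8 - r * b - q) at_top at_top" using v by real_asymp
  then have "\<forall>\<^sub>F b in at_top. 0 < v * b\<^sup>2 / 8 - r * b - q" unfolding filterlim_at_top_dense by blast
  then show "\<forall>\<^sub>F b in at_top. killed_laplace 0 b \<le> (b * q / \<nu>p) / (v * b\<^sup>2 / 8 - r * b - q)"
    using eventually_gt_at_top[of 0]
  proof eventually_elim
    case (elim b)
    then show ?case using decay[of b] pos_le_divide_eq[of "v * b\<^sup>2 / 8 - r * b - q" "killed_laplace 0 b" "b * q / \<nu>p"]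
      by (simp only: mult.commute)
  qed
  show "((\<lambda>b. (b * q / \<nu>p) / (v * b\<^sup>2 / 8 - r * b - q)) \<longlongrightarrow> 0) at_top"
    using v q \<nu>_pos by real_asymp
qed simp

text \<open>Divide the grid equation by \<open>h\<close> and express its boundary term through the known one at \<open>\<nu>\<^sup>+\<close>. In the
  limit \<open>h \<rightarrow> 0\<close> the deviation \<open>K\<close> from the claimed identity is bounded by a multiple of
  \<open>killed_laplace 0 b\<close> for every \<open>b\<close>, and the latter tends to 0 as \<open>b \<rightarrow> \<infinity>\<close>.\<close>

lemma killed_laplace_eq:
  assumes "0 < \<alpha>" "0 \<le> \<beta>" "\<beta> \<noteq> \<nu>p"
  shows "killed_laplace \<alpha> \<beta> = \<nu>p / (\<nu>p + \<alpha>) * (\<nu>m / (\<nu>m + \<beta>))"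
proof -
  define c where "c = \<alpha> + \<beta> + \<nu>p"
  have c: "\<alpha> \<le> c" "\<beta> \<le> c" "\<nu>p \<le> c" "0 < c" using assms \<nu>_pos by (auto simp: c_def)
  define A where "A = v * gauss_moment 2 (c * sqrt v) * exp 1"
  define H where "H = sqrt v ^ 3 * gauss_moment 3 (c * sqrt v)"
  define K where "K = \<kappa> \<beta> * killed_laplace \<alpha> \<beta> - q * (1 - (\<alpha> + \<beta>) / (\<alpha> + \<nu>p))"
  have K: "\<bar>K\<bar> \<le> (\<alpha> + \<beta>) * (2 * c * (A * killed_laplace 0 b))" if b: "0 < b" for b
  proof -
    let ?dev = "\<lambda>h. \<bar>(1 - exp (- h * \<kappa> \<beta>)) / h * grid_laplace h \<alpha> \<beta> - (1 - exp (- h * q)) / h * (1 - (\<alpha> + \<beta>) / (\<alpha> + \<nu>p))\<bar>"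
    let ?err = "\<lambda>h. (\<alpha> + \<beta>) * (2 * c * (A * grid_laplace h 0 b + sqrt h * (H * b)))"
    show ?thesis
    proof (rule LIMSEQ_le)
      show "(\<lambda>n. ?dev (mesh n)) \<longlonglongrightarrow> \<bar>K\<bar>"
        unfolding K_def using assms by (intro tendsto_intros exp_quotient_tendsto grid_laplace_tendsto) auto
      have "(\<lambda>n. ?err (mesh n)) \<longlonglongrightarrow> (\<alpha> + \<beta>) * (2 * c * (A * killed_laplace 0 b + sqrt 0 * (H * b)))"
        using b by (intro tendsto_intros grid_laplace_tendsto mesh_tendsto) auto
      then show "(\<lambda>n. ?err (mesh n)) \<longlonglongrightarrow> (\<alpha> + \<beta>) * (2 * c * (A * killed_laplace 0 b))" by simp
      have "?dev h \<le> ?err h" if h: "0 < h" "h \<le> 1" for h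
      proof -
        define \<rho> where "\<rho> = exp (- q * h)"
        have \<rho>: "0 < \<rho>" "\<rho> \<le> 1" using q h by (auto simp: \<rho>_def)
        let ?d = "(1 - exp (- h * \<kappa> \<beta>)) * grid_laplace h \<alpha> \<beta> - (1 - \<rho>) * (1 - (\<alpha> + \<beta>) / (\<alpha> + \<nu>p))"
        define g where "g = grid_boundary h \<alpha> \<beta> / (\<alpha> + \<beta>) - grid_boundary h \<alpha> \<nu>p / (\<alpha> + \<nu>p)"
        have "(1 - exp (- h * \<kappa> \<beta>)) * grid_laplace h \<alpha> \<beta> = (1 - \<rho>) - \<rho> * grid_boundary h \<alpha> \<beta>"
          using grid_laplace_equation[OF h, of \<alpha> \<beta>] assms by (simp add: \<rho>_def)
        moreover have "\<rho> * grid_boundary h \<alpha> \<nu>p = 1 - \<rho>"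
          using grid_boundary_root[OF h, of \<alpha>] assms by (simp add: \<rho>_def)
        moreover have "\<rho> * grid_boundary h \<alpha> \<beta> = (\<alpha> + \<beta>) * (\<rho> * g) + (\<alpha> + \<beta>) / (\<alpha> + \<nu>p) * (\<rho> * grid_boundary h \<alpha> \<nu>p)"
        proof -
          have "(\<alpha> + \<beta>) * g = grid_boundary h \<alpha> \<beta> - (\<alpha> + \<beta>) / (\<alpha> + \<nu>p) * grid_boundary h \<alpha> \<nu>p"
            using assms unfolding g_def right_diff_distrib by simp
          then show ?thesis unfolding mult.left_commute[of _ \<rho>] distrib_left[symmetric] by simp
        qed
        ultimately have "?d = - ((\<alpha> + \<beta>) * (\<rho> * g))"
          by (simp only: right_diff_distrib mult_1_right) (simp add: algebra_simps flip: add_divide_distrib diff_divide_distrib)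
        then have "\<bar>?d\<bar> = (\<alpha> + \<beta>) * (\<rho> * \<bar>g\<bar>)"
          using assms \<rho> by (simp add: abs_mult)
        also have "\<dots> \<le> (\<alpha> + \<beta>) * (1 * (h * (2 * c * (A * grid_laplace h 0 b + sqrt h * (H * b)))))"
          using grid_boundary_comparison[OF h, of \<alpha> \<beta> c b] assms c b \<rho>
          by (intro mult_left_mono mult_mono) (auto simp: g_def A_def H_def)
        finally have "\<bar>?d\<bar> / h \<le> ?err h"
          using h by (simp add: pos_divide_le_eq mult_ac)
        moreover have "(1 - exp (- h * \<kappa> \<beta>)) / h * grid_laplace h \<alpha> \<beta> - (1 - exp (- h * q)) / h * (1 - (\<alpha> + \<beta>) / (\<alpha> + \<nu>p)) = ?d / h"
          unfolding \<rho>_def diff_divide_distrib[of "_ * _"] times_divide_eq_left by (simp add: mult.commute[of q h])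
        ultimately show ?thesis
          using h by (simp only: abs_divide abs_of_pos)
      qed
      then show "\<exists>N. \<forall>n\<ge>N. ?dev (mesh n) \<le> ?err (mesh n)"
        using mesh by blast
    qed
  qed
  have "((\<lambda>b. (\<alpha> + \<beta>) * (2 * c * (A * killed_laplace 0 b))) \<longlongrightarrow> (\<alpha> + \<beta>) * (2 * c * (A * 0))) at_top"
    by (intro tendsto_intros killed_laplace_vanishes)
  then have "\<bar>K\<bar> \<le> (\<alpha> + \<beta>) * (2 * c * (A * 0))"
    by (rule tendsto_lowerbound) (use K in \<open>auto intro: eventually_mono[OF eventually_gt_at_top[of 0]]\<close>)
  then have "\<kappa> \<beta> * killed_laplace \<alpha> \<beta> = q * (1 - (\<alpha> + \<beta>) / (\<alpha> + \<nu>p))" by (simp add: K_def)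
  also have "\<dots> = v / 2 * \<nu>p * \<nu>m * ((\<nu>p - \<beta>) / (\<alpha> + \<nu>p))"
    using assms \<nu>_pos unfolding \<nu>_product by (simp add: field_simps)
  finally have "v / 2 * (\<nu>p - \<beta>) * ((\<beta> + \<nu>m) * killed_laplace \<alpha> \<beta>) = v / 2 * (\<nu>p - \<beta>) * (\<nu>p * \<nu>m / (\<alpha> + \<nu>p))"
    unfolding \<kappa>_factor by (simp only: times_divide_eq_right times_divide_eq_left divide_divide_eq_left mult_ac)
  moreover have "v / 2 * (\<nu>p - \<beta>) \<noteq> 0" using v assms by simp
  ultimately have "(\<beta> + \<nu>m) * killed_laplace \<alpha> \<beta> = \<nu>p * \<nu>m / (\<alpha> + \<nu>p)"
    by (simp only: mult_cancel_left) simp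
  then have "killed_laplace \<alpha> \<beta> = (\<nu>p * \<nu>m / (\<alpha> + \<nu>p)) / (\<beta> + \<nu>m)"
    using assms \<nu>_pos by (simp add: eq_divide_eq mult_ac)
  then show ?thesis by (simp add: add.commute)
qed

end

text \<open>Both sides are continuous in \<open>k\<close> for the supremum norm on the unit interval, and they agree on
  polynomials, which are dense by the Weierstrass approximation theorem.\<close>

lemma moments_determine_expectations:
  fixes G Z :: "'a \<Rightarrow> real" and Z' :: "'b \<Rightarrow> real" and k :: "real \<Rightarrow> real"
  assumes P: "prob_space P" and Q: "prob_space Q"
    and [measurable]: "G \<in> borel_measurable P" "Z \<in> borel_measurable P" "Z' \<in> borel_measurable Q" "k \<in> borel_measurable borel"
    and G: "\<And>x. x \<in> space P \<Longrightarrow> \<bar>G x\<bar> \<le> 1"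
    and Z: "\<And>x. x \<in> space P \<Longrightarrow> Z x \<in> {0..1}" and Z': "\<And>x. x \<in> space Q \<Longrightarrow> Z' x \<in> {0..1}"
    and moments: "\<And>j. (\<integral>x. G x * Z x ^ j \<partial>P) = c * (\<integral>x. Z' x ^ j \<partial>Q)"
    and k: "continuous_on {0..1} k"
  shows "(\<integral>x. G x * k (Z x) \<partial>P) = c * (\<integral>x. k (Z' x) \<partial>Q)"
proof -
  interpret P: prob_space P by fact
  interpret Q: prob_space Q by fact
  let ?A = "\<lambda>f. \<integral>x. G x * f (Z x) \<partial>P" and ?B = "\<lambda>f. \<integral>x. f (Z' x) \<partial>Q"
  have "compact (k ` {0..1})" using k by (intro compact_continuous_image) auto
  then have "bounded (k ` {0..1})" by (rule compact_imp_bounded)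
  then obtain K where K: "\<And>z. z \<in> {0..1} \<Longrightarrow> \<bar>k z\<bar> \<le> K"
    unfolding bounded_iff by (metis imageI real_norm_def)
  have intP: "integrable P (\<lambda>x. G x * f (Z x))" if [measurable]: "f \<in> borel_measurable borel" and "\<And>z. z \<in> {0..1} \<Longrightarrow> \<bar>f z\<bar> \<le> M" for f M
  proof (rule P.integrable_const_bound[where B=M])
    show "AE x in P. norm (G x * f (Z x)) \<le> M"
    proof (rule AE_I2)
      fix x assume x: "x \<in> space P"
      have "\<bar>G x * f (Z x)\<bar> \<le> 1 * M" unfolding abs_mult using G[OF x] that(2)[OF Z[OF x]] by (intro mult_mono) auto
      then show "norm (G x * f (Z x)) \<le> M" by simp
    qed
  qed measurable
  have intQ: "integrable Q (\<lambda>x. f (Z' x))" if [measurable]: "f \<in> borel_measurable borel" and "\<And>z. z \<in> {0..1} \<Longrightarrow> \<bar>f z\<bar> \<le> M" for f :: "real \<Rightarrow> real" and M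
    using that(2) Z' by (intro Q.integrable_const_bound[where B=M]) auto
  have "\<bar>?A k - c * ?B k\<bar> \<le> 0 + e" if "0 < e" for e
  proof -
    define d where "d = e / (1 + \<bar>c\<bar>)"
    have d: "0 < d" "d * (1 + \<bar>c\<bar>) = e" using \<open>0 < e\<close> by (auto simp: d_def add_pos_nonneg)
    obtain p where "real_polynomial_function p" and close: "\<And>z. z \<in> {0..1} \<Longrightarrow> \<bar>k z - p z\<bar> < d"
      using Stone_Weierstrass_real_polynomial_function[of "{0..1}" k d] k d by auto
    then obtain a n where p: "p = (\<lambda>x. \<Sum>i\<le>n. a i * x ^ i)"
      unfolding real_polynomial_function_iff_sum by blast
    have [measurable]: "p \<in> borel_measurable borel" unfolding p by measurable
    have pow: "\<bar>z ^ i\<bar> \<le> 1" if "z \<in> {0..1}" for z :: real and i using that by (auto simp: power_abs intro: power_le_one)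
    have "?A p = (\<integral>x. (\<Sum>i\<le>n. a i * (G x * Z x ^ i)) \<partial>P)"
      unfolding p by (simp add: sum_distrib_left mult_ac)
    also have "\<dots> = (\<Sum>i\<le>n. a i * (\<integral>x. G x * Z x ^ i \<partial>P))"
      using intP[of "\<lambda>z. z ^ i" 1 for i] pow by (subst Bochner_Integration.integral_sum) auto
    also have "\<dots> = c * (\<Sum>i\<le>n. a i * (\<integral>x. Z' x ^ i \<partial>Q))"
      unfolding moments by (simp add: sum_distrib_left mult_ac)
    also have "(\<Sum>i\<le>n. a i * (\<integral>x. Z' x ^ i \<partial>Q)) = ?B p"
      unfolding p using intQ[of "\<lambda>z. z ^ i" 1 for i] pow by (subst Bochner_Integration.integral_sum) auto
    finally have eq: "?A p = c * ?B p" .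
    have pK: "\<bar>p z\<bar> \<le> K + d" if "z \<in> {0..1}" for z using K[OF that] close[OF that] by linarith
    have "?A k - ?A p = (\<integral>x. G x * k (Z x) - G x * p (Z x) \<partial>P)"
      using intP[of k K] intP[of p "K + d"] K pK by simp
    also have "\<bar>\<dots>\<bar> \<le> d"
    proof (rule P.abs_expectation_le)
      fix x assume x: "x \<in> space P"
      have "\<bar>G x * k (Z x) - G x * p (Z x)\<bar> = \<bar>G x\<bar> * \<bar>k (Z x) - p (Z x)\<bar>"
        by (simp add: abs_mult flip: right_diff_distrib)
      also have "\<dots> \<le> 1 * d" using G[OF x] close[OF Z[OF x]] by (intro mult_mono) auto
      finally show "\<bar>G x * k (Z x) - G x * p (Z x)\<bar> \<le> d" by simp
    qed
    finally have 1: "\<bar>?A k - ?A p\<bar> \<le> d" .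
    have "?B k - ?B p = (\<integral>x. k (Z' x) - p (Z' x) \<partial>Q)"
      using intQ[of k K] intQ[of p "K + d"] K pK by simp
    also have "\<bar>\<dots>\<bar> \<le> d"
      using close Z' by (intro Q.abs_expectation_le) (auto intro: less_imp_le)
    finally have "\<bar>c\<bar> * \<bar>?B k - ?B p\<bar> \<le> \<bar>c\<bar> * d" by (intro mult_left_mono) auto
    then have 2: "\<bar>c * ?B k - c * ?B p\<bar> \<le> \<bar>c\<bar> * d" by (simp add: abs_mult flip: right_diff_distrib)
    have "\<bar>?A k - c * ?B k\<bar> \<le> d + \<bar>c\<bar> * d" using 1 2 eq by linarith
    then show ?thesis using d(2) by (simp add: algebra_simps)
  qed
  then have "\<bar>?A k - c * ?B k\<bar> \<le> 0" by (rule field_le_epsilon)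
  then show ?thesis by simp
qed

context drifted_bm
begin

text \<open>The right side is what independent exponential \<open>M\<close> (rate \<open>\<nu>\<^sup>+\<close>) and \<open>W\<close> (rate \<open>\<nu>\<^sup>-\<close>) give, because
  \<open>max M (y - X) = M + max 0 (y - W)\<close>. As a function of \<open>exp (- \<eta> * W)\<close> the factor
  \<open>exp (- \<gamma> * max 0 (y - W))\<close> is continuous on the unit interval, so the moments of
  \<open>exp (- \<eta> * W)\<close> weighted by \<open>exp (- \<gamma> * M)\<close> suffice, and these are given by \<open>killed_laplace_eq\<close>.\<close>

theorem wiener_hopf:
  assumes \<gamma>: "0 < \<gamma>"
  shows "(\<integral>t. expectation (\<lambda>\<omega>. exp (- \<gamma> * max (peak t \<omega>) (y - X (max 0 t) \<omega>))) \<partial>exp_law q)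
    = \<nu>p / (\<nu>p + \<gamma>) * (\<integral>w. exp (- \<gamma> * max 0 (y - w)) \<partial>exp_law \<nu>m)"
proof -
  let ?F = "\<lambda>t \<omega>. exp (- \<gamma> * max (peak t \<omega>) (y - X (max 0 t) \<omega>))"
  interpret E: prob_space "exp_law q" using q by (rule prob_space_exponential_density)
  interpret E': prob_space "exp_law \<nu>m" using \<nu>_pos by (intro prob_space_exponential_density)
  interpret pair_prob_space "exp_law q" M ..
  \<comment> \<open>The transform is known for arguments other than \<open>\<nu>\<^sup>+\<close>; no multiple of \<open>\<eta>\<close> equals \<open>\<nu>\<^sup>+\<close>.\<close>
  define \<eta> where "\<eta> = 2 * \<nu>p"
  have \<eta>: "0 < \<eta>" "real j * \<eta> \<noteq> \<nu>p" for j
  proof -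
    show "0 < \<eta>" using \<nu>_pos by (simp add: \<eta>_def)
    have "real j * 2 \<noteq> 1" by (metis One_nat_def of_nat_1 of_nat_eq_iff of_nat_mult of_nat_numeral odd_one dvd_triv_right)
    then show "real j * \<eta> \<noteq> \<nu>p" using \<nu>_pos by (simp add: \<eta>_def mult.assoc[symmetric])
  qed
  \<comment> \<open>The function \<open>exp (- \<gamma> * max 0 (y - w))\<close> in the variable \<open>z = exp (- \<eta> * w)\<close>; its value at \<open>z = 0\<close> is the limit 1.\<close>
  define k where "k z = (max 1 (exp y * z powr (1 / \<eta>))) powr (- \<gamma>)" for z
  have k_exp: "k (exp (- \<eta> * w)) = exp (- \<gamma> * max 0 (y - w))" for w
  proof -
    have "max 1 (exp y * exp (- \<eta> * w) powr (1 / \<eta>)) = exp (max 0 (y - w))"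
      using \<eta>(1) by (auto simp: powr_def max_def mult_exp_exp)
    then show ?thesis by (simp add: k_def powr_def)
  qed
  let ?P = "exp_law q \<Otimes>\<^sub>M M"
  let ?G = "\<lambda>(t, \<omega>). exp (- \<gamma> * peak t \<omega>)" and ?Z = "\<lambda>(t, \<omega>). exp (- \<eta> * excess t \<omega>)"
  let ?Z' = "\<lambda>w. exp (- \<eta> * max 0 w)"
  have "(\<integral>x. ?G x * k (?Z x) \<partial>?P) = \<nu>p / (\<nu>p + \<gamma>) * (\<integral>w. k (?Z' w) \<partial>exp_law \<nu>m)"
  proof (rule moments_determine_expectations[where k=k and G="?G" and Z="?Z" and Z'="?Z'"])
    show "prob_space ?P" by unfold_locales
    show "prob_space (exp_law \<nu>m)" by unfold_locales
    show "?G \<in> borel_measurable ?P" "?Z \<in> borel_measurable ?P" "?Z' \<in> borel_measurable (exp_law \<nu>m)"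
      by measurable
    show "k \<in> borel_measurable borel" unfolding k_def by measurable
    show "\<bar>?G x\<bar> \<le> 1" "?Z x \<in> {0..1}" if "x \<in> space ?P" for x
      using that \<gamma> \<eta>(1) running_max_X_nonneg excess_nonneg
      by (auto simp: space_pair_measure)
    show "?Z' w \<in> {0..1}" for w using \<eta>(1) by auto
    show "continuous_on {0..1} k"
      unfolding k_def using \<eta>(1) by (intro continuous_intros continuous_on_powr') auto
    fix j
    have eq: "?G x * ?Z x ^ j = (case x of (t, \<omega>) \<Rightarrow> exp (- \<gamma> * peak t \<omega> - (real j * \<eta>) * excess t \<omega>))" for x
      by (cases x) (simp add: exp_of_nat_mult[symmetric] mult_exp_exp mult_ac)
    have "integrable ?P (\<lambda>(t, \<omega>). exp (- \<gamma> * peak t \<omega> - (real j * \<eta>) * excess t \<omega>))"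
    proof (rule P.integrable_const_bound[where B=1])
      show "AE x in ?P. norm (case x of (t, \<omega>) \<Rightarrow> exp (- \<gamma> * peak t \<omega> - (real j * \<eta>) * excess t \<omega>)) \<le> 1"
        using laplace_exponent_nonpos[of _ \<gamma> "real j * \<eta>"] \<gamma> \<eta>(1) by (intro AE_I2) (auto simp: space_pair_measure)
    qed measurable
    from integral_fst'[OF this] have "(\<integral>x. ?G x * ?Z x ^ j \<partial>?P) = killed_laplace \<gamma> (real j * \<eta>)"
      unfolding eq by (simp add: killed_laplace_def)
    also have "\<dots> = \<nu>p / (\<nu>p + \<gamma>) * (\<nu>m / (\<nu>m + real j * \<eta>))"
      using \<gamma> \<eta> by (intro killed_laplace_eq) auto
    also have "\<nu>m / (\<nu>m + real j * \<eta>) = (\<integral>w. exp (- (real j * \<eta>) * w) \<partial>exp_law \<nu>m)"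
      using \<nu>_pos \<eta>(1) by (intro exp_law_laplace[symmetric]) auto
    also have "\<dots> = (\<integral>w. ?Z' w ^ j \<partial>exp_law \<nu>m)"
    proof (rule integral_cong_AE)
      show "AE w in exp_law \<nu>m. exp (- (real j * \<eta>) * w) = ?Z' w ^ j"
        using AE_exp_law_pos[OF \<nu>_pos(2)]
        by eventually_elim (simp add: exp_of_nat_mult[symmetric] mult_ac)
    qed measurable
    finally show "(\<integral>x. ?G x * ?Z x ^ j \<partial>?P) = \<nu>p / (\<nu>p + \<gamma>) * (\<integral>w. ?Z' w ^ j \<partial>exp_law \<nu>m)" .
  qed
  also have "(\<integral>w. k (?Z' w) \<partial>exp_law \<nu>m) = (\<integral>w. exp (- \<gamma> * max 0 (y - w)) \<partial>exp_law \<nu>m)"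
    unfolding k_exp
  proof (rule integral_cong_AE)
    show "AE w in exp_law \<nu>m. exp (- \<gamma> * max 0 (y - max 0 w)) = exp (- \<gamma> * max 0 (y - w))"
      using AE_exp_law_pos[OF \<nu>_pos(2)] by eventually_elim simp
  qed measurable
  also have "(\<integral>x. ?G x * k (?Z x) \<partial>?P)
      = (\<integral>(t, \<omega>). ?F t \<omega> \<partial>?P)"
  proof (intro Bochner_Integration.integral_cong refl)
    fix x
    have *: "max (peak t \<omega>) (y - X (max 0 t) \<omega>) = peak t \<omega> + max 0 (y - excess t \<omega>)" for t \<omega>
      by (auto simp: excess_def max_def)
    show "?G x * k (?Z x) = (case x of (t, \<omega>) \<Rightarrow> ?F t \<omega>)"
    proof (cases x)
      case (Pair t \<omega>)
      show ?thesis unfolding Pair split_conv k_exp * mult_exp_exp distrib_left ..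
    qed
  qed
  also have "\<dots> = (\<integral>t. \<integral>\<omega>. ?F t \<omega> \<partial>M \<partial>exp_law q)"
  proof -
    have "integrable ?P (\<lambda>(t, \<omega>). ?F t \<omega>)"
    proof (rule P.integrable_const_bound[where B=1])
      show "AE x in ?P. norm (case x of (t, \<omega>) \<Rightarrow> ?F t \<omega>) \<le> 1"
        using running_max_X_nonneg \<gamma> by (intro AE_I2) (auto simp: space_pair_measure le_max_iff_disj)
    qed measurable
    from integral_fst'[OF this] show ?thesis by simp
  qed
  finally show ?thesis .
qed

end

section \<open>The maximal net loss as a recursion over the periods\<close>

text \<open>The maximal net loss up to time \<open>s\<close>, if the current period has length \<open>t\<close> and \<open>V\<close> is the maximal net
  loss of the later periods. A period of length 0 contributes no value of its own before its default,
  so the running maximum is omitted then; this null case is kept exact in order that the maximal net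
  loss equals a measurable function everywhere and not only almost surely.\<close>

definition loss_step :: "'a realization \<Rightarrow> nat \<Rightarrow> (real \<Rightarrow> 'a \<Rightarrow> real) \<Rightarrow> real \<Rightarrow> real \<Rightarrow> 'a \<Rightarrow> real" where
  "loss_step R i V t s \<omega> =
     (let Y = loss R i \<omega> + V (s - t) \<omega> - motion R i (max 0 t) \<omega> in
      if s < t then running_max (motion R i) (max 0 s) \<omega>
      else if t = 0 then Y
      else max (running_max (motion R i) (max 0 t) \<omega>) Y)"

primrec max_loss_upto :: "'a realization \<Rightarrow> nat \<Rightarrow> real \<Rightarrow> 'a \<Rightarrow> real" where
  "max_loss_upto R 0 = (\<lambda>s \<omega>. 0)"
| "max_loss_upto R (Suc m) = (\<lambda>s \<omega>. loss_step R (Suc m) (max_loss_upto R m) (default_time R (Suc m) \<omega>) s \<omega>)"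

definition regular :: "'a realization \<Rightarrow> nat \<Rightarrow> 'a \<Rightarrow> bool" where
  "regular R n \<omega> \<longleftrightarrow> (\<forall>i\<in>{1..n}. continuous_on {0..} (\<lambda>t. motion R i t \<omega>) \<and> motion R i 0 \<omega> = 0 \<and> 0 \<le> default_time R i \<omega>)"

lemma regular_SucD:
  assumes "regular R (Suc m) \<omega>"
  shows "regular R m \<omega>" "continuous_on {0..} (\<lambda>t. motion R (Suc m) t \<omega>)" "motion R (Suc m) 0 \<omega> = 0"
    "0 \<le> default_time R (Suc m) \<omega>"
  using assms by (auto simp: regular_def)

lemma running_max_le_iff:
  fixes X :: "real \<Rightarrow> 'a \<Rightarrow> real"
  assumes "continuous_on {0..} (\<lambda>t. X t \<omega>)" "0 \<le> t"
  shows "running_max X t \<omega> \<le> b \<longleftrightarrow> (\<forall>u\<in>{0..t}. - X u \<omega> \<le> b)"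
  unfolding running_max_def using assms path_bdd_above[where X=X and \<omega>=\<omega>, OF assms(1), of t]
  by (subst cSUP_le_iff) auto

text \<open>At the default epoch the Brownian value has already been replaced by the value after the loss; by
  continuity the supremum over the half-open period is nevertheless the maximum over the closed one.\<close>

lemma running_max_le_iff_half_open:
  fixes X :: "real \<Rightarrow> 'a \<Rightarrow> real"
  assumes "continuous_on {0..} (\<lambda>t. X t \<omega>)" "0 < t"
  shows "running_max X t \<omega> \<le> b \<longleftrightarrow> (\<forall>u\<in>{0..<t}. - X u \<omega> \<le> b)"
proof
  assume *: "\<forall>u\<in>{0..<t}. - X u \<omega> \<le> b"
  have cl: "closure {0..<t} = {0..t}" using assms by simp
  have "continuous_on {0..t} (\<lambda>u. - X u \<omega>)"
    by (intro continuous_on_minus continuous_on_subset[OF assms(1)]) auto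
  then have "- X u \<omega> \<le> b" if "u \<in> {0..t}" for u
    using continuous_le_on_closure[of "{0..<t}" "\<lambda>u. - X u \<omega>" u b] * that unfolding cl by auto
  then show "running_max X t \<omega> \<le> b" using running_max_le_iff[where X=X and \<omega>=\<omega>, OF assms(1)] assms(2) by auto
qed (use running_max_le_iff[where X=X and \<omega>=\<omega>, OF assms(1), of t b] assms(2) in auto)

lemma net_loss_Suc:
  "net_loss R (Suc m) 0 s \<omega> =
    (let T = default_time R (Suc m) \<omega> in
     if s < T then - motion R (Suc m) s \<omega>
     else loss R (Suc m) \<omega> + net_loss R m 0 (s - T) \<omega> - motion R (Suc m) T \<omega>)"
  using reserve_shift[of R m 0 "motion R (Suc m) (default_time R (Suc m) \<omega>) \<omega> - loss R (Suc m) \<omega>"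
      "s - default_time R (Suc m) \<omega>" \<omega>]
  by (simp add: net_loss_def Let_def)

text \<open>Stating that the recursion has the same upper bounds as the path avoids separate arguments for
  boundedness and for the supremum being attained.\<close>

lemma net_loss_bounded_iff:
  assumes "regular R m \<omega>" "0 \<le> s"
  shows "(\<forall>u\<in>{0..s}. net_loss R m 0 u \<omega> \<le> b) \<longleftrightarrow> max_loss_upto R m s \<omega> \<le> b"
  using assms
proof (induction m arbitrary: s b)
  case 0
  then show ?case by (auto simp: net_loss_def)
next
  case (Suc m)
  note reg = regular_SucD[OF Suc.prems(1)]
  let ?X = "motion R (Suc m)" and ?T = "default_time R (Suc m) \<omega>" and ?L = "loss R (Suc m) \<omega>"
  note rm = running_max_le_iff[where X="?X" and \<omega>=\<omega>, OF reg(2)]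
    and rmo = running_max_le_iff_half_open[where X="?X" and \<omega>=\<omega>, OF reg(2)]
  let ?late = "\<forall>u\<in>{?T..s}. ?L + net_loss R m 0 (u - ?T) \<omega> - ?X ?T \<omega> \<le> b"
  have late: "?late \<longleftrightarrow> ?L + max_loss_upto R m (s - ?T) \<omega> - ?X ?T \<omega> \<le> b" if "?T \<le> s"
  proof -
    have "?late \<longleftrightarrow> (\<forall>u\<in>{0..s - ?T}. net_loss R m 0 u \<omega> \<le> b - ?L + ?X ?T \<omega>)"
    proof
      assume l: ?late
      show "\<forall>u\<in>{0..s - ?T}. net_loss R m 0 u \<omega> \<le> b - ?L + ?X ?T \<omega>"
      proof
        fix u assume "u \<in> {0..s - ?T}"
        then have "u + ?T \<in> {?T..s}" by auto
        then show "net_loss R m 0 u \<omega> \<le> b - ?L + ?X ?T \<omega>" using l by fastforce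
      qed
    next
      assume l: "\<forall>u\<in>{0..s - ?T}. net_loss R m 0 u \<omega> \<le> b - ?L + ?X ?T \<omega>"
      show ?late
      proof
        fix u assume "u \<in> {?T..s}"
        then have "u - ?T \<in> {0..s - ?T}" by auto
        then show "?L + net_loss R m 0 (u - ?T) \<omega> - ?X ?T \<omega> \<le> b" using l by fastforce
      qed
    qed
    also have "\<dots> \<longleftrightarrow> max_loss_upto R m (s - ?T) \<omega> \<le> b - ?L + ?X ?T \<omega>"
      using that by (intro Suc.IH reg) auto
    finally show ?thesis by auto
  qed
  have T: "max 0 ?T = ?T" and s: "max 0 s = s" using reg(4) Suc.prems(2) by auto
  consider "s < ?T" | "?T = 0" | "0 < ?T" "?T \<le> s" using reg(4) by linarith
  then show ?case
  proof cases
    case 1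
    then show ?thesis
      using rm[of s b] Suc.prems(2) by (auto simp: net_loss_Suc loss_step_def s)
  next
    case 2
    then show ?thesis
      using late Suc.prems(2) by (auto simp: net_loss_Suc loss_step_def T)
  next
    case 3
    have "(\<forall>u\<in>{0..s}. net_loss R (Suc m) 0 u \<omega> \<le> b) \<longleftrightarrow> (\<forall>u\<in>{0..<?T}. - ?X u \<omega> \<le> b) \<and> ?late"
      using 3 by (force simp: net_loss_Suc Let_def)
    also have "\<dots> \<longleftrightarrow> running_max ?X ?T \<omega> \<le> b \<and> ?L + max_loss_upto R m (s - ?T) \<omega> - ?X ?T \<omega> \<le> b"
      using rmo[OF 3(1)] late[OF 3(2)] by simp
    also have "\<dots> \<longleftrightarrow> max_loss_upto R (Suc m) s \<omega> \<le> b"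
      using 3 by (auto simp: loss_step_def T)
    finally show ?thesis .
  qed
qed

lemma max_net_loss_eq:
  assumes "regular R n \<omega>" "0 \<le> horizon R \<omega>"
  shows "max_net_loss R n \<omega> = max_loss_upto R n (horizon R \<omega>) \<omega>"
  unfolding max_net_loss_def using net_loss_bounded_iff[OF assms]
  by (intro cSup_eq) auto

lemma max_loss_upto_nonneg:
  assumes "regular R m \<omega>" "\<And>i. i \<in> {1..m} \<Longrightarrow> 0 < default_time R i \<omega>"
  shows "0 \<le> max_loss_upto R m s \<omega>"
  using assms
proof (induction m arbitrary: s)
  case (Suc m)
  note reg = regular_SucD[OF Suc.prems(1)]
  have "0 \<le> running_max (motion R (Suc m)) (max 0 t) \<omega>" for t
    by (intro running_max_nonneg reg) auto
  moreover have "default_time R (Suc m) \<omega> \<noteq> 0" using Suc.prems(2)[of "Suc m"] by simp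
  ultimately show ?case by (auto simp: loss_step_def Let_def le_max_iff_disj)
qed simp

section \<open>Independence of the sources\<close>

definition info :: "'a realization \<Rightarrow> source set \<Rightarrow> 'a measure" where
  "info R S = sigma (space (base R)) (\<Union>k\<in>S. source_events R k)"

lemma source_events_Pow: "source_events R k \<subseteq> Pow (space (base R))"
proof -
  have "sets (vimage_algebra (space (base R)) f N) \<subseteq> Pow (space (base R))" for f :: "'a \<Rightarrow> real" and N
    using sets.space_closed[of "vimage_algebra (space (base R)) f N"] by simp
  moreover have "sets (vimage_algebra (space (base R)) f N) \<subseteq> Pow (space (base R))" for f :: "'a \<Rightarrow> real \<Rightarrow> real" and N
    using sets.space_closed[of "vimage_algebra (space (base R)) f N"] by simp
  ultimately show ?thesis by (cases k) simp_all
qed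

lemma space_info [simp]: "space (info R S) = space (base R)"
  and sets_info: "sets (info R S) = sigma_sets (space (base R)) (\<Union>k\<in>S. source_events R k)"
  unfolding info_def using source_events_Pow by (auto intro!: space_measure_of sets_measure_of)

lemma source_events_info: "k \<in> S \<Longrightarrow> source_events R k \<subseteq> sets (info R S)"
  unfolding sets_info by auto

lemma measurable_info_vimage:
  assumes k: "k \<in> S" and ev: "source_events R k = sets (vimage_algebra (space (base R)) f N)"
    and f: "f \<in> space (base R) \<rightarrow> space N"
  shows "f \<in> measurable (info R S) N"
proof (rule measurableI)
  show "x \<in> space (info R S) \<Longrightarrow> f x \<in> space N" for x using f by auto
  fix A assume "A \<in> sets N"
  then have "f -` A \<inter> space (base R) \<in> source_events R k"
    unfolding ev by (rule in_vimage_algebra)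
  then show "f -` A \<inter> space (info R S) \<in> sets (info R S)"
    using source_events_info[OF k] by auto
qed

lemma measurable_info:
  shows "Default i \<in> S \<Longrightarrow> default_time R i \<in> borel_measurable (info R S)"
    and "Loss i \<in> S \<Longrightarrow> loss R i \<in> borel_measurable (info R S)"
    and "Horizon \<in> S \<Longrightarrow> horizon R \<in> borel_measurable (info R S)"
    and "Motion i \<in> S \<Longrightarrow> 0 \<le> t \<Longrightarrow> motion R i t \<in> borel_measurable (info R S)"
proof -
  show "Default i \<in> S \<Longrightarrow> default_time R i \<in> borel_measurable (info R S)"
    by (rule measurable_info_vimage[where k="Default i"]) auto
  show "Loss i \<in> S \<Longrightarrow> loss R i \<in> borel_measurable (info R S)"
    by (rule measurable_info_vimage[where k="Loss i"]) auto
  show "Horizon \<in> S \<Longrightarrow> horizon R \<in> borel_measurable (info R S)"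
    by (rule measurable_info_vimage[where k=Horizon]) auto
  assume M: "Motion i \<in> S" and t: "0 \<le> t"
  have path: "(\<lambda>\<omega>. \<lambda>t\<in>{0..}. motion R i t \<omega>) \<in> measurable (info R S) (\<Pi>\<^sub>M t\<in>{0..}. borel)"
    using M by (rule measurable_info_vimage) (auto simp: space_PiM)
  have coord: "(\<lambda>x. x t) \<in> borel_measurable (\<Pi>\<^sub>M t\<in>{0..}. (borel :: real measure))"
    using t by (intro measurable_component_singleton) simp
  show "motion R i t \<in> borel_measurable (info R S)"
    using measurable_compose[OF path coord] t by simp
qed

definition period_sources :: "nat \<Rightarrow> source set" where
  "period_sources n = (\<Union>i\<in>{1..n}. {Motion i, Default i, Loss i})"

context
  fixes R :: "'a realization" and n :: nat
  assumes regular: "\<And>\<omega>. \<omega> \<in> space (base R) \<Longrightarrow> regular R n \<omega>"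
begin

lemma measurable_motion_compose:
  assumes "i \<in> {1..n}" "Motion i \<in> S" "f \<in> borel_measurable N" "g \<in> measurable N (info R S)"
  shows "(\<lambda>x. motion R i (max 0 (f x)) (g x)) \<in> borel_measurable N"
    "(\<lambda>x. running_max (motion R i) (max 0 (f x)) (g x)) \<in> borel_measurable N"
proof -
  have m: "\<And>t. 0 \<le> t \<Longrightarrow> motion R i t \<in> borel_measurable (info R S)"
    using assms(2) by (rule measurable_info(4))
  have c: "\<And>\<omega>. \<omega> \<in> space (info R S) \<Longrightarrow> continuous_on {0..} (\<lambda>t. motion R i t \<omega>)"
    and z: "\<And>\<omega>. \<omega> \<in> space (info R S) \<Longrightarrow> motion R i 0 \<omega> = 0"
    using regular assms(1) by (auto simp: regular_def)
  show "(\<lambda>x. motion R i (max 0 (f x)) (g x)) \<in> borel_measurable N"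
    by (rule measurable_path_compose[OF m c assms(3,4)])
  show "(\<lambda>x. running_max (motion R i) (max 0 (f x)) (g x)) \<in> borel_measurable N"
    by (rule measurable_running_max_compose[OF m c z assms(3,4)])
qed

lemma measurable_loss_step_compose:
  assumes i: "i \<in> {1..n}" "Motion i \<in> S" "Loss i \<in> S"
    and [measurable]: "f \<in> borel_measurable N" "t \<in> borel_measurable N" "g \<in> measurable N (info R S)"
    and V [measurable]: "(\<lambda>x. V (f x - t x) (g x)) \<in> borel_measurable N"
  shows "(\<lambda>x. loss_step R i V (t x) (f x) (g x)) \<in> borel_measurable N"
proof -
  note [measurable] = measurable_motion_compose[OF i(1,2), of f N g] measurable_motion_compose[OF i(1,2), of t N g]
    measurable_compose[OF _ measurable_info(2)[OF i(3)], of g N]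
  show ?thesis unfolding loss_step_def Let_def by measurable
qed

lemma measurable_max_loss_upto_compose:
  assumes "m \<le> n" "period_sources m \<subseteq> S" "f \<in> borel_measurable N" "g \<in> measurable N (info R S)"
  shows "(\<lambda>x. max_loss_upto R m (f x) (g x)) \<in> borel_measurable N"
  using assms
proof (induction m arbitrary: f)
  case (Suc m)
  have src: "Motion (Suc m) \<in> S" "Default (Suc m) \<in> S" "Loss (Suc m) \<in> S" "period_sources m \<subseteq> S"
    using Suc.prems(2) by (auto simp: period_sources_def)
  have T: "(\<lambda>x. default_time R (Suc m) (g x)) \<in> borel_measurable N"
    using Suc.prems(4) measurable_info(1)[OF src(2)] by (rule measurable_compose)
  show ?case
    unfolding max_loss_upto.simps using Suc.prems src T
    by (intro measurable_loss_step_compose[where S=S] Suc.IH borel_measurable_diff) auto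
qed simp

end

locale obligor_process =
  fixes R :: "'a realization" and \<theta> :: real and lam r v :: "nat \<Rightarrow> real" and Q :: "real measure" and n :: nat
  assumes model: "obligor_model \<theta> lam r v Q n R"
    and \<theta>: "0 < \<theta>"
    and rates: "\<And>i. 1 \<le> i \<Longrightarrow> 0 < lam i" "\<And>i. 1 \<le> i \<Longrightarrow> 0 < r i" "\<And>i. 1 \<le> i \<Longrightarrow> 0 < v i"
    and losses_nonneg: "AE x in Q. 0 \<le> x"
begin

sublocale prob_space "base R"
  using model by (simp add: obligor_model_def)

abbreviation "M \<equiv> base R"
abbreviation "all_sources \<equiv> insert Horizon (period_sources n)"

lemma regular: "\<omega> \<in> space M \<Longrightarrow> regular R n \<omega>"
  using model by (auto simp: obligor_model_def regular_def brownian_motion_def)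

lemma default_law: "i \<in> {1..n} \<Longrightarrow> distributed M lborel (default_time R i) (exponential_density (lam i))"
  and horizon_law: "distributed M lborel (horizon R) (exponential_density \<theta>)"
  and loss_law: "i \<in> {1..n} \<Longrightarrow> distr M borel (loss R i) = Q"
  and loss_measurable: "i \<in> {1..n} \<Longrightarrow> loss R i \<in> borel_measurable M"
  and horizon_nonneg: "\<omega> \<in> space M \<Longrightarrow> 0 \<le> horizon R \<omega>"
  and sources_indep: "indep_sets (source_events R) all_sources"
  using model by (auto simp: obligor_model_def period_sources_def)

lemma sets_info_le:
  assumes "S \<subseteq> all_sources" shows "sets (info R S) \<subseteq> events"
proof -
  have "source_events R k \<subseteq> events" if "k \<in> S" for k
    using sources_indep that assms unfolding indep_sets_def by blast
  then show ?thesis unfolding sets_info by (intro sets.sigma_sets_subset) auto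
qed

lemma measurable_to_info:
  assumes "S \<subseteq> all_sources" "g \<in> measurable N M" shows "g \<in> measurable N (info R S)"
  using assms(2) sets_info_le[OF assms(1)] unfolding measurable_def by auto

text \<open>The identity maps of the base space into two sub-sigma-algebras are independent random variables when
  the sub-sigma-algebras are generated by disjoint sets of sources. Therefore an expectation of a
  function of both can be computed with two independent copies of the sample point, even though the
  function depends on whole paths.\<close>

lemma decouple:
  fixes f :: "'a \<times> 'a \<Rightarrow> real"
  assumes S: "S \<inter> S' = {}" "S \<subseteq> all_sources" "S' \<subseteq> all_sources"
    and f [measurable]: "f \<in> borel_measurable (info R S \<Otimes>\<^sub>M info R S')"
    and bound: "\<And>x y. x \<in> space M \<Longrightarrow> y \<in> space M \<Longrightarrow> \<bar>f (x, y)\<bar> \<le> b"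
  shows "expectation (\<lambda>\<omega>. f (\<omega>, \<omega>)) = expectation (\<lambda>x. expectation (\<lambda>y. f (x, y)))"
proof -
  let ?P = "distr M (info R S) (\<lambda>x. x)" and ?P' = "distr M (info R S') (\<lambda>x. x)"
  have id: "(\<lambda>x. x) \<in> measurable M (info R S)" "(\<lambda>x. x) \<in> measurable M (info R S')"
    using S by (auto intro: measurable_to_info)
  have "indep_sets (\<lambda>j. sigma_sets (space M) (\<Union>k\<in>case_bool S S' j. source_events R k)) UNIV"
  proof (rule indep_sets_collect_sigma)
    show "indep_sets (source_events R) (\<Union>j\<in>UNIV. case_bool S S' j)"
      by (rule indep_sets_mono_index[OF _ sources_indep]) (use S in \<open>auto split: bool.splits\<close>)
    show "Int_stable (source_events R k)" for k
      by (cases k) (auto simp: sets.Int_stable)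
    show "disjoint_family_on (case_bool S S') UNIV"
      using S by (auto simp: disjoint_family_on_def split: bool.splits)
  qed
  also have "(\<lambda>j. sigma_sets (space M) (\<Union>k\<in>case_bool S S' j. source_events R k)) = case_bool (sets (info R S)) (sets (info R S'))"
    by (auto simp: sets_info split: bool.splits)
  finally have "indep_set (sets (info R S)) (sets (info R S'))" by (simp add: indep_set_def)
  moreover have "sigma_sets (space M) {(\<lambda>x. x) -` A \<inter> space M |A. A \<in> sets (info R T)} = sets (info R T)" for T
  proof -
    have "{(\<lambda>x. x) -` A \<inter> space M |A. A \<in> sets (info R T)} = sets (info R T)"
      using sets.sets_into_space[of _ "info R T"] by (auto simp: Int_absorb2)
    then show ?thesis using sets.sigma_sets_eq[of "info R T"] by simp
  qed
  ultimately have "indep_var (info R S) (\<lambda>x. x) (info R S') (\<lambda>x. x)"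
    unfolding indep_var_eq using id by simp
  then have joint: "?P \<Otimes>\<^sub>M ?P' = distr M (info R S \<Otimes>\<^sub>M info R S') (\<lambda>x. (x, x))"
    unfolding indep_var_distribution_eq by blast
  interpret P1: prob_space "?P" using id(1) by (rule prob_space_distr)
  interpret P2: prob_space "?P'" using id(2) by (rule prob_space_distr)
  interpret PP: pair_prob_space "?P" "?P'" ..
  have "expectation (\<lambda>\<omega>. f (\<omega>, \<omega>)) = integral\<^sup>L (?P \<Otimes>\<^sub>M ?P') f"
    unfolding joint using id by (subst integral_distr) auto
  also have "\<dots> = (\<integral>x. \<integral>y. f (x, y) \<partial>?P' \<partial>?P)"
  proof (rule PP.integral_fst'[symmetric])
    show "integrable (?P \<Otimes>\<^sub>M ?P') f"
      using bound by (intro PP.P.integrable_const_bound[where B=b]) (auto simp: space_pair_measure)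
  qed
  also have "\<dots> = (\<integral>x. \<integral>y. f (x, y) \<partial>?P' \<partial>M)"
  proof (rule integral_distr[OF id(1)])
    have "(\<lambda>x. \<integral>y. f (x, y) \<partial>?P') \<in> borel_measurable (info R S)"
      by measurable
    then show "(\<lambda>x. \<integral>y. f (x, y) \<partial>?P') \<in> borel_measurable (info R S)" .
  qed
  also have "\<dots> = expectation (\<lambda>x. expectation (\<lambda>y. f (x, y)))"
  proof (rule Bochner_Integration.integral_cong[OF refl])
    fix x assume "x \<in> space M"
    then have "(\<lambda>y. f (x, y)) \<in> borel_measurable (info R S')"
      using measurable_compose[OF measurable_Pair1'[of x "info R S" "info R S'"] f] by simp
    then show "(\<integral>y. f (x, y) \<partial>?P') = expectation (\<lambda>y. f (x, y))"
      by (rule integral_distr[OF id(2)])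
  qed
  finally show ?thesis .
qed

lemma expectation_exponential:
  fixes g :: "real \<Rightarrow> real"
  assumes T: "distributed M lborel T (exponential_density a)" and "g \<in> borel_measurable borel"
  shows "expectation (\<lambda>\<omega>. g (T \<omega>)) = (\<integral>t. g t \<partial>exp_law a)"
proof -
  have "distr M lborel T = exp_law a" using T by (rule distributed_distr_eq_density)
  then show ?thesis
    using integral_distr[of T M lborel g] distributed_measurable[OF T] assms(2) by simp
qed

lemma AE_default_pos: "AE \<omega> in M. \<forall>i\<in>{1..n}. 0 < default_time R i \<omega>"
proof (rule AE_finite_allI)
  fix i assume i: "i \<in> {1..n}"
  have "AE t in distr M lborel (default_time R i). 0 < t"
    unfolding distributed_distr_eq_density[OF default_law[OF i]] using rates(1)[of i] i by (intro AE_exp_law_pos) auto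
  then show "AE \<omega> in M. 0 < default_time R i \<omega>"
    using distributed_measurable[OF default_law[OF i]] by (rule AE_distrD[rotated])
qed simp

lemma AE_loss_nonneg: "i \<in> {1..n} \<Longrightarrow> AE \<omega> in M. 0 \<le> loss R i \<omega>"
  using losses_nonneg loss_law[of i] loss_measurable[of i] by (metis AE_distrD)

lemma AE_max_loss_nonneg: "m \<le> n \<Longrightarrow> AE \<omega> in M. \<forall>s. 0 \<le> max_loss_upto R m s \<omega>"
  using AE_default_pos AE_space
proof eventually_elim
  case (elim \<omega>)
  then have "regular R m \<omega>" using regular[of \<omega>] by (auto simp: regular_def)
  with elim show ?case by (auto intro!: max_loss_upto_nonneg)
qed

lemma measurable_max_loss [measurable (raw)]:
  assumes "m \<le> n" "f \<in> borel_measurable N" "g \<in> measurable N M"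
  shows "(\<lambda>x. max_loss_upto R m (f x) (g x)) \<in> borel_measurable N"
proof (rule measurable_max_loss_upto_compose[OF regular assms(1) _ assms(2)])
  show "g \<in> measurable N (info R (period_sources n))" using assms(3) by (intro measurable_to_info) auto
  show "period_sources m \<subseteq> period_sources n" using assms(1) by (force simp: period_sources_def)
qed

definition loss_laplace :: "nat \<Rightarrow> real \<Rightarrow> real \<Rightarrow> real" where
  "loss_laplace m \<gamma> s = expectation (\<lambda>\<omega>. exp (- \<gamma> * max 0 (max_loss_upto R m s \<omega>)))"

definition killed_loss_laplace :: "nat \<Rightarrow> real \<Rightarrow> real" where
  "killed_loss_laplace m \<gamma> = (\<integral>s. loss_laplace m \<gamma> s \<partial>exp_law \<theta>)"

lemma measurable_loss_laplace [measurable]: "m \<le> n \<Longrightarrow> loss_laplace m \<gamma> \<in> borel_measurable borel"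
  unfolding loss_laplace_def by measurable

lemma loss_laplace_le: "0 < \<gamma> \<Longrightarrow> \<bar>loss_laplace m \<gamma> s\<bar> \<le> 1"
  unfolding loss_laplace_def by (intro abs_expectation_le) auto

text \<open>Decoupling the horizon from all other sources.\<close>

lemma expectation_killed:
  assumes "m \<le> n" "0 < \<gamma>"
  shows "expectation (\<lambda>\<omega>. exp (- \<gamma> * max 0 (max_loss_upto R m (horizon R \<omega>) \<omega>))) = killed_loss_laplace m \<gamma>"
proof -
  let ?f = "\<lambda>(h, \<omega>). exp (- \<gamma> * max 0 (max_loss_upto R m (horizon R h) \<omega>))"
  have sub: "period_sources m \<subseteq> period_sources n" using assms(1) by (force simp: period_sources_def)
  have "expectation (\<lambda>\<omega>. ?f (\<omega>, \<omega>)) = expectation (\<lambda>h. expectation (\<lambda>\<omega>. ?f (h, \<omega>)))"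
  proof (rule decouple[of "{Horizon}" "period_sources m" _ 1])
    have [measurable]: "(\<lambda>x. max_loss_upto R m (horizon R (fst x)) (snd x)) \<in> borel_measurable (info R {Horizon} \<Otimes>\<^sub>M info R (period_sources m))"
      by (rule measurable_max_loss_upto_compose[OF regular assms(1) order_refl])
        (auto intro: measurable_compose[OF _ measurable_info(3)])
    show "?f \<in> borel_measurable (info R {Horizon} \<Otimes>\<^sub>M info R (period_sources m))"
      unfolding split_beta' by measurable
  qed (use assms sub in \<open>auto simp: period_sources_def\<close>)
  also have "\<dots> = expectation (\<lambda>h. loss_laplace m \<gamma> (horizon R h))" by (simp add: loss_laplace_def)
  also have "\<dots> = killed_loss_laplace m \<gamma>"
    unfolding killed_loss_laplace_def using assms by (intro expectation_exponential[OF horizon_law]) auto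
  finally show ?thesis by simp
qed

end

section \<open>Conditioning on the first period\<close>

text \<open>The first period of the model with \<open>Suc m\<close> obligors, realized inside a model with possibly more of
  them.\<close>

locale obligor_period = obligor_process +
  fixes m :: nat
  assumes m: "Suc m \<le> n"
begin

abbreviation "X \<equiv> motion R (Suc m)"
abbreviation "rate \<equiv> lam (Suc m)"
abbreviation "q \<equiv> lam (Suc m) + \<theta>"

sublocale bm: drifted_bm "base R" X "r (Suc m)" "v (Suc m)" q
proof
  show "brownian_motion M (r (Suc m)) (v (Suc m)) X"
    using model m by (auto simp: obligor_model_def)
qed (use rates \<theta> in \<open>auto intro: add_pos_pos\<close>)

lemma rate: "0 < rate" using rates by simp

text \<open>The transform of the maximal net loss in the case that the first period lasts until \<open>t\<close> and that \<open>y\<close>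
  is the default loss plus the maximal net loss after it. The level \<open>y = 0\<close> covers the case that
  the horizon is reached first.\<close>

definition K :: "real \<Rightarrow> real \<Rightarrow> real \<Rightarrow> real" where
  "K \<gamma> t y = expectation (\<lambda>\<omega>. exp (- \<gamma> * max (running_max X (max 0 t) \<omega>) (y - X (max 0 t) \<omega>)))"

definition later_loss :: "real \<Rightarrow> 'a \<Rightarrow> real" where
  "later_loss s \<omega> = loss R (Suc m) \<omega> + max_loss_upto R m s \<omega>"

lemma measurable_later_loss [measurable (raw)]:
  "f \<in> borel_measurable N \<Longrightarrow> g \<in> measurable N M \<Longrightarrow> (\<lambda>x. later_loss (f x) (g x)) \<in> borel_measurable N"
  unfolding later_loss_def using m loss_measurable[of "Suc m"]
  by (intro borel_measurable_add measurable_max_loss measurable_compose[of g N M "loss R (Suc m)"]) auto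

lemma measurable_K [measurable (raw)]:
  assumes [measurable]: "f \<in> borel_measurable N" "g \<in> borel_measurable N"
  shows "(\<lambda>x. K \<gamma> (f x) (g x)) \<in> borel_measurable N"
  unfolding K_def by measurable

lemma K_integrand_le:
  "0 < \<gamma> \<Longrightarrow> \<omega> \<in> space M \<Longrightarrow> \<bar>exp (- \<gamma> * max (running_max X (max 0 t) \<omega>) (y - X (max 0 t) \<omega>))\<bar> \<le> 1"
  using bm.running_max_X_nonneg[of \<omega> t] by (simp add: le_max_iff_disj)

lemma K_le: "0 < \<gamma> \<Longrightarrow> \<bar>K \<gamma> t y\<bar> \<le> 1"
  unfolding K_def by (intro abs_expectation_le K_integrand_le)

abbreviation "step \<equiv> loss_step R (Suc m) (max_loss_upto R m)"

lemma measurable_step: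
  assumes "f \<in> borel_measurable N" "g \<in> measurable N (info R ({Motion (Suc m), Loss (Suc m)} \<union> period_sources m))"
  shows "(\<lambda>x. step (f x) e (g x)) \<in> borel_measurable N"
proof (rule measurable_loss_step_compose[OF regular _ _ _ _ assms])
  show "(\<lambda>x. max_loss_upto R m (e - f x) (g x)) \<in> borel_measurable N"
    using m assms by (intro measurable_max_loss_upto_compose[OF regular _ _ _ assms(2)] borel_measurable_diff) auto
qed (use m in auto)

lemma measurable_step_laplace:
  "(\<lambda>t. expectation (\<lambda>\<omega>. exp (- \<gamma> * max 0 (step t e \<omega>)))) \<in> borel_measurable borel"
proof -
  have "{Motion (Suc m), Loss (Suc m)} \<union> period_sources m \<subseteq> all_sources" using m by (auto simp: period_sources_def)
  then have [measurable]: "(\<lambda>x. step (fst x) e (snd x)) \<in> borel_measurable (borel \<Otimes>\<^sub>M M)"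
    by (intro measurable_step measurable_to_info) auto
  show ?thesis
    using borel_measurable_lebesgue_integral[of "\<lambda>t \<omega>. exp (- \<gamma> * max 0 (step t e \<omega>))" borel]
    by (simp add: split_beta')
qed

lemma condition_on_default:
  assumes "0 < \<gamma>"
  shows "loss_laplace (Suc m) \<gamma> e
    = (\<integral>t. expectation (\<lambda>\<omega>. exp (- \<gamma> * max 0 (step t e \<omega>))) \<partial>exp_law rate)"
proof -
  let ?S = "{Motion (Suc m), Loss (Suc m)} \<union> period_sources m" and ?D = "{Default (Suc m)}"
  let ?f = "\<lambda>(\<tau>, \<omega>). exp (- \<gamma> * max 0 (step (default_time R (Suc m) \<tau>) e \<omega>))"
  have i: "Suc m \<in> {1..n}" using m by simp
  have S: "?S \<subseteq> all_sources" "?D \<subseteq> all_sources" using m by (auto simp: period_sources_def)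
  have "expectation (\<lambda>\<omega>. ?f (\<omega>, \<omega>)) = expectation (\<lambda>\<tau>. expectation (\<lambda>\<omega>. ?f (\<tau>, \<omega>)))"
  proof (rule decouple[of ?D ?S _ 1])
    have [measurable]: "(\<lambda>x. step (default_time R (Suc m) (fst x)) e (snd x)) \<in> borel_measurable (info R ?D \<Otimes>\<^sub>M info R ?S)"
      by (intro measurable_step measurable_compose[OF measurable_fst measurable_info(1)] measurable_snd) simp
    show "?f \<in> borel_measurable (info R ?D \<Otimes>\<^sub>M info R ?S)"
      unfolding split_beta' by measurable
    show "?D \<inter> ?S = {}" by (auto simp: period_sources_def)
  qed (use assms S in auto)
  also have "\<dots> = (\<integral>t. expectation (\<lambda>\<omega>. exp (- \<gamma> * max 0 (step t e \<omega>))) \<partial>exp_law rate)"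
    using expectation_exponential[OF default_law[OF i] measurable_step_laplace] by simp
  finally show ?thesis by (simp add: loss_laplace_def)
qed

lemma condition_on_motion:
  assumes "0 < \<gamma>" "0 < t" "0 \<le> e"
  shows "expectation (\<lambda>\<omega>. exp (- \<gamma> * max 0 (step t e \<omega>)))
    = (if e < t then K \<gamma> e 0 else expectation (\<lambda>\<omega>. K \<gamma> t (later_loss (e - t) \<omega>)))"
proof (cases "e < t")
  case True
  have "max 0 (step t e \<omega>) = max (running_max X (max 0 e) \<omega>) (0 - X (max 0 e) \<omega>)"
    if "\<omega> \<in> space M" for \<omega>
    using True bm.running_max_X_nonneg[OF that, of e] bm.excess_nonneg[OF that, of e]
    by (simp add: loss_step_def bm.excess_def)
  then show ?thesis
    using True by (auto simp: K_def intro!: Bochner_Integration.integral_cong)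
next
  case False
  let ?S = "{Loss (Suc m)} \<union> period_sources m" and ?W = "{Motion (Suc m)}"
  let ?f = "\<lambda>(\<eta>, \<omega>). exp (- \<gamma> * max (running_max X (max 0 t) \<omega>) (later_loss (e - t) \<eta> - X (max 0 t) \<omega>))"
  have i: "Suc m \<in> {1..n}" using m by simp
  have S: "?S \<subseteq> all_sources" "?W \<subseteq> all_sources" using m by (auto simp: period_sources_def)
  have "max 0 (step t e \<omega>)
      = max (running_max X (max 0 t) \<omega>) (later_loss (e - t) \<omega> - X (max 0 t) \<omega>)" if "\<omega> \<in> space M" for \<omega>
    using False assms bm.running_max_X_nonneg[OF that, of t]
    by (simp add: loss_step_def later_loss_def)
  then have "expectation (\<lambda>\<omega>. exp (- \<gamma> * max 0 (step t e \<omega>))) = expectation (\<lambda>\<omega>. ?f (\<omega>, \<omega>))"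
    by (intro Bochner_Integration.integral_cong) auto
  also have "\<dots> = expectation (\<lambda>\<eta>. expectation (\<lambda>\<omega>. ?f (\<eta>, \<omega>)))"
  proof (rule decouple[of ?S ?W _ 1])
    have [measurable]: "(\<lambda>x. later_loss (e - t) (fst x)) \<in> borel_measurable (info R ?S \<Otimes>\<^sub>M info R ?W)"
      unfolding later_loss_def using m
      by (intro borel_measurable_add measurable_compose[OF measurable_fst measurable_info(2)]
          measurable_max_loss_upto_compose[OF regular _ _ _ measurable_fst[of "info R ?S"]]) auto
    have [measurable]: "(\<lambda>x. X (max 0 t) (snd x)) \<in> borel_measurable (info R ?S \<Otimes>\<^sub>M info R ?W)"
      "(\<lambda>x. running_max X (max 0 t) (snd x)) \<in> borel_measurable (info R ?S \<Otimes>\<^sub>M info R ?W)"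
      by (rule measurable_motion_compose[OF regular i _ _ measurable_snd[of _ "info R ?W"]]; simp)+
    show "?f \<in> borel_measurable (info R ?S \<Otimes>\<^sub>M info R ?W)"
      unfolding split_beta' by measurable
    show "?S \<inter> ?W = {}" by (auto simp: period_sources_def)
    show "\<bar>?f (x, y)\<bar> \<le> 1" if "x \<in> space M" "y \<in> space M" for x y
      using K_integrand_le[OF assms(1) that(2)] by simp
  qed (use S in auto)
  finally show ?thesis using False by (simp add: K_def)
qed

abbreviation "loss_transform \<equiv> laplace_transform Q (\<lambda>x. x)"

lemma later_loss_laplace:
  assumes "0 < \<gamma>"
  shows "expectation (\<lambda>\<omega>. exp (- \<gamma> * later_loss s \<omega>)) = loss_transform \<gamma> * loss_laplace m \<gamma> s"
proof -
  let ?S = "{Loss (Suc m)}" and ?P = "period_sources m"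
  let ?f = "\<lambda>(\<eta>, \<omega>). exp (- \<gamma> * max 0 (loss R (Suc m) \<eta>)) * exp (- \<gamma> * max 0 (max_loss_upto R m s \<omega>))"
  have i: "Suc m \<in> {1..n}" and "m \<le> n" using m by auto
  note [measurable] = loss_measurable[OF i]
  have S: "?S \<subseteq> all_sources" "?P \<subseteq> all_sources" using m by (auto simp: period_sources_def)
  have "expectation (\<lambda>\<omega>. exp (- \<gamma> * later_loss s \<omega>)) = expectation (\<lambda>\<omega>. ?f (\<omega>, \<omega>))"
  proof (rule integral_cong_AE)
    show "AE \<omega> in M. exp (- \<gamma> * later_loss s \<omega>) = ?f (\<omega>, \<omega>)"
      using AE_loss_nonneg[OF i] AE_max_loss_nonneg[OF \<open>m \<le> n\<close>]
    proof eventually_elim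
      case (elim \<omega>)
      then have "max 0 (loss R (Suc m) \<omega>) = loss R (Suc m) \<omega>" "max 0 (max_loss_upto R m s \<omega>) = max_loss_upto R m s \<omega>"
        by auto
      then show ?case by (simp add: later_loss_def mult_exp_exp algebra_simps)
    qed
  qed (use \<open>m \<le> n\<close> in measurable)
  also have "\<dots> = expectation (\<lambda>\<eta>. expectation (\<lambda>\<omega>. ?f (\<eta>, \<omega>)))"
  proof (rule decouple[of ?S ?P _ 1])
    have [measurable]: "(\<lambda>x. loss R (Suc m) (fst x)) \<in> borel_measurable (info R ?S \<Otimes>\<^sub>M info R ?P)"
      by (intro measurable_compose[OF measurable_fst measurable_info(2)]) simp
    have [measurable]: "(\<lambda>x. max_loss_upto R m s (snd x)) \<in> borel_measurable (info R ?S \<Otimes>\<^sub>M info R ?P)"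
      by (rule measurable_max_loss_upto_compose[OF regular \<open>m \<le> n\<close> order_refl _ measurable_snd]) auto
    show "?f \<in> borel_measurable (info R ?S \<Otimes>\<^sub>M info R ?P)"
      unfolding split_beta' by measurable
    show "?S \<inter> ?P = {}" by (auto simp: period_sources_def)
    show "\<bar>?f (x, y)\<bar> \<le> 1" for x y
      using assms by (auto simp: abs_mult intro!: mult_le_one)
  qed (use S in auto)
  also have "\<dots> = expectation (\<lambda>\<eta>. exp (- \<gamma> * max 0 (loss R (Suc m) \<eta>))) * loss_laplace m \<gamma> s"
    by (simp add: loss_laplace_def)
  also have "expectation (\<lambda>\<eta>. exp (- \<gamma> * max 0 (loss R (Suc m) \<eta>))) = expectation (\<lambda>\<eta>. exp (- \<gamma> * loss R (Suc m) \<eta>))"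
  proof (rule integral_cong_AE)
    show "AE \<omega> in M. exp (- \<gamma> * max 0 (loss R (Suc m) \<omega>)) = exp (- \<gamma> * loss R (Suc m) \<omega>)"
      using AE_loss_nonneg[OF i] by eventually_elim simp
  qed measurable
  also have "\<dots> = loss_transform \<gamma>"
    unfolding laplace_transform_def by (subst loss_law[OF i, symmetric], subst integral_distr) auto
  finally show ?thesis .
qed

lemma AE_later_loss_nonneg: "AE \<omega> in M. 0 \<le> later_loss s \<omega>"
proof -
  have "Suc m \<in> {1..n}" "m \<le> n" using m by auto
  from AE_loss_nonneg[OF this(1)] AE_max_loss_nonneg[OF this(2)]
  show ?thesis by eventually_elim (simp add: later_loss_def)
qed

lemma integrable_later_loss: "0 < \<gamma> \<Longrightarrow> integrable M (\<lambda>\<omega>. exp (- \<gamma> * later_loss s \<omega>))"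
  using AE_later_loss_nonneg[of s] by (intro integrable_const_bound[where B=1]) (auto elim!: eventually_mono)

lemma integral_K:
  assumes "0 < \<gamma>" "\<gamma> \<noteq> bm.\<nu>m" "0 \<le> y"
  shows "(\<integral>t. K \<gamma> t y \<partial>exp_law q)
    = bm.\<nu>p / (bm.\<nu>p + \<gamma>) * ((bm.\<nu>m * exp (- \<gamma> * y) - \<gamma> * exp (- bm.\<nu>m * y)) / (bm.\<nu>m - \<gamma>))"
  unfolding K_def bm.wiener_hopf[OF assms(1)] using assms bm.\<nu>_pos by (subst exp_law_overshoot) auto

text \<open>The race between default and horizon yields an exponential time with rate \<open>q\<close> and a fresh horizon.
  After exchanging integrals the Wiener-Hopf factorization is applied for each fixed value of the later
  loss; what it leaves is linear in the transforms of the later loss at \<open>\<gamma>\<close> and \<open>\<nu>\<^sup>-\<close>.\<close>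

theorem killed_loss_laplace_Suc:
  assumes \<gamma>: "0 < \<gamma>" "\<gamma> \<noteq> bm.\<nu>m"
  shows "killed_loss_laplace (Suc m) \<gamma> = bm.\<nu>p / (bm.\<nu>p + \<gamma>) * (\<theta> / q + rate / q *
    ((bm.\<nu>m * (loss_transform \<gamma> * killed_loss_laplace m \<gamma>) - \<gamma> * (loss_transform bm.\<nu>m * killed_loss_laplace m bm.\<nu>m)) / (bm.\<nu>m - \<gamma>)))"
proof -
  have q: "0 < q" using rate \<theta> by simp
  have "m \<le> n" using m by simp
  interpret E: prob_space "exp_law \<theta>" using \<theta> by (rule prob_space_exponential_density)
  interpret Eq: prob_space "exp_law q" using q by (rule prob_space_exponential_density)
  interpret Er: prob_space "exp_law rate" using rate by (rule prob_space_exponential_density)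
  interpret N: pair_prob_space "exp_law \<theta>" M ..
  interpret T: pair_prob_space "exp_law q" "exp_law \<theta> \<Otimes>\<^sub>M M" ..
  let ?c = "bm.\<nu>p / (bm.\<nu>p + \<gamma>)"
  let ?I = "\<lambda>s \<omega>. \<integral>t. K \<gamma> t (later_loss s \<omega>) \<partial>exp_law q"
  let ?ex = "\<lambda>s \<omega>. ?c * ((bm.\<nu>m * exp (- \<gamma> * later_loss s \<omega>) - \<gamma> * exp (- bm.\<nu>m * later_loss s \<omega>)) / (bm.\<nu>m - \<gamma>))"
  let ?lin = "\<lambda>s. ?c * ((bm.\<nu>m * (loss_transform \<gamma> * loss_laplace m \<gamma> s) - \<gamma> * (loss_transform bm.\<nu>m * loss_laplace m bm.\<nu>m s)) / (bm.\<nu>m - \<gamma>))"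
  define G where "G t s = (\<integral>\<omega>. K \<gamma> t (later_loss s \<omega>) \<partial>M)" for t s
  have "killed_loss_laplace (Suc m) \<gamma> = (\<integral>e. \<integral>t. (if e < t then K \<gamma> e 0 else G t (e - t)) \<partial>exp_law rate \<partial>exp_law \<theta>)"
    unfolding killed_loss_laplace_def
  proof (rule integral_cong_AE)
    show "(\<lambda>e. \<integral>t. (if e < t then K \<gamma> e 0 else G t (e - t)) \<partial>exp_law rate) \<in> borel_measurable (exp_law \<theta>)"
      unfolding G_def by measurable
    show "loss_laplace (Suc m) \<gamma> \<in> borel_measurable (exp_law \<theta>)"
      using m by simp
    have "loss_laplace (Suc m) \<gamma> e = (\<integral>t. (if e < t then K \<gamma> e 0 else G t (e - t)) \<partial>exp_law rate)" if e: "0 < e" for e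
      unfolding condition_on_default[OF \<gamma>(1)]
    proof (rule integral_cong_AE)
      show "AE t in exp_law rate. expectation (\<lambda>\<omega>. exp (- \<gamma> * max 0 (step t e \<omega>)))
          = (if e < t then K \<gamma> e 0 else G t (e - t))"
        using AE_exp_law_pos[OF rate]
      proof eventually_elim
        case (elim t)
        then show ?case using condition_on_motion[OF \<gamma>(1) elim, of e] e by (simp add: G_def)
      qed
      show "(\<lambda>t. if e < t then K \<gamma> e 0 else G t (e - t)) \<in> borel_measurable (exp_law rate)"
        unfolding G_def by measurable
      show "(\<lambda>t. expectation (\<lambda>\<omega>. exp (- \<gamma> * max 0 (step t e \<omega>)))) \<in> borel_measurable (exp_law rate)"
        using measurable_step_laplace by simp
    qed
    then show "AE e in exp_law \<theta>. loss_laplace (Suc m) \<gamma> e = (\<integral>t. (if e < t then K \<gamma> e 0 else G t (e - t)) \<partial>exp_law rate)"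
      using AE_exp_law_pos[OF \<theta>] by (auto elim!: eventually_mono)
  qed
  also have "\<dots> = \<theta> / q * (\<integral>e. K \<gamma> e 0 \<partial>exp_law q) + rate / q * (\<integral>t. \<integral>s. G t s \<partial>exp_law \<theta> \<partial>exp_law q)"
  proof (rule exp_law_race[OF rate \<theta>])
    show "(\<lambda>e. K \<gamma> e 0) \<in> borel_measurable borel" by measurable
    show "case_prod G \<in> borel_measurable (borel \<Otimes>\<^sub>M borel)"
      unfolding G_def split_beta' by measurable
    show "\<bar>K \<gamma> x 0\<bar> \<le> 1" for x using \<gamma> by (intro K_le)
    show "\<bar>G t s\<bar> \<le> 1" for t s unfolding G_def using \<gamma> by (intro abs_expectation_le K_le)
  qed
  also have "(\<integral>e. K \<gamma> e 0 \<partial>exp_law q) = ?c"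
    using integral_K[of \<gamma> 0] \<gamma> by simp
  also have "(\<integral>t. \<integral>s. G t s \<partial>exp_law \<theta> \<partial>exp_law q) = (\<integral>t. \<integral>(s, \<omega>). K \<gamma> t (later_loss s \<omega>) \<partial>(exp_law \<theta> \<Otimes>\<^sub>M M) \<partial>exp_law q)"
  proof (rule Bochner_Integration.integral_cong[OF refl])
    fix t
    have "integrable (exp_law \<theta> \<Otimes>\<^sub>M M) (\<lambda>(s, \<omega>). K \<gamma> t (later_loss s \<omega>))"
      using K_le[OF \<gamma>(1)] unfolding split_beta' by (intro N.P.integrable_const_bound[where B=1]) auto
    from N.integral_fst'[OF this] show "(\<integral>s. G t s \<partial>exp_law \<theta>) = (\<integral>(s, \<omega>). K \<gamma> t (later_loss s \<omega>) \<partial>(exp_law \<theta> \<Otimes>\<^sub>M M))"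
      by (simp add: G_def)
  qed
  also have "\<dots> = (\<integral>(s, \<omega>). ?I s \<omega> \<partial>(exp_law \<theta> \<Otimes>\<^sub>M M))"
  proof -
    have "integrable (exp_law q \<Otimes>\<^sub>M (exp_law \<theta> \<Otimes>\<^sub>M M)) (\<lambda>(t, s, \<omega>). K \<gamma> t (later_loss s \<omega>))"
      using K_le[OF \<gamma>(1)] unfolding split_beta' by (intro T.P.integrable_const_bound[where B=1]) auto
    from T.Fubini_integral[of "\<lambda>t (s, \<omega>). K \<gamma> t (later_loss s \<omega>)"] this show ?thesis
      by (simp add: split_beta')
  qed
  also have "\<dots> = (\<integral>s. \<integral>\<omega>. ?I s \<omega> \<partial>M \<partial>exp_law \<theta>)"
  proof -
    have "integrable (exp_law \<theta> \<Otimes>\<^sub>M M) (\<lambda>(s, \<omega>). ?I s \<omega>)"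
    proof (rule N.P.integrable_const_bound[where B=1])
      show "AE x in exp_law \<theta> \<Otimes>\<^sub>M M. norm (case x of (s, \<omega>) \<Rightarrow> ?I s \<omega>) \<le> 1"
        using K_le[OF \<gamma>(1)] by (intro AE_I2) (auto intro!: Eq.abs_expectation_le)
      show "(\<lambda>(s, \<omega>). ?I s \<omega>) \<in> borel_measurable (exp_law \<theta> \<Otimes>\<^sub>M M)"
        unfolding split_beta' by measurable
    qed
    from N.integral_fst'[OF this] show ?thesis by simp
  qed
  also have "\<dots> = (\<integral>s. ?lin s \<partial>exp_law \<theta>)"
  proof (rule Bochner_Integration.integral_cong[OF refl])
    fix s
    have "(\<integral>\<omega>. ?I s \<omega> \<partial>M)
      = (\<integral>\<omega>. ?ex s \<omega> \<partial>M)"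
    proof (rule integral_cong_AE)
      show "AE \<omega> in M. (?I s \<omega>)
        = ?ex s \<omega>"
        using AE_later_loss_nonneg[of s] by eventually_elim (rule integral_K[OF \<gamma>])
    qed measurable
    also have "\<dots> = ?lin s"
      using integrable_later_loss[of \<gamma> s] integrable_later_loss[of bm.\<nu>m s] later_loss_laplace[of \<gamma> s] later_loss_laplace[of bm.\<nu>m s] \<gamma> bm.\<nu>_pos
      by simp
    finally show "(\<integral>\<omega>. ?I s \<omega> \<partial>M)
      = ?lin s" .
  qed
  also have "\<dots> = ?c * ((bm.\<nu>m * (loss_transform \<gamma> * killed_loss_laplace m \<gamma>) - \<gamma> * (loss_transform bm.\<nu>m * killed_loss_laplace m bm.\<nu>m)) / (bm.\<nu>m - \<gamma>))"
  proof -
    have "integrable (exp_law \<theta>) (loss_laplace m \<gamma>)" "integrable (exp_law \<theta>) (loss_laplace m bm.\<nu>m)"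
      using \<theta> loss_laplace_le[of \<gamma> m] loss_laplace_le[of bm.\<nu>m m] \<gamma> bm.\<nu>_pos \<open>m \<le> n\<close>
      by (auto intro!: integrable_exp_law_bounded[where B=1])
    then show ?thesis by (simp add: killed_loss_laplace_def)
  qed
  finally show ?thesis by (simp add: algebra_simps)
qed

end

section \<open>The transform of the ruin probability\<close>

context obligor_process
begin

lemma killed_loss_laplace_0 [simp]: "killed_loss_laplace 0 \<gamma> = 1"
proof -
  interpret E: prob_space "exp_law \<theta>" using \<theta> by (rule prob_space_exponential_density)
  show ?thesis using prob_space E.prob_space by (simp add: killed_loss_laplace_def loss_laplace_def)
qed

lemma measurable_horizon [measurable]: "horizon R \<in> borel_measurable M"
  using distributed_measurable[OF horizon_law] by simp

lemma killed_loss_laplace_right_continuous: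
  assumes "m \<le> n" "0 < \<gamma>"
  shows "(\<lambda>k. killed_loss_laplace m (\<gamma> + mesh k)) \<longlonglongrightarrow> killed_loss_laplace m \<gamma>"
proof -
  let ?Z = "\<lambda>\<omega>. max 0 (max_loss_upto R m (horizon R \<omega>) \<omega>)"
  have pos: "0 < \<gamma> + mesh k" for k using assms mesh(1)[of k] by simp
  have "(\<lambda>k. expectation (\<lambda>\<omega>. exp (- (\<gamma> + mesh k) * ?Z \<omega>))) \<longlonglongrightarrow> expectation (\<lambda>\<omega>. exp (- \<gamma> * ?Z \<omega>))"
  proof (rule integral_dominated_convergence)
    show "integrable M (\<lambda>_. 1::real)" by simp
    show "(\<lambda>\<omega>. exp (- \<gamma> * ?Z \<omega>)) \<in> borel_measurable M" "(\<lambda>\<omega>. exp (- (\<gamma> + mesh k) * ?Z \<omega>)) \<in> borel_measurable M" for k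
      using assms by measurable
    have "(\<lambda>k. exp (- (\<gamma> + mesh k) * z)) \<longlonglongrightarrow> exp (- (\<gamma> + 0) * z)" for z
      by (intro tendsto_intros mesh_tendsto)
    then show "AE \<omega> in M. (\<lambda>k. exp (- (\<gamma> + mesh k) * ?Z \<omega>)) \<longlonglongrightarrow> exp (- \<gamma> * ?Z \<omega>)" by simp
    have "0 \<le> (\<gamma> + mesh k) * ?Z \<omega>" for k \<omega> using pos[of k] by (intro mult_nonneg_nonneg) auto
    then show "AE \<omega> in M. norm (exp (- (\<gamma> + mesh k) * ?Z \<omega>)) \<le> 1" for k
      unfolding mult_minus_left by simp
  qed
  then show ?thesis
    unfolding expectation_killed[OF assms] expectation_killed[OF assms(1) pos] .
qed

text \<open>\<open>\<gamma>\<close> times the transform is the probability that the maximal net loss reaches an independent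
  exponential level with rate \<open>\<gamma>\<close>.\<close>

lemma ruin_transform_eq:
  assumes "0 < \<gamma>"
  shows "ruin_transform R n \<gamma> = (1 - killed_loss_laplace n \<gamma>) / \<gamma>"
proof -
  interpret E: prob_space "exp_law \<gamma>" using assms by (rule prob_space_exponential_density)
  interpret pair: pair_prob_space "exp_law \<gamma>" M ..
  define Z where "Z \<omega> = max_loss_upto R n (horizon R \<omega>) \<omega>" for \<omega>
  have Z [measurable]: "Z \<in> borel_measurable M" unfolding Z_def by measurable
  have prob: "ruin_prob R n u = (\<integral>\<omega>. indicator {..Z \<omega>} u \<partial>M)" for u
  proof -
    have "ruin_prob R n u = measure M {\<omega> \<in> space M. u \<le> Z \<omega>}"
      unfolding ruin_prob_def Z_def
      by (intro arg_cong[where f="measure M"]) (auto simp: max_net_loss_eq[OF regular horizon_nonneg])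
    also have "\<dots> = (\<integral>\<omega>. indicator {\<omega> \<in> space M. u \<le> Z \<omega>} \<omega> \<partial>M)" by simp
    also have "\<dots> = (\<integral>\<omega>. indicator {..Z \<omega>} u \<partial>M)"
      by (rule Bochner_Integration.integral_cong[OF refl]) (auto split: split_indicator)
    finally show ?thesis .
  qed
  have [measurable]: "(\<lambda>u. ruin_prob R n u) \<in> borel_measurable borel"
    unfolding prob indicator_def atMost_iff by measurable
  have "ruin_transform R n \<gamma> = (\<integral>u. 1 / \<gamma> * (exponential_density \<gamma> u * ruin_prob R n u) \<partial>lborel)"
    unfolding ruin_transform_def set_lebesgue_integral_def
  proof (rule integral_cong_AE)
    have "AE u in lborel. u \<noteq> (0::real)" by (rule AE_lborel_singleton)
    then show "AE u in lborel. indicator {0<..} u *\<^sub>R (exp (- \<gamma> * u) * ruin_prob R n u) = 1 / \<gamma> * (exponential_density \<gamma> u * ruin_prob R n u)"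
      by eventually_elim (use assms in \<open>auto simp: exponential_density_def mult.commute split: split_indicator\<close>)
  qed measurable
  also have "\<dots> = 1 / \<gamma> * (\<integral>u. ruin_prob R n u \<partial>exp_law \<gamma>)"
    using assms by (subst integral_exp_law) auto
  also have "(\<integral>u. ruin_prob R n u \<partial>exp_law \<gamma>) = (\<integral>\<omega>. \<integral>u. indicator {..Z \<omega>} u \<partial>exp_law \<gamma> \<partial>M)"
  proof -
    have "integrable (exp_law \<gamma> \<Otimes>\<^sub>M M) (\<lambda>(u, \<omega>). indicator {..Z \<omega>} u :: real)"
    proof (rule pair.P.integrable_const_bound[where B=1])
      show "(\<lambda>(u, \<omega>). indicator {..Z \<omega>} u :: real) \<in> borel_measurable (exp_law \<gamma> \<Otimes>\<^sub>M M)"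
        unfolding split_beta' indicator_def atMost_iff by measurable
    qed auto
    from pair.Fubini_integral[OF this] show ?thesis unfolding prob by simp
  qed
  also have "\<dots> = (\<integral>\<omega>. 1 - exp (- \<gamma> * max 0 (Z \<omega>)) \<partial>M)"
    unfolding exp_law_cdf[OF assms] ..
  also have "\<dots> = 1 - killed_loss_laplace n \<gamma>"
  proof -
    have "integrable M (\<lambda>\<omega>. exp (- \<gamma> * max 0 (Z \<omega>)))"
      using assms by (intro integrable_const_bound[where B=1]) auto
    then show ?thesis
      using prob_space expectation_killed[OF order_refl assms] by (simp add: Z_def)
  qed
  finally show ?thesis by simp
qed

end

text \<open>Induction with the recursion, which expresses the value at \<open>\<gamma> \<noteq> \<nu>\<^sup>-\<close> by values with one obligor less.\<close>

lemma killed_loss_laplace_unique: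
  assumes R: "obligor_process R \<theta> lam r v Q n" and R': "obligor_process R' \<theta> lam r v Q n'"
    and "m \<le> n" "m \<le> n'" "0 < \<gamma>"
  shows "obligor_process.killed_loss_laplace R \<theta> m \<gamma> = obligor_process.killed_loss_laplace R' \<theta> m \<gamma>"
  using assms(3-)
proof (induction m arbitrary: \<gamma>)
  case 0
  show ?case using obligor_process.killed_loss_laplace_0[OF R] obligor_process.killed_loss_laplace_0[OF R'] by simp
next
  case (Suc m)
  have "obligor_period R \<theta> lam r v Q n m" "obligor_period R' \<theta> lam r v Q n' m"
    using R R' Suc.prems by (auto simp: obligor_period_def obligor_period_axioms_def)
  then interpret A: obligor_period R \<theta> lam r v Q n m + B: obligor_period R' \<theta> lam r v Q n' m by auto
  have generic: "A.killed_loss_laplace (Suc m) g = B.killed_loss_laplace (Suc m) g" if "0 < g" "g \<noteq> A.bm.\<nu>m" for g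
    using that A.killed_loss_laplace_Suc[OF that] B.killed_loss_laplace_Suc[OF that] Suc.IH[of g] Suc.IH[of A.bm.\<nu>m] Suc.prems A.bm.\<nu>_pos
    by simp
  show ?case
  \<comment> \<open>The recursion does not apply at \<open>\<nu>\<^sup>-\<close> itself; approach it from the right.\<close>
  proof (cases "\<gamma> = A.bm.\<nu>m")
    case True
    have "\<gamma> + mesh k \<noteq> A.bm.\<nu>m" "0 < \<gamma> + mesh k" for k using True Suc.prems mesh(1)[of k] by auto
    then have "A.killed_loss_laplace (Suc m) (\<gamma> + mesh k) = B.killed_loss_laplace (Suc m) (\<gamma> + mesh k)" for k
      by (intro generic)
    then show ?thesis
      using A.killed_loss_laplace_right_continuous[OF Suc.prems(1) Suc.prems(3)]
        B.killed_loss_laplace_right_continuous[OF Suc.prems(2) Suc.prems(3)]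
      by (simp add: LIMSEQ_unique)
  qed (use generic Suc.prems in simp)
qed

lemma transform_algebra:
  fixes \<gamma> \<nu> p a A C :: real
  assumes "0 < \<gamma>" "0 < \<nu>" "0 < p" "\<gamma> \<noteq> \<nu>"
  shows "(1 - p / (p + \<gamma>) * (1 - a + a * ((\<nu> * A - \<gamma> * C) / (\<nu> - \<gamma>)))) / \<gamma>
    = 1 / (\<gamma> + p) + a * (1 / (\<gamma> + p)) * (p / \<gamma>) - a * (\<nu> * p / ((\<gamma> - \<nu>) * (\<gamma> + p))) * (C / \<nu> - A / \<gamma>)"
proof -
  define X where "X = (\<nu> * A - \<gamma> * C) / (\<nu> - \<gamma>)"
  have "\<nu> * p / ((\<gamma> - \<nu>) * (\<gamma> + p)) * (C / \<nu> - A / \<gamma>) = p / (\<gamma> + p) * (X / \<gamma>)"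
  proof -
    have "\<nu> * (C / \<nu> - A / \<gamma>) / (\<gamma> - \<nu>) = X / \<gamma>"
    proof -
      have "\<nu> * (C / \<nu> - A / \<gamma>) = (\<gamma> * C - \<nu> * A) / \<gamma>" using assms by (simp add: field_simps)
      moreover have "X = (\<gamma> * C - \<nu> * A) / (\<gamma> - \<nu>)" unfolding X_def using assms
        by (metis minus_diff_eq minus_divide_divide)
      ultimately show ?thesis by simp
    qed
    then show ?thesis by (metis (no_types, opaque_lifting) times_divide_times_eq mult.commute mult.left_commute times_divide_eq_right times_divide_eq_left)
  qed
  then have "a * (\<nu> * p / ((\<gamma> - \<nu>) * (\<gamma> + p))) * (C / \<nu> - A / \<gamma>) = a * (p / (\<gamma> + p) * (X / \<gamma>))"
    by (simp only: mult.assoc)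
  moreover have "(1 - p / (p + \<gamma>) * (1 - a + a * X)) / \<gamma>
    = 1 / (\<gamma> + p) + a * (1 / (\<gamma> + p)) * (p / \<gamma>) - a * (p / (\<gamma> + p) * (X / \<gamma>))"
  proof -
    have "\<gamma> + p \<noteq> 0" using assms by simp
    then show ?thesis using assms by (simp add: divide_simps add.commute) (simp add: algebra_simps)
  qed
  ultimately show ?thesis by (simp only: X_def)
qed

theorem theorem4p1:
  fixes \<theta> :: real and lam r v :: "nat \<Rightarrow> real"
    and N :: "'b measure" and L :: "'b \<Rightarrow> real"
    and R :: "nat \<Rightarrow> 'a realization"
  assumes "0 < \<theta>"
    and "\<And>i. 1 \<le> i \<Longrightarrow> 0 < lam i"
    and "\<And>i. 1 \<le> i \<Longrightarrow> 0 < r i"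
    and "\<And>i. 1 \<le> i \<Longrightarrow> 0 < v i"
    and "prob_space N" and "L \<in> borel_measurable N" and "\<And>\<omega>. \<omega> \<in> space N \<Longrightarrow> 0 \<le> L \<omega>"
    and "\<And>n. obligor_model \<theta> lam r v (distr N borel L) n (R n)"
  shows "(\<forall>\<gamma>>0. ruin_transform (R 0) 0 \<gamma> = 0) \<and>
    (\<forall>n\<ge>1. \<forall>\<gamma>>0. \<gamma> \<noteq> nu_minus \<theta> lam r v n \<longrightarrow>
      (let \<psi> = (\<lambda>k. ruin_transform (R k) k);
           \<nu>p = nu_plus \<theta> lam r v n;
           \<nu>m = nu_minus \<theta> lam r v n;
           B = B_fun (laplace_transform N L)
       in \<psi> n \<gamma> =
            1 / (\<gamma> + \<nu>p)
            + lam n / (lam n + \<theta>) * (1 / (\<gamma> + \<nu>p)) * (\<nu>p / \<gamma>)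
            - lam n / (lam n + \<theta>) * (\<nu>m * \<nu>p / ((\<gamma> - \<nu>m) * (\<gamma> + \<nu>p)))
              * (B \<nu>m (\<psi> (n - 1) \<nu>m) - B \<gamma> (\<psi> (n - 1) \<gamma>))))"
proof -
  let ?Q = "distr N borel L"
  have "AE x in ?Q. 0 \<le> x" using assms(6,7) by (subst AE_distr_iff) auto
  then have proc: "obligor_process (R n) \<theta> lam r v ?Q n" for n
    using assms by (unfold_locales) auto
  have lt: "laplace_transform ?Q (\<lambda>x. x) \<gamma> = laplace_transform N L \<gamma>" for \<gamma>
    unfolding laplace_transform_def using assms(6) by (subst integral_distr) auto
  have "ruin_transform (R 0) 0 \<gamma> = 0" if "0 < \<gamma>" for \<gamma>
    using obligor_process.ruin_transform_eq[OF proc that, of 0] obligor_process.killed_loss_laplace_0[OF proc, of 0] by simp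
  moreover have "ruin_transform (R n) n \<gamma> = 1 / (\<gamma> + nu_plus \<theta> lam r v n)
      + lam n / (lam n + \<theta>) * (1 / (\<gamma> + nu_plus \<theta> lam r v n)) * (nu_plus \<theta> lam r v n / \<gamma>)
      - lam n / (lam n + \<theta>) * (nu_minus \<theta> lam r v n * nu_plus \<theta> lam r v n / ((\<gamma> - nu_minus \<theta> lam r v n) * (\<gamma> + nu_plus \<theta> lam r v n)))
        * (B_fun (laplace_transform N L) (nu_minus \<theta> lam r v n) (ruin_transform (R (n - 1)) (n - 1) (nu_minus \<theta> lam r v n))
          - B_fun (laplace_transform N L) \<gamma> (ruin_transform (R (n - 1)) (n - 1) \<gamma>))"
    if "1 \<le> n" "0 < \<gamma>" "\<gamma> \<noteq> nu_minus \<theta> lam r v n" for n \<gamma>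
  proof -
    obtain m where n: "n = Suc m" using \<open>1 \<le> n\<close> by (cases n) auto
    interpret obligor_period "R n" \<theta> lam r v ?Q n m
      using proc[of n] n by (simp add: obligor_period_def obligor_period_axioms_def)
    have \<nu>: "nu_plus \<theta> lam r v n = bm.\<nu>p" "nu_minus \<theta> lam r v n = bm.\<nu>m"
      unfolding nu_plus_def nu_minus_def bm.\<nu>p_def bm.\<nu>m_def n by auto
    define l where "l = laplace_transform N L"
    have B: "B_fun l x (ruin_transform (R (n - 1)) (n - 1) x) = l x * killed_loss_laplace m x / x" if "0 < x" for x
    proof -
      have "obligor_process.killed_loss_laplace (R m) \<theta> m x = killed_loss_laplace m x"
        using killed_loss_laplace_unique[OF proc[of m] proc[of n], of m x] n that by simp
      then have "ruin_transform (R (n - 1)) (n - 1) x = (1 - killed_loss_laplace m x) / x"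
        using obligor_process.ruin_transform_eq[OF proc[of m] that] n by simp
      then show ?thesis by (simp add: B_fun_def diff_divide_distrib)
    qed
    have q: "\<theta> / q = 1 - rate / q" using rate \<theta> by (simp add: field_simps)
    have "\<gamma> \<noteq> bm.\<nu>m" using that \<nu> by simp
    have "ruin_transform (R n) n \<gamma> = (1 - killed_loss_laplace (Suc m) \<gamma>) / \<gamma>"
      using ruin_transform_eq[OF that(2)] n by simp
    also have "\<dots> = 1 / (\<gamma> + bm.\<nu>p) + rate / q * (1 / (\<gamma> + bm.\<nu>p)) * (bm.\<nu>p / \<gamma>)
       - rate / q * (bm.\<nu>m * bm.\<nu>p / ((\<gamma> - bm.\<nu>m) * (\<gamma> + bm.\<nu>p)))
         * (l bm.\<nu>m * killed_loss_laplace m bm.\<nu>m / bm.\<nu>m - l \<gamma> * killed_loss_laplace m \<gamma> / \<gamma>)"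
      unfolding killed_loss_laplace_Suc[OF that(2) \<open>\<gamma> \<noteq> bm.\<nu>m\<close>] lt l_def[symmetric] q
      using that(2) bm.\<nu>_pos \<open>\<gamma> \<noteq> bm.\<nu>m\<close> by (intro transform_algebra)
    finally show ?thesis
      unfolding \<nu> l_def[symmetric] B[OF bm.\<nu>_pos(2)] B[OF that(2)] by (simp add: n)
  qed
  ultimately show ?thesis by (simp add: Let_def)
qed

end
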